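(* Let $\mathcal{P}\in\{1||\sum w_jU_j,\;1||\sum w_jT_j\}$, with uncertain due dates and deterministic processing times. Then for any $\epsilon>0$ and each constant $\alpha\in[0,1)$, $\textsc{Min-Exp}~\mathcal{P}$ is approximable within $4+\epsilon$ and $\textsc{Min-CVaR}_\alpha~\mathcal{P}$ is approximable within $\min\{\frac{4+\epsilon}{{\rm Pr}_{\min}},\frac{4+\epsilon}{1-\alpha}\}$.
   Context: Single machine scheduling without precedence constraints: a set $J$ of $n$ jobs with deterministic nonnegative processing times $p_j$ and weights $w_j$; a schedule $\pi$ is a permutation of $J$ processed without idle time from time 0, with completion times $C_j(\pi)$. A scenario set $\mathcal{U}=\{\xi_1,\dots,\xi_K\}$ (part of the input) specifies nonnegative due dates $d_j(\xi)$, with probabilities ${\rm Pr}[\xi_i]>0$ summing to 1; ${\rm Pr}_{\min}=\min_i{\rm Pr}[\xi_i]$. $T_j(\pi,\xi)=\max\{0,C_j(\pi)-d_j(\xi)\}$, $U_j(\pi,\xi)=1$ if $C_j(\pi)>d_j(\xi)$ else $0$; $f(\pi,\xi)=\sum_jw_jU_j(\pi,\xi)$ or $\sum_jw_jT_j(\pi,\xi)$. ${\rm F}(\pi)$ is the random variable equal to $f(\pi,\xi_i)$ with probability ${\rm Pr}[\xi_i]$. $\textsc{Min-Exp}~\mathcal{P}$ minimizes $\mathbf{E}[{\rm F}(\pi)]$; $\textsc{Min-CVaR}_\alpha~\mathcal{P}$ minimizes $\mathbf{CVaR}_\alpha[{\rm F}(\pi)]=\inf_{\gamma}\{\gamma+\frac{1}{1-\alpha}\mathbf{E}[({\rm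 F}(\pi)-\gamma)^+]\}$. "Approximable within $\rho$": a polynomial-time algorithm returns a schedule of objective value at most $\rho$ times the optimum. *)

theory Defs
  imports
    "HOL-Probability.Probability"
    "HOL-Combinatorics.Multiset_Permutations"
    "HOL-Computational_Algebra.Polynomial"
    "HOL-Library.Log_Nat"
begin

section \<open>Polynomial-time computation\<close>

text \<open>
  The model of computation is an untyped first-order functional language over finite
  tree-structured data with integer leaves.  Costs are bit costs: every variable access, constant
  and primitive operation is charged the total bit size of the data it touches (a logarithmic cost
  measure), so that running times agree with those of Turing machines up to a polynomial.
\<close>

datatype dat = IntV int | ListV "dat list"

fun bitsize :: "dat \<Rightarrow> nat" where
  "bitsize (IntV x) = Suc (floorlog 2 (nat \<bar>x\<bar>))"
| "bitsize (ListV xs) = Suc (\<Sum>x\<leftarrow>xs. bitsize x)"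

datatype prim = Add | Sub | Mul | Div | Leq | Empty | Cons_op | Head | Tail | Is_Empty

text \<open>Ill-typed applications yield the integer 0; truth values are the integers 0 and 1.\<close>

fun apply_prim :: "prim \<Rightarrow> dat list \<Rightarrow> dat" where
  "apply_prim Add [IntV x, IntV y] = IntV (x + y)"
| "apply_prim Sub [IntV x, IntV y] = IntV (x - y)"
| "apply_prim Mul [IntV x, IntV y] = IntV (x * y)"
| "apply_prim Div [IntV x, IntV y] = IntV (x div y)"
| "apply_prim Leq [IntV x, IntV y] = IntV (if x \<le> y then 1 else 0)"
| "apply_prim Empty [] = ListV []"
| "apply_prim Cons_op [v, ListV vs] = ListV (v # vs)"
| "apply_prim Head [ListV (v # vs)] = v"
| "apply_prim Tail [ListV (v # vs)] = ListV vs"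
| "apply_prim Is_Empty [ListV vs] = IntV (if vs = [] then 1 else 0)"
| "apply_prim _ _ = IntV 0"

text \<open>
  Variables are de Bruijn indices into the environment.  A program is a list of function bodies
  that may call each other recursively by position.
\<close>

datatype expr =
    Var nat
  | Const int
  | Prim prim "expr list"
  | Let expr expr
  | If expr expr expr
  | Call nat "expr list"

type_synonym program = "expr list"

text \<open>
  \<open>eval P env e v t\<close>: in environment \<open>env\<close>, the expression \<open>e\<close> evaluates to \<open>v\<close> at total cost \<open>t\<close>.
  A nonterminating evaluation has no derivation.
\<close>

inductive eval :: "program \<Rightarrow> dat list \<Rightarrow> expr \<Rightarrow> dat \<Rightarrow> nat \<Rightarrow> bool"
  and evals :: "program \<Rightarrow> dat list \<Rightarrow> expr list \<Rightarrow> dat list \<Rightarrow> nat \<Rightarrow> bool"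
  for P :: program
  where
  eval_Var: "i < length env \<Longrightarrow> eval P env (Var i) (env ! i) (bitsize (env ! i))"
| eval_Const: "eval P env (Const c) (IntV c) (bitsize (IntV c))"
| eval_Prim: "evals P env es vs t \<Longrightarrow> v = apply_prim f vs \<Longrightarrow>
    eval P env (Prim f es) v (t + (\<Sum>u\<leftarrow>vs. bitsize u) + bitsize v)"
| eval_Let: "eval P env e1 v1 t1 \<Longrightarrow> eval P (v1 # env) e2 v2 t2 \<Longrightarrow>
    eval P env (Let e1 e2) v2 (Suc (t1 + t2))"
| eval_If_true: "eval P env b u t1 \<Longrightarrow> u \<noteq> IntV 0 \<Longrightarrow> eval P env e1 v t2 \<Longrightarrow>
    eval P env (If b e1 e2) v (Suc (t1 + t2))"
| eval_If_false: "eval P env b u t1 \<Longrightarrow> u = IntV 0 \<Longrightarrow> eval P env e2 v t2 \<Longrightarrow>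
    eval P env (If b e1 e2) v (Suc (t1 + t2))"
| eval_Call: "evals P env es vs t1 \<Longrightarrow> f < length P \<Longrightarrow> eval P vs (P ! f) v t2 \<Longrightarrow>
    eval P env (Call f es) v (Suc (t1 + t2))"
| evals_Nil: "evals P env [] [] 0"
| evals_Cons: "eval P env e v t1 \<Longrightarrow> evals P env es vs t2 \<Longrightarrow>
    evals P env (e # es) (v # vs) (t1 + t2)"

inductive_cases eval_VarE: "eval P env (Var i) v t"
inductive_cases eval_ConstE: "eval P env (Const c) v t"
inductive_cases eval_PrimE: "eval P env (Prim f es) v t"
inductive_cases eval_LetE: "eval P env (Let e1 e2) v t"
inductive_cases eval_IfE: "eval P env (If b e1 e2) v t"
inductive_cases eval_CallE: "eval P env (Call f es) v t"
inductive_cases evals_NilE: "evals P env [] vs t"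
inductive_cases evals_ConsE: "evals P env (e # es) vs t"

lemma eval_deterministic:
  "eval P env e v t \<Longrightarrow> (\<And>v' t'. eval P env e v' t' \<Longrightarrow> v' = v \<and> t' = t)"
  "evals P env es vs t \<Longrightarrow> (\<And>vs' t'. evals P env es vs' t' \<Longrightarrow> vs' = vs \<and> t' = t)"
proof (induction rule: eval_evals.inducts)
  case (eval_Var i env) then show ?case by (auto elim: eval_VarE)
next
  case (eval_Const env c) then show ?case by (auto elim: eval_ConstE)
next
  case (eval_Prim env es vs t v f)
  then show ?case by (elim eval_PrimE) blast
next
  case (eval_Let env e1 v1 t1 e2 v2 t2)
  then show ?case by (elim eval_LetE) blast
next
  case (eval_If_true env b u t1 e1 v t2 e2)
  then show ?case by (elim eval_IfE) blast+
next
  case (eval_If_false env b u t1 e2 v t2 e1)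
  then show ?case by (elim eval_IfE) blast+
next
  case (eval_Call env es vs t1 f v t2)
  then show ?case by (elim eval_CallE) blast
next
  case (evals_Nil env) then show ?case by (auto elim: evals_NilE)
next
  case (evals_Cons env e v t1 es vs t2)
  then show ?case by (elim evals_ConsE) blast
qed

text \<open>Function 0 of a program is its entry point.\<close>

definition runs :: "program \<Rightarrow> dat \<Rightarrow> dat \<Rightarrow> nat \<Rightarrow> bool" where
  "runs P x y t \<longleftrightarrow> eval P [x] (Call 0 [Var 0]) y t"

text \<open>\<open>A\<close> is computable in time polynomial in the bit size of its encoded input, on the inputs \<open>D\<close>.\<close>

definition polynomial_time_on ::
    "'a set \<Rightarrow> ('a \<Rightarrow> dat) \<Rightarrow> ('b \<Rightarrow> dat) \<Rightarrow> ('a \<Rightarrow> 'b) \<Rightarrow> bool" where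
  "polynomial_time_on D enc_in enc_out A \<longleftrightarrow>
     (\<exists>(P :: program) (q :: nat poly). \<forall>x\<in>D.
        \<exists>t \<le> poly q (bitsize (enc_in x)). runs P (enc_in x) (enc_out (A x)) t)"


section \<open>Single machine scheduling with uncertain due dates\<close>

text \<open>
  The jobs are \<open>0, \<dots>, n - 1\<close>.  Each scenario is given by its probability and the list of the due
  dates of the jobs under it.  Numerical data are rational, as they are part of the input.
\<close>

record sched =
  ptimes :: "rat list"
  weights :: "rat list"
  scenarios :: "(rat \<times> rat list) list"

definition num_jobs :: "sched \<Rightarrow> nat" where
  "num_jobs I = length (ptimes I)"

definition num_scenarios :: "sched \<Rightarrow> nat" where
  "num_scenarios I = length (scenarios I)"

definition prob :: "sched \<Rightarrow> nat \<Rightarrow> rat" where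
  "prob I i = fst (scenarios I ! i)"

definition due :: "sched \<Rightarrow> nat \<Rightarrow> nat \<Rightarrow> rat" where
  "due I i j = snd (scenarios I ! i) ! j"

definition valid_inst :: "sched \<Rightarrow> bool" where
  "valid_inst I \<longleftrightarrow>
     length (weights I) = num_jobs I \<and>
     (\<forall>i < num_scenarios I. length (snd (scenarios I ! i)) = num_jobs I) \<and>
     (\<forall>j < num_jobs I. ptimes I ! j \<ge> 0 \<and> weights I ! j \<ge> 0) \<and>
     (\<forall>i < num_scenarios I. \<forall>j < num_jobs I. due I i j \<ge> 0) \<and>
     (\<forall>i < num_scenarios I. prob I i > 0) \<and>
     (\<Sum>i < num_scenarios I. prob I i) = 1"

text \<open>A schedule lists the jobs in the order in which they are processed.\<close>

definition schedules :: "sched \<Rightarrow> nat list set" where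
  "schedules I = permutations_of_set {..<num_jobs I}"

lemma finite_schedules: "finite (schedules I)"
  and schedules_nonempty: "schedules I \<noteq> {}"
  by (simp_all add: schedules_def)

definition completion :: "sched \<Rightarrow> nat list \<Rightarrow> nat \<Rightarrow> rat" where
  "completion I \<pi> j = (\<Sum>k\<leftarrow>takeWhile (\<lambda>k. k \<noteq> j) \<pi>. ptimes I ! k) + ptimes I ! j"

definition tardiness :: "sched \<Rightarrow> nat list \<Rightarrow> nat \<Rightarrow> nat \<Rightarrow> rat" where
  "tardiness I \<pi> i j = max 0 (completion I \<pi> j - due I i j)"

definition late :: "sched \<Rightarrow> nat list \<Rightarrow> nat \<Rightarrow> nat \<Rightarrow> rat" where
  "late I \<pi> i j = (if completion I \<pi> j > due I i j then 1 else 0)"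

text \<open>The two problems \<open>1||\<Sum>w\<^sub>jU\<^sub>j\<close> and \<open>1||\<Sum>w\<^sub>jT\<^sub>j\<close>.\<close>

datatype problem = Sum_wU | Sum_wT

fun cost :: "problem \<Rightarrow> sched \<Rightarrow> nat list \<Rightarrow> nat \<Rightarrow> rat" where
  "cost Sum_wU I \<pi> i = (\<Sum>j < num_jobs I. weights I ! j * late I \<pi> i j)"
| "cost Sum_wT I \<pi> i = (\<Sum>j < num_jobs I. weights I ! j * tardiness I \<pi> i j)"

definition scenario_pmf :: "sched \<Rightarrow> nat pmf" where
  "scenario_pmf I = pmf_of_list (map (\<lambda>i. (i, of_rat (prob I i))) [0..<num_scenarios I])"

text \<open>The distribution of the random cost \<open>F(\<pi>)\<close>.\<close>

definition random_cost :: "problem \<Rightarrow> sched \<Rightarrow> nat list \<Rightarrow> real pmf" where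
  "random_cost Q I \<pi> = map_pmf (\<lambda>i. of_rat (cost Q I \<pi> i)) (scenario_pmf I)"

definition CVaR :: "real \<Rightarrow> real pmf \<Rightarrow> real" where
  "CVaR \<alpha> X =
     (INF \<gamma>. \<gamma> + 1 / (1 - \<alpha>) * measure_pmf.expectation X (\<lambda>x. max 0 (x - \<gamma>)))"

definition min_exp_objective :: "problem \<Rightarrow> sched \<Rightarrow> nat list \<Rightarrow> real" where
  "min_exp_objective Q I \<pi> = measure_pmf.expectation (random_cost Q I \<pi>) (\<lambda>x. x)"

definition min_cvar_objective :: "real \<Rightarrow> problem \<Rightarrow> sched \<Rightarrow> nat list \<Rightarrow> real" where
  "min_cvar_objective \<alpha> Q I \<pi> = CVaR \<alpha> (random_cost Q I \<pi>)"

definition prob_min :: "sched \<Rightarrow> real" where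
  "prob_min I = of_rat (Min (prob I ` {..<num_scenarios I}))"


section \<open>Approximability\<close>

definition enc_rat :: "rat \<Rightarrow> dat" where
  "enc_rat r = (case quotient_of r of (a, b) \<Rightarrow> ListV [IntV a, IntV b])"

definition enc_inst :: "sched \<Rightarrow> dat" where
  "enc_inst I = ListV
     [ListV (map enc_rat (ptimes I)),
      ListV (map enc_rat (weights I)),
      ListV (map (\<lambda>(r, ds). ListV [enc_rat r, ListV (map enc_rat ds)]) (scenarios I))]"

definition enc_schedule :: "nat list \<Rightarrow> dat" where
  "enc_schedule \<pi> = ListV (map (\<lambda>j. IntV (int j)) \<pi>)"

text \<open>The ratio \<open>\<rho>\<close> may depend on the instance.\<close>

definition approximable_within ::
    "(sched \<Rightarrow> nat list \<Rightarrow> real) \<Rightarrow> (sched \<Rightarrow> real) \<Rightarrow> bool" where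
  "approximable_within objective \<rho> \<longleftrightarrow>
     (\<exists>A. polynomial_time_on {I. valid_inst I} enc_inst enc_schedule A \<and>
        (\<forall>I. valid_inst I \<longrightarrow>
           A I \<in> schedules I \<and>
           objective I (A I) \<le> \<rho> I * Min (objective I ` schedules I)))"

end

theory Submission
  imports Defs
begin

text \<open>
  By linearity, the expected cost is \<open>\<Sum>j. f\<^sub>j(C\<^sub>j)\<close> with nondecreasing \<open>f\<^sub>j\<close>, and a schedule amounts
  to deadlines \<open>\<sigma> j\<close> such that for each time \<open>b\<close> the jobs with \<open>\<sigma> j > b\<close> have total processing time
  at least \<open>T - b\<close>, where \<open>T\<close> is the total processing time; the jobs are then processed by earliest
  deadline.  After scaling to integers, the deadlines can be restricted to polynomially many
  breakpoints (due dates plus geometrically growing offsets) at the loss of a factor \<open>1 + 1/m\<close>.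

  The deadlines are computed by the primal-dual algorithm of Cheung, Mestre, Shmoys and Verschae,
  in local-ratio form.  As long as some demand is unmet, take the breakpoint \<open>b\<close> of largest residual
  demand \<open>R\<close>, and subtract a multiple of \<open>min (p j) R\<close> from the cost of every move of a job \<open>j\<close> from a
  deadline at most \<open>b\<close> to a deadline beyond \<open>b\<close>, until such a move becomes free; perform it.  At the
  end, revert the moves in reverse order wherever this keeps all demands met.  Every feasible
  solution pays at least \<open>R\<close> for the subtracted part, and a minimal one at most \<open>4 R\<close>.

  For \<open>CVaR\<close>, the same schedule works, since
  \<open>E[F] \<le> CVaR[F] \<le> min (E[F] / (1 - \<alpha>)) (E[F] / Pr\<^sub>m\<^sub>i\<^sub>n)\<close>.
\<close>

section \<open>A primal-dual algorithm for covering by deadlines\<close>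

text \<open>Local ratio rests on an exact decomposition of the cost: the subtracted part charges
  every job that crosses the worst breakpoint in proportion to its capped size
  \<open>min (p j) R\<close>. The truncation at \<open>R\<close> is that of knapsack-cover
  inequalities; it limits the overshoot of a minimal solution, since a single oversized job counts
  only \<open>R\<close>. Undoing in reverse order matters because minimality is needed relative to
  every intermediate state, not only at the end: the predicate \<open>solves\<close> carries
  criticality backwards through the moves. Pooling the due dates of all jobs and scenarios into one
  grid makes a single rounding of a completion time good for all scenarios at once. For the running
  time the obstacle is the growth of numbers: integrality is bought by multiplying the costs by a
  capped size in each step, which is harmless because there are polynomially many steps and each
  adds about the bits of the load. Programs are never written out as a whole: closure properties of
  a predicate \<open>computes\<close> assemble them, with all bounds stated in the size of the
  original input.\<close>

definition select :: "('a \<Rightarrow> 'a \<Rightarrow> bool) \<Rightarrow> 'a list \<Rightarrow> 'a" where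
  "select le xs = fold (\<lambda>l a. if le l a then l else a) (tl xs) (hd xs)"

lemma fold_select_mem: "fold (\<lambda>l a. if le l a then l else a) xs a \<in> insert a (set xs)"
proof (induction xs arbitrary: a)
  case (Cons x xs)
  show ?case using Cons.IH[of "if le x a then x else a"] by (auto split: if_splits)
qed simp

lemma select_mem: "xs \<noteq> [] \<Longrightarrow> select le xs \<in> set xs"
  unfolding select_def using fold_select_mem[of le "tl xs" "hd xs"] by (cases xs) auto

text \<open>The order properties are assumed on members of the list because the comparison of ratios
  in \<open>pick\<close> can fail to be transitive where a capped size is zero; for candidates it is
  positive.\<close>

lemma select_le:
  assumes "xs \<noteq> []" "l \<in> set xs"
    and total: "\<And>x y. x \<in> set xs \<Longrightarrow> y \<in> set xs \<Longrightarrow> le x y \<or> le y x"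
    and trans: "\<And>x y z. x \<in> set xs \<Longrightarrow> y \<in> set xs \<Longrightarrow> z \<in> set xs \<Longrightarrow> le x y \<Longrightarrow> le y z \<Longrightarrow> le x z"
  shows "le (select le xs) l"
proof -
  let ?f = "\<lambda>l a. if le l a then l else a"
  have "\<forall>l\<in>insert a (set ys). le (fold ?f ys a) l" if "insert a (set ys) \<subseteq> set xs" for ys a
    using that
  proof (induction ys arbitrary: a)
    case Nil then show ?case using total[of a a] by auto
  next
    case (Cons y ys)
    let ?m = "fold ?f ys (?f y a)"
    have sub: "insert (?f y a) (set ys) \<subseteq> set xs" using Cons.prems by auto
    have IH: "\<forall>l\<in>insert (?f y a) (set ys). le ?m l" by (rule Cons.IH[OF sub])
    have m: "?m \<in> set xs" using fold_select_mem[of le ys "?f y a"] sub by blast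
    have "le (?f y a) y" "le (?f y a) a"
      using total[of y a] total[of y y] total[of a a] Cons.prems by auto
    then have "le ?m y" "le ?m a"
      using IH m sub Cons.prems trans[of ?m "?f y a"] by (auto split del: if_split)
    then show ?case using IH by auto
  qed
  from this[of "hd xs" "tl xs"] show ?thesis
    using assms(1,2) unfolding select_def by (cases xs) auto
qed

section \<open>Demands at breakpoints and one step of the primal-dual algorithm\<close>

definition load :: "nat \<Rightarrow> (nat \<Rightarrow> int) \<Rightarrow> int" where
  "load n p = (\<Sum>j\<leftarrow>[0..<n]. p j)"

definition demand :: "nat \<Rightarrow> (nat \<Rightarrow> int) \<Rightarrow> (nat \<Rightarrow> int) \<Rightarrow> int \<Rightarrow> int" where
  "demand n p r b = load n p - b - (\<Sum>j\<leftarrow>[0..<n]. if b < r j then p j else 0)"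

definition worst :: "nat \<Rightarrow> (nat \<Rightarrow> int) \<Rightarrow> int list \<Rightarrow> (nat \<Rightarrow> int) \<Rightarrow> int" where
  "worst n p B r = select (\<lambda>b a. demand n p r a \<le> demand n p r b) B"

text \<open>Evaluated at the worst breakpoint, so that a single selection decides it;
  \<open>covers_iff\<close> turns this into a statement about all breakpoints.\<close>

definition covers :: "nat \<Rightarrow> (nat \<Rightarrow> int) \<Rightarrow> int list \<Rightarrow> (nat \<Rightarrow> int) \<Rightarrow> bool" where
  "covers n p B r \<longleftrightarrow> demand n p r (worst n p B r) \<le> 0"

text \<open>The truncation of knapsack-cover inequalities: in \<open>capped_sum_le_two\<close> it
  bounds the share of the one job that criticality leaves out by the residual demand.\<close>

definition cap :: "nat \<Rightarrow> (nat \<Rightarrow> int) \<Rightarrow> int list \<Rightarrow> (nat \<Rightarrow> int) \<Rightarrow> nat \<Rightarrow> int" where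
  "cap n p B r j = min (p j) (demand n p r (worst n p B r))"

text \<open>Jobs of size zero are left out, so that the capped size, the denominator of the ratio
  minimized by \<open>pick\<close>, is positive while demand is unmet.\<close>

definition candidates :: "nat \<Rightarrow> (nat \<Rightarrow> int) \<Rightarrow> int list \<Rightarrow> (nat \<Rightarrow> int) \<Rightarrow> (nat \<times> int) list" where
  "candidates n p B r = concat (map (\<lambda>j. map (\<lambda>u. (j, u)) (filter (\<lambda>u. worst n p B r < u) B))
     (filter (\<lambda>j. r j \<le> worst n p B r \<and> 0 < p j) [0..<n]))"

text \<open>Minimizes the ratio of \<open>g j u\<close> to the capped size of \<open>j\<close>,
  cross-multiplied to stay in the integers. This ratio is the largest multiple of the capped sizes
  that can be subtracted from all crossing moves without a negative cost.\<close>

definition pick :: "nat \<Rightarrow> (nat \<Rightarrow> int) \<Rightarrow> int list \<Rightarrow> (nat \<Rightarrow> int) \<Rightarrow> (nat \<Rightarrow> int \<Rightarrow> int) \<Rightarrow> nat \<times> int" where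
  "pick n p B r g = select (\<lambda>x y. g (fst x) (snd x) * cap n p B r (fst y)
       \<le> g (fst y) (snd y) * cap n p B r (fst x)) (candidates n p B r)"

type_synonym state = "(nat \<Rightarrow> int) \<times> (nat \<Rightarrow> int \<Rightarrow> int) \<times> (nat \<times> int \<times> int) list"

text \<open>
  The residual costs are scaled by the capped size of the picked job, so that they remain integers.
\<close>

definition reduce :: "nat \<Rightarrow> (nat \<Rightarrow> int) \<Rightarrow> int list \<Rightarrow> (nat \<Rightarrow> int) \<Rightarrow> (nat \<Rightarrow> int \<Rightarrow> int) \<Rightarrow> nat \<Rightarrow> int \<Rightarrow>
    nat \<Rightarrow> int \<Rightarrow> int" where
  "reduce n p B r g j u i v =
     (if r i \<le> worst n p B r \<and> worst n p B r < v then g i v * cap n p B r j - g j u * cap n p B r i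
      else g i v * cap n p B r j)"

text \<open>A covered state is a fixed point, so the number of iterations can be fixed in advance.
  The log has the latest move in front, hence a left fold of \<open>undo\<close> over it reverts the
  moves in reverse order.\<close>

definition step :: "nat \<Rightarrow> (nat \<Rightarrow> int) \<Rightarrow> int list \<Rightarrow> state \<Rightarrow> state" where
  "step n p B s = (case s of (r, g, l) \<Rightarrow>
     if covers n p B r then s
     else case pick n p B r g of (j, u) \<Rightarrow> (r(j := u), reduce n p B r g j u, (j, r j, u) # l))"

text \<open>The test \<open>\<sigma> j = u\<close> recognizes a move that is still in force;
  otherwise a later, unreverted move has carried \<open>j\<close> beyond \<open>u\<close>, and this
  one is skipped.\<close>

definition undo :: "nat \<Rightarrow> (nat \<Rightarrow> int) \<Rightarrow> int list \<Rightarrow> nat \<times> int \<times> int \<Rightarrow> (nat \<Rightarrow> int) \<Rightarrow> (nat \<Rightarrow> int)" where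
  "undo n p B x \<sigma> = (case x of (j, a, u) \<Rightarrow>
     if \<sigma> j = u \<and> covers n p B (\<sigma>(j := a)) then \<sigma>(j := a) else \<sigma>)"

text \<open>The current deadline \<open>r j\<close> counts as already paid, so only deadlines beyond
  it are charged. A competing solution may lie below \<open>r\<close>, where it pays
  nothing.\<close>

definition residual_cost :: "nat \<Rightarrow> (nat \<Rightarrow> int) \<Rightarrow> (nat \<Rightarrow> int \<Rightarrow> int) \<Rightarrow> (nat \<Rightarrow> int) \<Rightarrow> int" where
  "residual_cost n r g \<sigma> = (\<Sum>j<n. if r j < \<sigma> j then g j (\<sigma> j) else 0)"

section \<open>Analysis of the covering algorithm: minimal covers and the factor 4\<close>

locale cover_instance =
  fixes n :: nat and p :: "nat \<Rightarrow> int" and B :: "int list"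
  assumes p_nonneg: "j < n \<Longrightarrow> 0 \<le> p j"
    and B_nonneg: "b \<in> set B \<Longrightarrow> 0 \<le> b"
    and load_in_B: "load n p \<in> set B"
begin

lemma sum_upt: "(\<Sum>j\<leftarrow>[0..<n]. f j) = (\<Sum>j<n. f j)" for f :: "nat \<Rightarrow> int"
  by (simp add: sum_list_distinct_conv_sum_set atLeast0LessThan)

lemma load_eq: "load n p = (\<Sum>j<n. p j)"
  by (simp add: load_def sum_upt)

lemma demand_eq: "demand n p r b = load n p - b - (\<Sum>j<n. if b < r j then p j else 0)"
  by (simp add: demand_def sum_upt)

lemma B_ne: "B \<noteq> []"
  using load_in_B by auto

lemma worst_in_B: "worst n p B r \<in> set B"
  unfolding worst_def by (rule select_mem[OF B_ne])

lemma demand_le_worst: "b \<in> set B \<Longrightarrow> demand n p r b \<le> demand n p r (worst n p B r)"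
  unfolding worst_def by (rule select_le[OF B_ne]) auto

lemma covers_iff: "covers n p B r \<longleftrightarrow> (\<forall>b\<in>set B. demand n p r b \<le> 0)"
  unfolding covers_def using demand_le_worst worst_in_B by (meson order_trans)

text \<open>Minimality relative to \<open>r\<close>, witnessed by a breakpoint: at \<open>t\<close>
  the jobs other than \<open>j\<close> fall short of \<open>load n p - t\<close>, so returning
  \<open>j\<close> to \<open>r j\<close>, which is at most \<open>t\<close>, would leave demand
  unmet.\<close>

definition critical :: "(nat \<Rightarrow> int) \<Rightarrow> (nat \<Rightarrow> int) \<Rightarrow> bool" where
  "critical r \<sigma> \<longleftrightarrow> (\<forall>j<n. r j < \<sigma> j \<longrightarrow> (\<exists>t\<in>set B. r j \<le> t \<and> t < \<sigma> j \<and>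
     (\<Sum>i\<in>{..<n} - {j}. if t < \<sigma> i then p i else 0) < load n p - t))"

text \<open>By the shortfall at \<open>t\<close>, the jobs already beyond \<open>t\<close> under
  \<open>r\<close> together with \<open>S - {j}\<close> stay below \<open>load n p - t\<close>. So
  \<open>S - {j}\<close> weighs at most the residual demand at \<open>t\<close>, and
  \<open>j\<close> itself adds at most \<open>R\<close> by the truncation.\<close>

lemma capped_sum_le_two:
  assumes le: "\<And>j. j < n \<Longrightarrow> r j \<le> \<sigma> j"
    and S: "S \<subseteq> {..<n}" "j \<in> S" "\<And>i. i \<in> S \<Longrightarrow> r i \<le> t \<and> t < \<sigma> i"
    and t: "(\<Sum>i\<in>{..<n} - {j}. if t < \<sigma> i then p i else 0) < load n p - t"
    and R: "demand n p r t \<le> R"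
  shows "(\<Sum>i\<in>S. min (p i) R) \<le> 2 * R"
proof -
  have fin: "finite S" using S(1) finite_subset by blast
  have jn: "j < n" using S by auto
  have "(\<Sum>i<n. if t < r i then p i else 0) = (\<Sum>i\<in>{..<n} - {j}. if t < r i then p i else 0)"
    using S(3)[OF S(2)] by (subst sum.remove[of _ j]) (use jn in auto)
  moreover have "(\<Sum>i\<in>S - {j}. p i) = (\<Sum>i\<in>{..<n} - {j}. if i \<in> S then p i else 0)"
    using S(1) by (simp add: sum.If_cases Int_absorb1 Diff_Int_distrib2 flip: Int_Diff)
      (rule sum.cong; auto)
  moreover have "(\<Sum>i\<in>{..<n} - {j}. if t < r i then p i else 0) + (\<Sum>i\<in>{..<n} - {j}. if i \<in> S then p i else 0)
      \<le> (\<Sum>i\<in>{..<n} - {j}. if t < \<sigma> i then p i else 0)"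
    unfolding sum.distrib[symmetric]
  proof (rule sum_mono)
    fix i assume "i \<in> {..<n} - {j}"
    then show "(if t < r i then p i else 0) + (if i \<in> S then p i else 0) \<le> (if t < \<sigma> i then p i else 0)"
      using le[of i] S(3)[of i] p_nonneg[of i] by auto
  qed
  ultimately have "(\<Sum>i\<in>S - {j}. p i) \<le> R" using t R unfolding demand_eq by linarith
  moreover have "(\<Sum>i\<in>S - {j}. min (p i) R) \<le> (\<Sum>i\<in>S - {j}. p i)" by (rule sum_mono) simp
  moreover have "(\<Sum>i\<in>S. min (p i) R) = min (p j) R + (\<Sum>i\<in>S - {j}. min (p i) R)"
    by (rule sum.remove[OF fin S(2)])
  ultimately show ?thesis by linarith
qed

text \<open>
  The factor 4 is 2 + 2.  The jobs alive at \<open>b\<close> are split according to the side of \<open>b\<close> on which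
  their critical points lie.  On each side, the job that extends least to that side has a critical
  point at which all other jobs of that side are alive, so these others together are
  too small to meet the residual demand there.
\<close>

lemma capped_sum_le_four:
  assumes le: "\<And>j. j < n \<Longrightarrow> r j \<le> \<sigma> j" and crit: "critical r \<sigma>"
    and R: "\<And>b. b \<in> set B \<Longrightarrow> demand n p r b \<le> R" "0 \<le> R"
  shows "(\<Sum>i\<in>{i. i < n \<and> r i \<le> b \<and> b < \<sigma> i}. min (p i) R) \<le> 4 * R"
proof -
  define X where "X = {i. i < n \<and> r i \<le> b \<and> b < \<sigma> i}"
  have "\<forall>j\<in>X. \<exists>t\<in>set B. r j \<le> t \<and> t < \<sigma> j \<and>
     (\<Sum>i\<in>{..<n} - {j}. if t < \<sigma> i then p i else 0) < load n p - t"
    using crit unfolding critical_def X_def by auto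
  then obtain t where t: "\<And>j. j \<in> X \<Longrightarrow> t j \<in> set B \<and> r j \<le> t j \<and> t j < \<sigma> j \<and>
     (\<Sum>i\<in>{..<n} - {j}. if t j < \<sigma> i then p i else 0) < load n p - t j"
    by metis
  have X: "X \<subseteq> {..<n}" "finite X" unfolding X_def by auto
  define L where "L = {j\<in>X. t j \<le> b}"
  define U where "U = {j\<in>X. b < t j}"
  have sub: "L \<subseteq> X" "U \<subseteq> X" "finite L" "finite U" using X by (auto simp: L_def U_def)
  have "(\<Sum>i\<in>L. min (p i) R) \<le> 2 * R"
  proof (cases "L = {}")
    case False
    obtain j where j: "j \<in> L" "\<And>i. i \<in> L \<Longrightarrow> r i \<le> r j"
      using Max_in[of "r ` L"] Max_ge[of "r ` L"] sub(3) False by fastforce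
    then have jX: "j \<in> X" using sub by auto
    show ?thesis
    proof (rule capped_sum_le_two[OF le])
      show "r i \<le> t j \<and> t j < \<sigma> i" if "i \<in> L" for i
        using that j(2)[OF that] j(1) t[OF jX] by (auto simp: L_def X_def)
    qed (use t[OF jX] R j sub X in auto)
  qed (use R in simp)
  moreover have "(\<Sum>i\<in>U. min (p i) R) \<le> 2 * R"
  proof (cases "U = {}")
    case False
    obtain j where j: "j \<in> U" "\<And>i. i \<in> U \<Longrightarrow> \<sigma> j \<le> \<sigma> i"
      using Min_in[of "\<sigma> ` U"] Min_le[of "\<sigma> ` U"] sub(4) False by fastforce
    then have jX: "j \<in> X" using sub by auto
    show ?thesis
    proof (rule capped_sum_le_two[OF le])
      show "r i \<le> t j \<and> t j < \<sigma> i" if "i \<in> U" for i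
        using that j(2)[OF that] j(1) t[OF jX] by (auto simp: U_def X_def)
    qed (use t[OF jX] R j sub X in auto)
  qed (use R in simp)
  moreover have "(\<Sum>i\<in>X. min (p i) R) = (\<Sum>i\<in>L. min (p i) R) + (\<Sum>i\<in>U. min (p i) R)"
    by (subst sum.union_disjoint[symmetric]) (use sub in \<open>auto simp: L_def U_def intro!: sum.cong\<close>)
  ultimately show ?thesis unfolding X_def by linarith
qed

text \<open>Either one of the crossing jobs reaches \<open>R\<close> alone, or no size is truncated
  and the crossing jobs must supply what \<open>r\<close> lacks at \<open>b\<close>.\<close>

lemma capped_sum_ge:
  assumes o: "covers n p B \<tau>" and b: "b \<in> set B" and R: "R = demand n p r b" "0 \<le> R"
  shows "R \<le> (\<Sum>i\<in>{i. i < n \<and> r i \<le> b \<and> b < \<tau> i}. min (p i) R)"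
proof -
  define X where "X = {i. i < n \<and> r i \<le> b \<and> b < \<tau> i}"
  have X: "X \<subseteq> {..<n}" "finite X" unfolding X_def by auto
  have nn: "\<And>i. i \<in> X \<Longrightarrow> 0 \<le> min (p i) R" using R p_nonneg by (auto simp: X_def)
  show ?thesis
  proof (cases "\<exists>i\<in>X. R \<le> p i")
    case True
    then obtain i where i: "i \<in> X" "R \<le> p i" by auto
    have "min (p i) R \<le> (\<Sum>i\<in>X. min (p i) R)" by (rule member_le_sum[OF i(1)]) (use nn X in auto)
    then show ?thesis using i unfolding X_def by simp
  next
    case False
    have "(\<Sum>i<n. if b < \<tau> i then p i else 0) \<le>
        (\<Sum>i<n. (if b < r i then p i else 0) + (if i \<in> X then p i else 0))"
      by (rule sum_mono) (use p_nonneg in \<open>auto simp: X_def\<close>)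
    also have "\<dots> = (\<Sum>i<n. if b < r i then p i else 0) + (\<Sum>i\<in>X. p i)"
      using X by (simp add: sum.distrib sum.If_cases Int_absorb1)
    finally have "R \<le> (\<Sum>i\<in>X. p i)"
      using o b unfolding covers_iff R demand_eq by fastforce
    also have "\<dots> = (\<Sum>i\<in>X. min (p i) R)" using False by (intro sum.cong) auto
    finally show ?thesis unfolding X_def .
  qed
qed

text \<open>The induction hypothesis of the local-ratio argument, relative to an intermediate state.
  The competitor \<open>\<tau>\<close> is any cover by breakpoints, not just one above
  \<open>r\<close>, so that the same competitor can be kept through all steps.\<close>

definition solves :: "(nat \<Rightarrow> int) \<Rightarrow> (nat \<Rightarrow> int \<Rightarrow> int) \<Rightarrow> (nat \<Rightarrow> int) \<Rightarrow> bool" where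
  "solves r g \<sigma> \<longleftrightarrow> (\<forall>j<n. r j \<le> \<sigma> j \<and> \<sigma> j \<in> set B) \<and> covers n p B \<sigma> \<and> critical r \<sigma> \<and>
     (\<forall>\<tau>. covers n p B \<tau> \<longrightarrow> (\<forall>j<n. \<tau> j \<in> set B) \<longrightarrow>
        residual_cost n r g \<sigma> \<le> 4 * residual_cost n r g \<tau>)"

definition valid_state :: "(nat \<Rightarrow> int) \<Rightarrow> (nat \<Rightarrow> int \<Rightarrow> int) \<Rightarrow> bool" where
  "valid_state r g \<longleftrightarrow> (\<forall>j<n. r j \<in> set B) \<and> (\<forall>j<n. \<forall>u\<in>set B. 0 \<le> g j u)"

lemma set_candidates: "set (candidates n p B r) =
    {(j, u). j < n \<and> r j \<le> worst n p B r \<and> 0 < p j \<and> u \<in> set B \<and> worst n p B r < u}"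
  unfolding candidates_def by auto

text \<open>If demand is unmet at a nonnegative \<open>b\<close>, then \<open>b\<close> lies below
  the load, so the load is a possible target; and some job of positive size is still at or before
  \<open>b\<close>, since otherwise all processing time would lie beyond \<open>b\<close>.\<close>

lemma candidates_ne:
  assumes "\<not> covers n p B r"
  shows "candidates n p B r \<noteq> []"
proof -
  let ?b = "worst n p B r"
  have d: "demand n p r ?b > 0" using assms by (simp add: covers_def)
  have b: "0 \<le> ?b" using B_nonneg worst_in_B by blast
  have "0 \<le> (\<Sum>j<n. if ?b < r j then p j else 0)" by (rule sum_nonneg) (use p_nonneg in auto)
  then have "?b < load n p" using d unfolding demand_eq by linarith
  moreover have "\<exists>j<n. r j \<le> ?b \<and> 0 < p j"
  proof (rule ccontr)
    assume "\<not> ?thesis"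
    then have "(\<Sum>j<n. if ?b < r j then p j else 0) = (\<Sum>j<n. p j)"
      by (intro sum.cong) (use p_nonneg in force)+
    then show False using d b unfolding demand_eq load_eq by linarith
  qed
  ultimately have "\<exists>j. (j, load n p) \<in> set (candidates n p B r)"
    using load_in_B by (auto simp: set_candidates)
  then show ?thesis by auto
qed

context
  fixes r g j u
  assumes valid: "valid_state r g" and uncovered: "\<not> covers n p B r"
    and pick: "pick n p B r g = (j, u)"
begin

lemma picked: "j < n" "r j \<le> worst n p B r" "0 < p j" "u \<in> set B" "worst n p B r < u"
proof -
  have "pick n p B r g \<in> set (candidates n p B r)"
    unfolding pick_def by (rule select_mem[OF candidates_ne[OF uncovered]])
  then show "j < n" "r j \<le> worst n p B r" "0 < p j" "u \<in> set B" "worst n p B r < u"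
    unfolding pick set_candidates by auto
qed

lemma demand_pos: "0 < demand n p r (worst n p B r)"
  using uncovered by (simp add: covers_def)

lemma cap_pos: "0 < p i \<Longrightarrow> 0 < cap n p B r i"
  using demand_pos by (simp add: cap_def)

lemma cap_nonneg: "i < n \<Longrightarrow> 0 \<le> cap n p B r i"
  using demand_pos p_nonneg by (simp add: cap_def)

lemma picked_cost_nonneg: "0 \<le> g j u"
  using valid picked by (simp add: valid_state_def)

lemma picked_minimal:
  assumes "(i, v) \<in> set (candidates n p B r)"
  shows "g j u * cap n p B r i \<le> g i v * cap n p B r j"
proof -
  let ?c = "cap n p B r" and ?C = "candidates n p B r"
  let ?le = "\<lambda>x y. g (fst x) (snd x) * ?c (fst y) \<le> g (fst y) (snd y) * ?c (fst x)"
  have pos: "0 < ?c (fst x)" if "x \<in> set ?C" for x using that cap_pos by (auto simp: set_candidates)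
  have "?le (pick n p B r g) (i, v)"
    unfolding pick_def
  proof (rule select_le[OF candidates_ne[OF uncovered] assms])
    fix x y z assume xyz: "x \<in> set ?C" "y \<in> set ?C" "z \<in> set ?C" and le: "?le x y" "?le y z"
    \<comment> \<open>Each inequality is multiplied by the capped size missing from it; the common
      positive factor \<open>?c (fst y)\<close> is cancelled at the end.\<close>
    have "(g (fst x) (snd x) * ?c (fst y)) * ?c (fst z) \<le> (g (fst y) (snd y) * ?c (fst x)) * ?c (fst z)"
      using le(1) pos[OF xyz(3)] by (intro mult_right_mono) auto
    moreover have "(g (fst y) (snd y) * ?c (fst z)) * ?c (fst x) \<le> (g (fst z) (snd z) * ?c (fst y)) * ?c (fst x)"
      using le(2) pos[OF xyz(1)] by (intro mult_right_mono) auto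
    ultimately have "?c (fst y) * (g (fst x) (snd x) * ?c (fst z)) \<le> ?c (fst y) * (g (fst z) (snd z) * ?c (fst x))"
      by (simp add: ac_simps)
    then show "?le x z" using pos[OF xyz(2)] by (simp add: mult_le_cancel_left_pos)
  qed auto
  then show ?thesis unfolding pick by simp
qed

text \<open>For candidates this is the minimality of the picked ratio. A job of size zero is no
  candidate, but its capped size is zero, so nothing is subtracted from its costs.\<close>

lemma reduce_nonneg:
  assumes "i < n" "v \<in> set B"
  shows "0 \<le> reduce n p B r g j u i v"
proof -
  have 1: "0 \<le> g i v * cap n p B r j"
    using valid assms cap_nonneg picked(1) by (simp add: valid_state_def)
  have "g j u * cap n p B r i \<le> g i v * cap n p B r j" if a: "r i \<le> worst n p B r" "worst n p B r < v"
  proof (cases "0 < p i")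
    case True then show ?thesis using picked_minimal[of i v] assms a by (simp add: set_candidates)
  next
    case False
    then have "cap n p B r i = 0" using p_nonneg[OF assms(1)] demand_pos by (simp add: cap_def)
    then show ?thesis using 1 by simp
  qed
  then show ?thesis using 1 by (simp add: reduce_def)
qed

text \<open>Limits the growth of the integers for the running time: the scaling factor is a capped
  size and thus at most the load.\<close>

lemma reduce_le:
  assumes "i < n" "v \<in> set B"
  shows "reduce n p B r g j u i v \<le> g i v * load n p"
proof -
  have "p j \<le> load n p" unfolding load_eq by (rule member_le_sum) (use picked p_nonneg in auto)
  then have "cap n p B r j \<le> load n p" by (simp add: cap_def)
  then have "g i v * cap n p B r j \<le> g i v * load n p"
    using valid assms by (intro mult_left_mono) (auto simp: valid_state_def)
  moreover have "0 \<le> g j u * cap n p B r i" using cap_nonneg[OF assms(1)] picked_cost_nonneg by simp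
  ultimately show ?thesis by (simp add: reduce_def)
qed

lemma valid_state_step: "valid_state (r(j := u)) (reduce n p B r g j u)"
  using valid picked reduce_nonneg by (auto simp: valid_state_def)

text \<open>A job crossing the worst breakpoint satisfies \<open>r i < \<tau> i\<close> and so is
  charged in \<open>residual_cost\<close>; the subtraction in \<open>reduce\<close> therefore
  removes exactly the capped sizes of the crossing jobs, times \<open>g j u\<close>.\<close>

lemma residual_cost_split:
  "cap n p B r j * residual_cost n r g \<tau> = residual_cost n r (reduce n p B r g j u) \<tau> +
     g j u * (\<Sum>i\<in>{i. i < n \<and> r i \<le> worst n p B r \<and> worst n p B r < \<tau> i}. cap n p B r i)"
proof -
  let ?b = "worst n p B r"
  have "(\<Sum>i\<in>{i. i < n \<and> r i \<le> ?b \<and> ?b < \<tau> i}. cap n p B r i)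
      = (\<Sum>i<n. if r i \<le> ?b \<and> ?b < \<tau> i then cap n p B r i else 0)"
    by (simp add: sum.If_cases Collect_conj_eq lessThan_def)
  then show ?thesis
    unfolding residual_cost_def
    by (simp add: sum_distrib_left sum.distrib[symmetric])
      (intro sum.cong, auto simp: reduce_def algebra_simps)
qed

text \<open>One backward step of local ratio. The picked move is free for the reduced costs, so
  reverting it leaves their value unchanged; the subtracted part is within a factor 4 because the
  result is again critical, now relative to \<open>r\<close>.\<close>

lemma solves_undo:
  assumes s: "solves (r(j := u)) (reduce n p B r g j u) \<sigma>"
  shows "solves r g (undo n p B (j, r j, u) \<sigma>)"
proof -
  let ?r = "r(j := u)" and ?g = "reduce n p B r g j u"
  let ?s = "undo n p B (j, r j, u) \<sigma>" and ?b = "worst n p B r"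
  let ?c = "cap n p B r"
  define R where "R = demand n p r ?b"
  have le: "\<And>i. i < n \<Longrightarrow> ?r i \<le> \<sigma> i" "\<And>i. i < n \<Longrightarrow> \<sigma> i \<in> set B" and cov: "covers n p B \<sigma>"
    and crit: "critical ?r \<sigma>"
    and approx: "\<And>\<tau>. covers n p B \<tau> \<Longrightarrow> (\<forall>j<n. \<tau> j \<in> set B) \<Longrightarrow>
        residual_cost n ?r ?g \<sigma> \<le> 4 * residual_cost n ?r ?g \<tau>"
    using s unfolding solves_def by blast+
  have rju: "r j < u" using picked by linarith
  have uj: "u \<le> \<sigma> j" using le(1)[OF picked(1)] by simp
  have s_eq: "?s = \<sigma> \<or> (?s = \<sigma>(j := r j) \<and> \<sigma> j = u)" by (simp add: undo_def)
  have s_le: "?s i \<le> \<sigma> i" for i using s_eq rju by auto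
  have r_le: "r i \<le> ?s i" if "i < n" for i using le(1)[OF that] s_eq rju by (auto split: if_splits)
  have s_B: "?s i \<in> set B" if "i < n" for i
    using le(2)[OF that] s_eq valid picked by (auto simp: valid_state_def)
  have s_cov: "covers n p B ?s" using cov by (simp add: undo_def)
  have s_crit: "critical r ?s"
    unfolding critical_def
  proof (intro allI impI)
    fix i assume i: "i < n" "r i < ?s i"
    \<comment> \<open>It suffices to bound the other jobs under \<open>\<sigma>\<close>, since
      undoing only lowers deadlines.\<close>
    have "\<exists>t\<in>set B. r i \<le> t \<and> t < ?s i \<and>
       (\<Sum>k\<in>{..<n} - {i}. if t < \<sigma> k then p k else 0) < load n p - t"
    proof (cases "i = j")
      case True
      then have eq: "?s = \<sigma>" using i s_eq by auto
      show ?thesis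
      proof (cases "\<sigma> j = u")
        case True
        \<comment> \<open>The undo was refused although the move is in force, so reverting it
          violates some demand; that breakpoint is the witness. It lies between \<open>r j\<close>
          and \<open>u\<close> because \<open>\<sigma>\<close> itself meets the demand
          there.\<close>
        then have "\<not> covers n p B (\<sigma>(j := r j))"
          using eq rju by (auto simp: undo_def fun_eq_iff split: if_splits)
        then obtain t where t: "t \<in> set B" "0 < demand n p (\<sigma>(j := r j)) t"
          unfolding covers_iff by force
        have c: "demand n p \<sigma> t \<le> 0" using cov t unfolding covers_iff by blast
        have split: "(\<Sum>k<n. if t < f k then p k else 0) = (if t < f j then p j else 0) +
            (\<Sum>k\<in>{..<n} - {j}. if t < f k then p k else 0)" for f
          using picked(1) by (subst sum.remove[of _ j]) auto
        have same: "(\<Sum>k\<in>{..<n} - {j}. if t < (\<sigma>(j := r j)) k then p k else 0)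
            = (\<Sum>k\<in>{..<n} - {j}. if t < \<sigma> k then p k else 0)" by (rule sum.cong) auto
        have "r j \<le> t" "t < \<sigma> j"
          using t(2) c rju True picked(3) unfolding demand_eq split same by (auto split: if_splits)
        moreover have "(\<Sum>k\<in>{..<n} - {j}. if t < \<sigma> k then p k else 0) < load n p - t"
          using t(2) \<open>r j \<le> t\<close> unfolding demand_eq split same by simp
        ultimately show ?thesis using t(1) eq \<open>i = j\<close> by auto
      next
        case False
        \<comment> \<open>A later move of \<open>j\<close> was kept: its witness lies at or beyond
          \<open>u\<close>, hence beyond \<open>r j\<close>.\<close>
        then have "?r j < \<sigma> j" using uj by simp
        then obtain t where "t \<in> set B" "?r j \<le> t" "t < \<sigma> j"
            "(\<Sum>k\<in>{..<n} - {j}. if t < \<sigma> k then p k else 0) < load n p - t"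
          using crit picked(1) unfolding critical_def by blast
        then show ?thesis using rju \<open>i = j\<close> unfolding eq by (intro bexI[of _ t]) auto
      qed
    next
      case False
      then have "?r i < \<sigma> i" "?s i = \<sigma> i" using i s_eq by auto
      then obtain t where "t \<in> set B" "?r i \<le> t" "t < \<sigma> i"
          "(\<Sum>k\<in>{..<n} - {i}. if t < \<sigma> k then p k else 0) < load n p - t"
        using crit i(1) unfolding critical_def by blast
      then show ?thesis using False \<open>?s i = \<sigma> i\<close> by (intro bexI[of _ t]) auto
    qed
    then obtain t where t: "t \<in> set B" "r i \<le> t" "t < ?s i"
      "(\<Sum>k\<in>{..<n} - {i}. if t < \<sigma> k then p k else 0) < load n p - t" by blast
    have "(\<Sum>k\<in>{..<n} - {i}. if t < ?s k then p k else 0) \<le> (\<Sum>k\<in>{..<n} - {i}. if t < \<sigma> k then p k else 0)"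
    proof (rule sum_mono)
      fix k assume "k \<in> {..<n} - {i}"
      then show "(if t < ?s k then p k else 0) \<le> (if t < \<sigma> k then p k else 0)"
        using s_le[of k] p_nonneg[of k] by auto
    qed
    then show "\<exists>t\<in>set B. r i \<le> t \<and> t < ?s i \<and>
       (\<Sum>k\<in>{..<n} - {i}. if t < ?s k then p k else 0) < load n p - t"
      using t by fastforce
  qed
  have cost_le: "residual_cost n r g ?s \<le> 4 * residual_cost n r g \<tau>"
    if \<tau>: "covers n p B \<tau>" "\<forall>j<n. \<tau> j \<in> set B" for \<tau>
  proof -
    \<comment> \<open>The two products in \<open>reduce\<close> coincide for the picked move itself,
      so it has become free.\<close>
    have zero: "?g j u = 0" using picked by (simp add: reduce_def)
    have A: "residual_cost n r ?g ?s = residual_cost n ?r ?g \<sigma>"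
      unfolding residual_cost_def
    proof (rule sum.cong)
      fix i assume "i \<in> {..<n}"
      show "(if r i < ?s i then ?g i (?s i) else 0) = (if ?r i < \<sigma> i then ?g i (\<sigma> i) else 0)"
        using s_eq uj rju zero by (cases "\<sigma> j = u") auto
    qed simp
    \<comment> \<open>Raising \<open>r j\<close> to \<open>u\<close> can only exempt
      \<open>j\<close> from being charged, and the reduced costs are nonnegative.\<close>
    have Bd: "residual_cost n ?r ?g \<tau> \<le> residual_cost n r ?g \<tau>"
      unfolding residual_cost_def
      by (rule sum_mono) (use rju \<tau>(2) reduce_nonneg in auto)
    let ?h = "\<lambda>\<tau>. \<Sum>i\<in>{i. i < n \<and> r i \<le> ?b \<and> ?b < \<tau> i}. ?c i"
    have R0: "0 \<le> R" using demand_pos by (simp add: R_def)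
    have h1: "?h ?s \<le> 4 * R" unfolding cap_def R_def[symmetric]
      by (rule capped_sum_le_four[OF r_le s_crit _ R0]) (use demand_le_worst in \<open>auto simp: R_def\<close>)
    have h2: "R \<le> ?h \<tau>" unfolding cap_def R_def[symmetric]
      by (rule capped_sum_ge[OF \<tau>(1) worst_in_B R_def R0])
    have "?c j * residual_cost n r g ?s = residual_cost n ?r ?g \<sigma> + g j u * ?h ?s"
      unfolding residual_cost_split A ..
    also have "\<dots> \<le> 4 * residual_cost n r ?g \<tau> + 4 * (g j u * ?h \<tau>)"
    proof (rule add_mono)
      show "residual_cost n ?r ?g \<sigma> \<le> 4 * residual_cost n r ?g \<tau>" using approx[OF \<tau>] Bd by linarith
      have "g j u * ?h ?s \<le> g j u * (4 * ?h \<tau>)"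
        by (rule mult_left_mono[OF _ picked_cost_nonneg]) (use h1 h2 in linarith)
      then show "g j u * ?h ?s \<le> 4 * (g j u * ?h \<tau>)" by simp
    qed
    also have "\<dots> = ?c j * (4 * residual_cost n r g \<tau>)"
      using residual_cost_split[of \<tau>] by simp
    finally show ?thesis using cap_pos[OF picked(3)] by (simp add: mult_le_cancel_left_pos)
  qed
  show ?thesis unfolding solves_def using r_le s_B s_cov s_crit cost_le by blast
qed

end

lemma solves_refl:
  assumes "valid_state r g" "covers n p B r"
  shows "solves r g r"
proof -
  have "0 \<le> residual_cost n r g \<tau>" if "\<forall>j<n. \<tau> j \<in> set B" for \<tau>
    unfolding residual_cost_def by (rule sum_nonneg) (use that assms(1) in \<open>auto simp: valid_state_def\<close>)
  moreover have "residual_cost n r g r = 0" by (simp add: residual_cost_def)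
  ultimately show ?thesis using assms by (auto simp: solves_def critical_def valid_state_def)
qed

text \<open>An upper bound on the moves still to come, as each raises one deadline to a higher
  breakpoint.\<close>

definition potential :: "(nat \<Rightarrow> int) \<Rightarrow> nat" where
  "potential r = (\<Sum>j<n. card {b \<in> set B. r j < b})"

lemma potential_step:
  assumes "j < n" "r j < u" "u \<in> set B"
  shows "potential (r(j := u)) < potential r"
  unfolding potential_def
proof (rule sum_strict_mono_ex1)
  have "{b \<in> set B. u < b} \<subset> {b \<in> set B. r j < b}" using assms by auto
  then have "card {b \<in> set B. u < b} < card {b \<in> set B. r j < b}" by (intro psubset_card_mono) auto
  then show "\<forall>i\<in>{..<n}. card {b \<in> set B. (r(j := u)) i < b} \<le> card {b \<in> set B. r i < b}"
    and "\<exists>i\<in>{..<n}. card {b \<in> set B. (r(j := u)) i < b} < card {b \<in> set B. r i < b}"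
    using assms(1) by auto
qed simp

text \<open>\<open>l'\<close> is the part of the log written from this state on. Its last entry is
  the first move, which is undone last: the induction peels off this move and applies
  \<open>solves_undo\<close> to it.\<close>

lemma solves_iterate:
  assumes "valid_state r g" "potential r \<le> k"
  shows "\<exists>r' g' l'. (step n p B ^^ k) (r, g, l) = (r', g', l' @ l) \<and>
    solves r g (fold (undo n p B) l' r')"
  using assms
proof (induction k arbitrary: r g l)
  case 0
  have "covers n p B r"
  proof (rule ccontr)
    assume nc: "\<not> covers n p B r"
    obtain j u where ju: "pick n p B r g = (j, u)" by fastforce
    note pk = picked[OF 0(1) nc ju]
    have "potential (r(j := u)) < potential r" by (rule potential_step) (use pk in auto)
    then show False using 0 by simp
  qed
  then show ?case using solves_refl[OF 0(1)] by auto
next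
  case (Suc k)
  show ?case
  proof (cases "covers n p B r")
    case True
    then have "(step n p B ^^ m) (r, g, l) = (r, g, l)" for m by (induction m) (auto simp: step_def)
    from this[of "Suc k"] show ?thesis using solves_refl[OF Suc.prems(1) True]
      by (intro exI[of _ r] exI[of _ g] exI[of _ "[]"]) simp
  next
    case False
    obtain j u where ju: "pick n p B r g = (j, u)" by fastforce
    note pk = picked[OF Suc.prems(1) False ju]
    have "potential (r(j := u)) < potential r" by (rule potential_step) (use pk in auto)
    then have "potential (r(j := u)) \<le> k" using Suc.prems by simp
    from Suc.IH[OF valid_state_step[OF Suc.prems(1) False ju] this, of "(j, r j, u) # l"]
    obtain r' g' l' where st: "(step n p B ^^ k) (r(j := u), reduce n p B r g j u, (j, r j, u) # l)
        = (r', g', l' @ (j, r j, u) # l)"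
      and sol: "solves (r(j := u)) (reduce n p B r g j u) (fold (undo n p B) l' r')" by blast
    have "(step n p B ^^ Suc k) (r, g, l) = (r', g', (l' @ [(j, r j, u)]) @ l)"
      using st False ju by (simp add: funpow_swap1[of _ k] funpow_Suc_right step_def del: funpow.simps)
    then show ?thesis
      using solves_undo[OF Suc.prems(1) False ju sol] by (auto intro!: exI[of _ "l' @ [(j, r j, u)]"])
  qed
qed

end

section \<open>The scheduling algorithm\<close>

definition insert_by :: "(nat \<Rightarrow> int) \<Rightarrow> nat \<Rightarrow> nat list \<Rightarrow> nat list" where
  "insert_by \<sigma> j xs = filter (\<lambda>i. \<sigma> i < \<sigma> j) xs @ j # filter (\<lambda>i. \<sigma> j \<le> \<sigma> i) xs"

definition edd :: "nat \<Rightarrow> (nat \<Rightarrow> int) \<Rightarrow> nat list" where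
  "edd n \<sigma> = fold (insert_by \<sigma>) [0..<n] []"

lemma set_insert_by: "set (insert_by \<sigma> j xs) = insert j (set xs)"
  by (auto simp: insert_by_def)

lemma distinct_insert_by: "distinct xs \<Longrightarrow> j \<notin> set xs \<Longrightarrow> distinct (insert_by \<sigma> j xs)"
  by (auto simp: insert_by_def)

lemma sorted_insert_by: "sorted (map \<sigma> xs) \<Longrightarrow> sorted (map \<sigma> (insert_by \<sigma> j xs))"
  by (auto simp: insert_by_def sorted_append sorted_filter)

lemma fold_insert_by:
  assumes "distinct (xs @ ys)" "sorted (map \<sigma> ys)"
  shows "distinct (fold (insert_by \<sigma>) xs ys) \<and> set (fold (insert_by \<sigma>) xs ys) = set xs \<union> set ys \<and>
    sorted (map \<sigma> (fold (insert_by \<sigma>) xs ys))"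
  using assms
proof (induction xs arbitrary: ys)
  case (Cons x xs)
  have "distinct (xs @ insert_by \<sigma> x ys)"
    using Cons.prems by (auto simp: set_insert_by distinct_insert_by)
  from Cons.IH[OF this sorted_insert_by[OF Cons.prems(2)]] show ?case by (simp add: set_insert_by)
qed simp

lemma edd_props: "distinct (edd n \<sigma>)" "set (edd n \<sigma>) = {..<n}" "sorted (map \<sigma> (edd n \<sigma>))"
proof -
  have "distinct ([0..<n] @ [])" "sorted (map \<sigma> [])" by simp_all
  from fold_insert_by[OF this]
  show "distinct (edd n \<sigma>)" "set (edd n \<sigma>) = {..<n}" "sorted (map \<sigma> (edd n \<sigma>))"
    unfolding edd_def by (simp_all only: set_upt atLeast0LessThan set_simps Un_empty_right)
qed

definition finish :: "(nat \<Rightarrow> int) \<Rightarrow> nat list \<Rightarrow> nat \<Rightarrow> int" where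
  "finish p \<pi> j = (\<Sum>k\<leftarrow>takeWhile (\<lambda>k. k \<noteq> j) \<pi>. p k) + p j"

lemma finish_Cons: "finish p (x # \<pi>) k = (if k = x then p x else p x + finish p \<pi> k)"
  by (simp add: finish_def)

text \<open>The jobs that finish by time \<open>b\<close> are processed one after another between
  the start \<open>c\<close> and \<open>b\<close>. The start is variable for the induction over the
  sequence, and the \<open>max\<close> covers \<open>b < c\<close>.\<close>

lemma sum_finished_le:
  assumes "distinct \<pi>" "\<And>k. k \<in> set \<pi> \<Longrightarrow> 0 \<le> p k"
  shows "(\<Sum>k\<in>set \<pi>. if c + finish p \<pi> k \<le> b then p k else 0) \<le> max 0 (b - c)"
  using assms
proof (induction \<pi> arbitrary: c)
  case (Cons x \<pi>)
  have "(\<Sum>k\<in>set (x # \<pi>). if c + finish p (x # \<pi>) k \<le> b then p k else 0)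
    = (if c + p x \<le> b then p x else 0) + (\<Sum>k\<in>set \<pi>. if (c + p x) + finish p \<pi> k \<le> b then p k else 0)"
    using Cons.prems(1)
    by (simp add: finish_Cons) (intro conjI impI arg_cong2[where f = "(+)"] sum.cong; auto simp: add.assoc)
  also have "\<dots> \<le> (if c + p x \<le> b then p x else 0) + max 0 (b - (c + p x))"
    using Cons by (intro add_left_mono) auto
  also have "\<dots> \<le> max 0 (b - c)" using Cons.prems(2)[of x] by auto
  finally show ?case .
qed simp

lemma sum_finished_load:
  assumes "distinct \<pi>" "\<And>k. k \<in> set \<pi> \<Longrightarrow> 0 \<le> p k" "j \<in> set \<pi>"
  shows "finish p \<pi> j \<le> (\<Sum>k\<in>set \<pi>. p k)"
  using assms
proof (induction \<pi>)
  case (Cons x \<pi>)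
  have "0 \<le> (\<Sum>k\<in>set \<pi>. p k)" using Cons.prems by (intro sum_nonneg) auto
  then show ?case using Cons by (auto simp: finish_Cons)
qed simp

text \<open>
  Consecutive offsets either differ by 1, which loses nothing as all times are integers, or by a
  factor of at most \<open>1 + 1/m\<close>.
\<close>

primrec offset :: "int \<Rightarrow> nat \<Rightarrow> int" where
  "offset m 0 = 1"
| "offset m (Suc k) = offset m k + max 1 (offset m k div m)"

definition num_offsets :: "int \<Rightarrow> int \<Rightarrow> nat" where
  "num_offsets m T = (LEAST k. T \<le> offset m k)"

text \<open>The offset 0 makes the due dates themselves breakpoints, so that jobs on time stay on
  time. The reversed order is that in which the program builds the list.\<close>

definition offsets :: "int \<Rightarrow> int \<Rightarrow> int list" where
  "offsets m T = 0 # map (offset m) (rev [0..<Suc (num_offsets m T)])"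

lemma offset_ge: "int k < offset m k"
  by (induction k) auto

lemma num_offsets_le: "T \<le> offset m (num_offsets m T)"
proof -
  have "T \<le> offset m (nat T)" using offset_ge[of "nat T" m] by linarith
  then show ?thesis unfolding num_offsets_def by (rule LeastI)
qed

lemma offset_less: "k < num_offsets m T \<Longrightarrow> offset m k < T"
  unfolding num_offsets_def using not_less_Least not_le by blast

lemma offsets_dense:
  assumes m: "0 < m" and z: "1 \<le> z" "z \<le> T"
  shows "\<exists>\<delta>\<in>set (offsets m T). z \<le> \<delta> \<and> m * \<delta> \<le> (m + 1) * z"
proof -
  define k where "k = (LEAST k. z \<le> offset m k)"
  have ex: "z \<le> offset m (num_offsets m T)" using num_offsets_le z(2) order_trans by blast
  have zk: "z \<le> offset m k" unfolding k_def by (rule LeastI[of "\<lambda>k. z \<le> offset m k", OF ex])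
  have "k \<le> num_offsets m T" unfolding k_def by (rule Least_le) (rule ex)
  moreover have "m * offset m k \<le> (m + 1) * z"
  proof (cases k)
    case 0 
    have "m * 1 \<le> (m + 1) * z" using m z(1) by (intro mult_mono) auto
    then show ?thesis using 0 by simp
  next
    case (Suc l)
    then have l: "offset m l < z" using not_less_Least[of l "\<lambda>k. z \<le> offset m k"] by (simp add: k_def)
    show ?thesis
    proof (cases "offset m l div m \<le> 1")
      case True
      \<comment> \<open>The increment is 1 and \<open>offset m l < z\<close>, so over the integers
        rounding \<open>z\<close> up is exact.\<close>
      then have "offset m k \<le> z" using Suc l by simp
      then have "m * offset m k \<le> m * z" using m by simp
      then show ?thesis using z(1) by (simp add: algebra_simps)
    next
      case False
      then have "m * offset m k = m * offset m l + m * (offset m l div m)" using Suc by (simp add: algebra_simps)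
      also have "\<dots> \<le> m * offset m l + offset m l"
        using pos_mod_sign[OF m, of "offset m l"] mult_div_mod_eq[of m "offset m l"] by linarith
      also have "\<dots> = (m + 1) * offset m l" by (simp add: algebra_simps)
      also have "\<dots> \<le> (m + 1) * z" using l m by (intro mult_left_mono) auto
      finally show ?thesis .
    qed
  qed
  moreover have "offset m k \<in> set (offsets m T)" if "k \<le> num_offsets m T"
    using that unfolding offsets_def by (auto simp del: upt_Suc intro!: imageI)
  ultimately show ?thesis using zk by blast
qed

definition penalty :: "problem \<Rightarrow> int \<Rightarrow> int \<Rightarrow> int" where
  "penalty Q d b = (case Q of Sum_wU \<Rightarrow> of_bool (d < b) | Sum_wT \<Rightarrow> max 0 (b - d))"

lemma penalty_mono: "b \<le> b' \<Longrightarrow> penalty Q d b \<le> penalty Q d b'"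
  by (cases Q) (auto simp: penalty_def)

lemma penalty_nonneg: "0 \<le> penalty Q d b"
  by (cases Q) (auto simp: penalty_def)

lemma penalty_zero: "b \<le> d \<Longrightarrow> penalty Q d b = 0"
  by (cases Q) (auto simp: penalty_def)

text \<open>For \<open>C \<le> d\<close> the offset 0 forces \<open>b \<le> d\<close>. For a late
  job the lateness grows by at most the factor \<open>1 + 1/m\<close>; when late jobs are merely
  counted, the penalty of \<open>C\<close> is already 1 and that of \<open>b\<close> at most
  1.\<close>

lemma penalty_round:
  assumes m: "0 < m" and d: "0 \<le> d" "C \<le> T" and b: "\<And>\<delta>. \<delta> \<in> set (offsets m T) \<Longrightarrow> C \<le> d + \<delta> \<Longrightarrow> b \<le> d + \<delta>"
  shows "m * penalty Q d b \<le> (m + 1) * penalty Q d C"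
proof (cases "C \<le> d")
  case True
  then have "b \<le> d" using b[of 0] by (simp add: offsets_def)
  then show ?thesis using True by (simp add: penalty_zero)
next
  case False
  then obtain \<delta> where \<delta>: "\<delta> \<in> set (offsets m T)" "C - d \<le> \<delta>" "m * \<delta> \<le> (m + 1) * (C - d)"
    using offsets_dense[OF m, of "C - d" T] d by auto
  then have "b \<le> d + \<delta>" using b by auto
  then have "m * (b - d) \<le> m * \<delta>" using m by simp
  then have "m * (b - d) \<le> (m + 1) * (C - d)" using \<delta> by linarith
  moreover have "0 \<le> (m + 1) * (C - d)" using False m by (intro mult_nonneg_nonneg) auto
  ultimately show ?thesis using False m by (cases Q) (auto simp: penalty_def max_def)
qed

section \<open>Scaling the rational data to integers\<close>

definition all_rats :: "sched \<Rightarrow> rat list" where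
  "all_rats I = ptimes I @ weights I @ concat (map (\<lambda>s. fst s # snd s) (scenarios I))"

text \<open>A product instead of a least common multiple: it is directly computable, and its bit
  length is at most the sum of those of the denominators.\<close>

definition denominators_prod :: "sched \<Rightarrow> int" where
  "denominators_prod I = (\<Prod>r\<leftarrow>all_rats I. snd (quotient_of r))"

text \<open>For a number of the instance the division is exact and the result is
  \<open>r * denominators_prod I\<close>; times, weights and probabilities are all scaled
  alike.\<close>

definition to_int :: "sched \<Rightarrow> rat \<Rightarrow> int" where
  "to_int I r = fst (quotient_of r) * (denominators_prod I div snd (quotient_of r))"

lemma denominators_prod_pos: "0 < denominators_prod I"
proof -
  have "0 < (\<Prod>r\<leftarrow>xs. snd (quotient_of r))" for xs
    by (induction xs) (auto simp: quotient_of_denom_pos')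
  then show ?thesis unfolding denominators_prod_def .
qed

lemma of_int_to_int:
  assumes "r \<in> set (all_rats I)"
  shows "of_int (to_int I r) = r * of_int (denominators_prod I)"
proof -
  obtain a b where q: "quotient_of r = (a, b)" by fastforce
  have "b dvd (\<Prod>r\<leftarrow>xs. snd (quotient_of r))" if "r \<in> set xs" for xs
    using that q by (induction xs) auto
  then obtain c where c: "denominators_prod I = b * c" using assms unfolding denominators_prod_def by blast
  have "b > 0" using quotient_of_denom_pos[OF q] .
  then show ?thesis using q c quotient_of_div[OF q] by (simp add: to_int_def)
qed

lemma to_int_nonneg:
  assumes "0 \<le> r"
  shows "0 \<le> to_int I r"
proof -
  obtain a b where q: "quotient_of r = (a, b)" by fastforce
  have "b > 0" using quotient_of_denom_pos[OF q] .
  moreover have "0 \<le> a" using quotient_of_div[OF q] assms \<open>b > 0\<close>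
    by (simp add: zero_le_divide_iff)
  ultimately show ?thesis using q denominators_prod_pos[of I]
    by (simp add: to_int_def pos_imp_zdiv_nonneg_iff)
qed

definition job_time :: "sched \<Rightarrow> nat \<Rightarrow> int" where
  "job_time I j = to_int I (ptimes I ! j)"

definition job_cost :: "problem \<Rightarrow> sched \<Rightarrow> nat \<Rightarrow> int \<Rightarrow> int" where
  "job_cost Q I j b = to_int I (weights I ! j) *
     (\<Sum>s\<leftarrow>scenarios I. to_int I (fst s) * penalty Q (to_int I (snd s ! j)) b)"

text \<open>0 is the initial deadline, and at the load every schedule is finished, so all demands
  can be met. The due dates of all jobs and scenarios are pooled into one grid.\<close>

definition breakpoints :: "int \<Rightarrow> sched \<Rightarrow> int list" where
  "breakpoints m I = 0 # load (num_jobs I) (job_time I) # concat (map (\<lambda>s. concat (map (\<lambda>d.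
     map (\<lambda>\<delta>. to_int I d + \<delta>) (offsets m (load (num_jobs I) (job_time I)))) (snd s))) (scenarios I))"

definition final_state :: "problem \<Rightarrow> int \<Rightarrow> sched \<Rightarrow> state" where
  "final_state Q m I = (step (num_jobs I) (job_time I) (breakpoints m I)
     ^^ (num_jobs I * length (breakpoints m I))) (\<lambda>_. 0, job_cost Q I, [])"

definition deadlines :: "problem \<Rightarrow> int \<Rightarrow> sched \<Rightarrow> nat \<Rightarrow> int" where
  "deadlines Q m I = (case final_state Q m I of (r, g, l) \<Rightarrow>
     fold (undo (num_jobs I) (job_time I) (breakpoints m I)) l r)"

definition schedule :: "problem \<Rightarrow> int \<Rightarrow> sched \<Rightarrow> nat list" where
  "schedule Q m I = edd (num_jobs I) (deadlines Q m I)"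

section \<open>The guarantee for the scaled expected cost\<close>

context
  fixes I :: sched
  assumes valid: "valid_inst I"
begin

lemma valid_mems:
  "j < num_jobs I \<Longrightarrow> ptimes I ! j \<in> set (all_rats I) \<and> 0 \<le> ptimes I ! j"
  "j < num_jobs I \<Longrightarrow> weights I ! j \<in> set (all_rats I) \<and> 0 \<le> weights I ! j"
  "s \<in> set (scenarios I) \<Longrightarrow> fst s \<in> set (all_rats I) \<and> 0 < fst s \<and> length (snd s) = num_jobs I"
  "s \<in> set (scenarios I) \<Longrightarrow> d \<in> set (snd s) \<Longrightarrow> d \<in> set (all_rats I) \<and> 0 \<le> d"
proof -
  show "j < num_jobs I \<Longrightarrow> ptimes I ! j \<in> set (all_rats I) \<and> 0 \<le> ptimes I ! j"
   "j < num_jobs I \<Longrightarrow> weights I ! j \<in> set (all_rats I) \<and> 0 \<le> weights I ! j"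
    using valid by (auto simp: valid_inst_def all_rats_def num_jobs_def)
  show 3: "s \<in> set (scenarios I) \<Longrightarrow> fst s \<in> set (all_rats I) \<and> 0 < fst s \<and> length (snd s) = num_jobs I"
    using valid unfolding valid_inst_def all_rats_def num_scenarios_def prob_def
    by (auto simp: in_set_conv_nth[of s])
  show "d \<in> set (all_rats I) \<and> 0 \<le> d" if s: "s \<in> set (scenarios I)" and d: "d \<in> set (snd s)"
  proof -
    obtain i where i: "i < num_scenarios I" "scenarios I ! i = s"
      using s by (auto simp: in_set_conv_nth num_scenarios_def)
    obtain j where j: "j < num_jobs I" "snd s ! j = d"
      using d 3[OF s] by (auto simp: in_set_conv_nth)
    have "0 \<le> d" using valid i j unfolding valid_inst_def due_def by blast
    then show ?thesis using s d by (auto simp: all_rats_def)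
  qed
qed

lemma job_time_nonneg: "j < num_jobs I \<Longrightarrow> 0 \<le> job_time I j"
  using valid_mems(1) to_int_nonneg by (simp add: job_time_def)

lemma job_cost_mono:
  assumes "j < num_jobs I" "b \<le> b'"
  shows "job_cost Q I j b \<le> job_cost Q I j b'"
  unfolding job_cost_def using valid_mems(2)[OF assms(1)] valid_mems(3) assms(2)
  by (intro mult_left_mono sum_list_mono to_int_nonneg penalty_mono) (auto intro: less_imp_le)

lemma job_cost_nonneg:
  assumes "j < num_jobs I"
  shows "0 \<le> job_cost Q I j b"
  unfolding job_cost_def using valid_mems(2)[OF assms(1)] valid_mems(3)
  by (intro mult_nonneg_nonneg sum_list_nonneg to_int_nonneg)
    (auto intro!: mult_nonneg_nonneg to_int_nonneg penalty_nonneg intro: less_imp_le)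

text \<open>Due dates are nonnegative. Hence the residual cost at the initial deadlines 0, which
  charges only positive deadlines, is the full cost.\<close>

lemma job_cost_zero:
  assumes "j < num_jobs I"
  shows "job_cost Q I j 0 = 0"
proof -
  have "(\<Sum>s\<leftarrow>scenarios I. to_int I (fst s) * penalty Q (to_int I (snd s ! j)) 0) = 
     (\<Sum>s\<leftarrow>scenarios I. 0)"
    using valid_mems(3,4) assms
    by (intro arg_cong[where f = sum_list] map_cong refl) (simp add: penalty_zero to_int_nonneg)
  then show ?thesis by (simp add: job_cost_def)
qed

lemma breakpoint_offset:
  assumes "s \<in> set (scenarios I)" "j < num_jobs I" "\<delta> \<in> set (offsets m (load (num_jobs I) (job_time I)))"
  shows "to_int I (snd s ! j) + \<delta> \<in> set (breakpoints m I)"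
proof -
  have "snd s ! j \<in> set (snd s)" using valid_mems(3)[OF assms(1)] assms(2) by simp
  then show ?thesis using assms(1,3) unfolding breakpoints_def by force
qed

lemma offsets_nonneg: "\<delta> \<in> set (offsets m T) \<Longrightarrow> 0 \<le> \<delta>"
proof -
  have "0 \<le> offset m k" for k using offset_ge[of k m] by linarith
  then show "\<delta> \<in> set (offsets m T) \<Longrightarrow> 0 \<le> \<delta>" by (auto simp: offsets_def)
qed

lemma cover_instance: "cover_instance (num_jobs I) (job_time I) (breakpoints m I)"
proof
  show "0 \<le> job_time I j" if "j < num_jobs I" for j using job_time_nonneg that .
  have "0 \<le> load (num_jobs I) (job_time I)"
    unfolding load_def by (rule sum_list_nonneg) (use job_time_nonneg in auto)
  moreover have "0 \<le> to_int I d + \<delta>"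
    if "s \<in> set (scenarios I)" "d \<in> set (snd s)" "\<delta> \<in> set (offsets m T)" for s d \<delta> T
    using to_int_nonneg[where r = d and I = I] valid_mems(4)[OF that(1,2)] offsets_nonneg[OF that(3)] by simp
  ultimately show "0 \<le> b" if "b \<in> set (breakpoints m I)" for b
    using that by (auto simp: breakpoints_def)
  show "load (num_jobs I) (job_time I) \<in> set (breakpoints m I)" by (simp add: breakpoints_def)
qed

interpretation cover_instance "num_jobs I" "job_time I" "breakpoints m I" for m
  by (rule cover_instance)

lemma valid_init: "valid_state m (\<lambda>_. 0) (job_cost Q I)"
proof -
  have "0 \<in> set (breakpoints m I)" by (simp add: breakpoints_def)
  then show ?thesis unfolding valid_state_def by (simp add: job_cost_nonneg)
qed

lemma solves_deadlines: "solves m (\<lambda>_. 0) (job_cost Q I) (deadlines Q m I)"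
proof -
  have "potential m (\<lambda>_. 0) \<le> (\<Sum>j<num_jobs I. length (breakpoints m I))"
    unfolding potential_def
    by (intro sum_mono order_trans[OF card_mono card_length]) auto
  then have "potential m (\<lambda>_. 0) \<le> num_jobs I * length (breakpoints m I)" by simp
  from solves_iterate[OF valid_init[where Q = Q] this, where l = "[]"] show ?thesis
    unfolding deadlines_def final_state_def by auto
qed

text \<open>Up to and including \<open>j\<close> only jobs with deadline at most
  \<open>\<sigma> j\<close> are processed, and the demand at the breakpoint
  \<open>\<sigma> j\<close> says that these weigh at most \<open>\<sigma> j\<close>.\<close>

lemma finish_edd_le:
  assumes "covers (num_jobs I) (job_time I) (breakpoints m I) \<sigma>" "j < num_jobs I" "\<sigma> j \<in> set (breakpoints m I)"
  shows "finish (job_time I) (edd (num_jobs I) \<sigma>) j \<le> \<sigma> j"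
proof -
  let ?n = "num_jobs I" and ?p = "job_time I"
  let ?xs = "edd ?n \<sigma>" and ?S = "{k. k < ?n \<and> \<sigma> k \<le> \<sigma> j}"
  have "j \<in> set ?xs" using assms(2) edd_props by simp
  then obtain ys zs where xs: "?xs = ys @ j # zs" "j \<notin> set ys" by (meson split_list_first)
  then have tw: "takeWhile (\<lambda>k. k \<noteq> j) ?xs = ys" unfolding xs(1) by (subst takeWhile_append2) auto
  have ys: "distinct ys" "set ys \<subseteq> ?S - {j}"
    using edd_props[where n = ?n and \<sigma> = \<sigma>] xs(2) unfolding xs(1) by (auto simp: sorted_append)
  have "finish ?p ?xs j = (\<Sum>k\<in>set ys. ?p k) + ?p j"
    unfolding finish_def tw using ys(1) by (simp add: sum_list_distinct_conv_sum_set)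
  also have "\<dots> \<le> (\<Sum>k\<in>?S - {j}. ?p k) + ?p j"
    using ys(2) job_time_nonneg by (intro add_right_mono sum_mono2) auto
  also have "\<dots> = (\<Sum>k\<in>?S. ?p k)" using assms(2) by (subst sum.remove[of ?S j]) auto
  also have "\<dots> = (\<Sum>k<?n. if \<sigma> k \<le> \<sigma> j then ?p k else 0)"
    by (simp add: sum.If_cases Collect_conj_eq lessThan_def)
  also have "\<dots> = load ?n ?p - (\<Sum>k<?n. if \<sigma> j < \<sigma> k then ?p k else 0)"
    unfolding load_eq sum_subtractf[symmetric] by (rule sum.cong) auto
  also have "\<dots> \<le> \<sigma> j"
    using assms(1,3) unfolding covers_iff demand_eq by fastforce
  finally show ?thesis .
qed

text \<open>Each completion time is rounded up to the next breakpoint. Demands are met because jobs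
  with rounded deadline at most \<open>b\<close> finish by \<open>b\<close>. As the grid contains
  the offsets from every due date, the same rounding is good in every scenario and for both
  problems.\<close>

lemma round_up_schedule:
  assumes \<pi>: "\<pi> \<in> schedules I" and m: "0 < m"
  obtains \<tau> where "covers (num_jobs I) (job_time I) (breakpoints m I) \<tau>"
    "\<forall>j<num_jobs I. \<tau> j \<in> set (breakpoints m I)"
    "\<And>Q j. j < num_jobs I \<Longrightarrow> m * job_cost Q I j (\<tau> j) \<le> (m + 1) * job_cost Q I j (finish (job_time I) \<pi> j)"
proof -
  let ?n = "num_jobs I" and ?p = "job_time I" and ?B = "breakpoints m I"
  let ?C = "finish ?p \<pi>"
  have \<pi>: "distinct \<pi>" "set \<pi> = {..<?n}" using \<pi> by (auto simp: schedules_def permutations_of_set_def)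
  define \<tau> where "\<tau> j = Min {b \<in> set ?B. ?C j \<le> b}" for j
  have C_le: "?C j \<le> load ?n ?p" if "j < ?n" for j
    using sum_finished_load[OF \<pi>(1), of ?p j] job_time_nonneg that \<pi>(2) by (simp add: load_eq)
  have mem: "\<tau> j \<in> {b \<in> set ?B. ?C j \<le> b}" if "j < ?n" for j
  proof -
    have "load ?n ?p \<in> {b \<in> set ?B. ?C j \<le> b}" using C_le[OF that] load_in_B by simp
    then show ?thesis unfolding \<tau>_def by (intro Min_in) auto
  qed
  have le: "\<tau> j \<le> b" if "b \<in> set ?B" "?C j \<le> b" for j b
    unfolding \<tau>_def using that by (intro Min_le) auto
  have "covers ?n ?p ?B \<tau>"
    unfolding covers_iff
  proof
    fix b assume b: "b \<in> set ?B"
    have "load ?n ?p - (\<Sum>k<?n. if b < \<tau> k then ?p k else 0) = (\<Sum>k<?n. if \<tau> k \<le> b then ?p k else 0)"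
      unfolding load_eq sum_subtractf[symmetric] by (rule sum.cong) auto
    also have "\<dots> \<le> (\<Sum>k<?n. if 0 + ?C k \<le> b then ?p k else 0)"
      by (rule sum_mono) (use mem job_time_nonneg in fastforce)
    also have "\<dots> \<le> max 0 (b - 0)"
      using sum_finished_le[OF \<pi>(1), of ?p 0 b] job_time_nonneg \<pi>(2) by simp
    also have "\<dots> = b" using B_nonneg[OF b] by simp
    finally show "demand ?n ?p \<tau> b \<le> 0" unfolding demand_eq by simp
  qed
  moreover have "m * job_cost Q I j (\<tau> j) \<le> (m + 1) * job_cost Q I j (?C j)" if j: "j < ?n" for Q j
  proof -
    have "m * (\<Sum>s\<leftarrow>scenarios I. to_int I (fst s) * penalty Q (to_int I (snd s ! j)) (\<tau> j))
       \<le> (m + 1) * (\<Sum>s\<leftarrow>scenarios I. to_int I (fst s) * penalty Q (to_int I (snd s ! j)) (?C j))"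
      unfolding sum_list_const_mult[symmetric]
    proof (rule sum_list_mono)
      fix s assume s: "s \<in> set (scenarios I)"
      have "m * penalty Q (to_int I (snd s ! j)) (\<tau> j) \<le> (m + 1) * penalty Q (to_int I (snd s ! j)) (?C j)"
      proof (rule penalty_round[OF m _ C_le[OF j]])
        show "0 \<le> to_int I (snd s ! j)" using valid_mems(3,4)[OF s] j by (simp add: to_int_nonneg)
        show "\<tau> j \<le> to_int I (snd s ! j) + \<delta>"
          if "\<delta> \<in> set (offsets m (load ?n ?p))" "?C j \<le> to_int I (snd s ! j) + \<delta>" for \<delta>
          using le breakpoint_offset[OF s j that(1)] that(2) by blast
      qed
      then have "to_int I (fst s) * (m * penalty Q (to_int I (snd s ! j)) (\<tau> j)) \<le>
          to_int I (fst s) * ((m + 1) * penalty Q (to_int I (snd s ! j)) (?C j))"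
        using valid_mems(3)[OF s] by (intro mult_left_mono to_int_nonneg) auto
      then show "m * (to_int I (fst s) * penalty Q (to_int I (snd s ! j)) (\<tau> j)) \<le>
          (m + 1) * (to_int I (fst s) * penalty Q (to_int I (snd s ! j)) (?C j))"
        by (simp only: mult.left_commute)
    qed
    then have "to_int I (weights I ! j) * (m * (\<Sum>s\<leftarrow>scenarios I. to_int I (fst s) * penalty Q (to_int I (snd s ! j)) (\<tau> j)))
       \<le> to_int I (weights I ! j) * ((m + 1) * (\<Sum>s\<leftarrow>scenarios I. to_int I (fst s) * penalty Q (to_int I (snd s ! j)) (?C j)))"
      using valid_mems(2)[OF j] by (intro mult_left_mono to_int_nonneg) auto
    then show ?thesis unfolding job_cost_def by (simp only: mult.left_commute)
  qed
  ultimately show thesis using that mem by blast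
qed

lemma schedule_in_schedules: "schedule Q m I \<in> schedules I"
  using edd_props by (auto simp: schedule_def schedules_def permutations_of_set_def)

lemma schedule_cost_le:
  assumes \<pi>: "\<pi> \<in> schedules I" and m: "0 < m"
  shows "m * (\<Sum>j<num_jobs I. job_cost Q I j (finish (job_time I) (schedule Q m I) j))
    \<le> 4 * (m + 1) * (\<Sum>j<num_jobs I. job_cost Q I j (finish (job_time I) \<pi> j))"
proof -
  let ?n = "num_jobs I" and ?p = "job_time I" and ?B = "breakpoints m I" and ?c = "job_cost Q I"
  let ?s = "deadlines Q m I"
  obtain \<tau> where \<tau>: "covers ?n ?p ?B \<tau>" "\<forall>j<?n. \<tau> j \<in> set ?B"
    "\<And>j. j < ?n \<Longrightarrow> m * ?c j (\<tau> j) \<le> (m + 1) * ?c j (finish ?p \<pi> j)"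
    using round_up_schedule[OF \<pi> m] by metis
  have s: "\<forall>j<?n. 0 \<le> ?s j \<and> ?s j \<in> set ?B" "covers ?n ?p ?B ?s"
    "residual_cost ?n (\<lambda>_. 0) ?c ?s \<le> 4 * residual_cost ?n (\<lambda>_. 0) ?c \<tau>"
    using solves_deadlines[of m Q] \<tau>(1,2) unfolding solves_def by blast+
  have res: "residual_cost ?n (\<lambda>_. 0) ?c \<rho> = (\<Sum>j<?n. ?c j (\<rho> j))"
    if "\<forall>j<?n. \<rho> j \<in> set ?B" for \<rho>
    unfolding residual_cost_def
  proof (rule sum.cong)
    fix j assume "j \<in> {..<?n}"
    then show "(if 0 < \<rho> j then ?c j (\<rho> j) else 0) = ?c j (\<rho> j)"
      using job_cost_zero[of j Q] that B_nonneg[of "\<rho> j" m] by (cases "\<rho> j = 0") force+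
  qed simp
  have "m * (\<Sum>j<?n. ?c j (finish ?p (schedule Q m I) j)) \<le> m * (\<Sum>j<?n. ?c j (?s j))"
  proof (intro mult_left_mono sum_mono)
    fix j assume "j \<in> {..<?n}"
    then show "?c j (finish ?p (schedule Q m I) j) \<le> ?c j (?s j)"
      using s finish_edd_le unfolding schedule_def by (intro job_cost_mono) auto
  qed (use m in simp)
  also have "\<dots> \<le> m * (4 * (\<Sum>j<?n. ?c j (\<tau> j)))"
    using s(3) res[of ?s] res[OF \<tau>(2)] s(1) m by (intro mult_left_mono) auto
  also have "\<dots> = 4 * (\<Sum>j<?n. m * ?c j (\<tau> j))"
    by (simp add: sum_distrib_left mult.left_commute)
  also have "\<dots> \<le> 4 * (\<Sum>j<?n. (m + 1) * ?c j (finish ?p \<pi> j))"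
    using \<tau>(3) by (intro mult_left_mono sum_mono) auto
  finally show ?thesis by (simp only: sum_distrib_left mult.assoc)
qed

end

section \<open>Expected cost and conditional value at risk\<close>

definition expected_cost :: "problem \<Rightarrow> sched \<Rightarrow> nat list \<Rightarrow> rat" where
  "expected_cost Q I \<pi> = (\<Sum>i<num_scenarios I. prob I i * cost Q I \<pi> i)"

lemma of_int_sum_list: "of_int (\<Sum>x\<leftarrow>xs. f x) = (\<Sum>x\<leftarrow>xs. of_int (f x))"
  by (induction xs) auto

lemma of_int_finish:
  assumes "valid_inst I" "\<pi> \<in> schedules I" "j < num_jobs I"
  shows "of_int (finish (job_time I) \<pi> j) = completion I \<pi> j * of_int (denominators_prod I)"
proof -
  have p: "of_int (job_time I k) = ptimes I ! k * of_int (denominators_prod I)" if "k < num_jobs I" for k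
    unfolding job_time_def by (rule of_int_to_int) (use valid_mems(1)[OF assms(1) that] in simp)
  have "set \<pi> = {..<num_jobs I}" using assms(2) by (auto simp: schedules_def permutations_of_set_def)
  then have "(\<Sum>k\<leftarrow>takeWhile (\<lambda>k. k \<noteq> j) \<pi>. of_int (job_time I k)) =
      (\<Sum>k\<leftarrow>takeWhile (\<lambda>k. k \<noteq> j) \<pi>. ptimes I ! k * of_int (denominators_prod I))"
    by (intro arg_cong[where f = sum_list] map_cong refl p) (auto dest: set_takeWhileD)
  then show ?thesis
    by (simp add: finish_def completion_def of_int_sum_list p assms(3) distrib_right sum_list_mult_const)
qed

definition late_penalty :: "problem \<Rightarrow> rat \<Rightarrow> rat \<Rightarrow> rat" where
  "late_penalty Q d c = (case Q of Sum_wU \<Rightarrow> if c > d then 1 else 0 | Sum_wT \<Rightarrow> max 0 (c - d))"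

text \<open>Tardiness is a time and scales with the denominators, whereas being late is invariant
  under scaling.\<close>

definition penalty_scale :: "problem \<Rightarrow> sched \<Rightarrow> int" where
  "penalty_scale Q I = (case Q of Sum_wU \<Rightarrow> 1 | Sum_wT \<Rightarrow> denominators_prod I)"

lemma cost_eq: "cost Q I \<pi> i = (\<Sum>j<num_jobs I. weights I ! j * late_penalty Q (due I i j) (completion I \<pi> j))"
  by (cases Q) (auto simp: late_penalty_def late_def tardiness_def)

lemma of_int_penalty:
  assumes "of_int a = d * of_int (denominators_prod I)" "of_int b = c * of_int (denominators_prod I)"
  shows "of_int (penalty Q a b) = late_penalty Q d c * of_int (penalty_scale Q I)"
proof -
  have D: "(0 :: rat) < of_int (denominators_prod I)" using denominators_prod_pos by simp
  have "a < b \<longleftrightarrow> (of_int a :: rat) < of_int b" by simp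
  also have "\<dots> \<longleftrightarrow> d < c" unfolding assms using D by simp
  finally have less: "a < b \<longleftrightarrow> d < c" .
  show ?thesis
  proof (cases Q)
    case Sum_wU
    then show ?thesis using less by (simp add: penalty_def late_penalty_def penalty_scale_def)
  next
    case Sum_wT
    have "of_int (b - a) = (c - d) * of_int (denominators_prod I)"
      by (simp add: assms left_diff_distrib)
    then show ?thesis using less Sum_wT
      by (cases "a < b") (auto simp: penalty_def late_penalty_def penalty_scale_def max_def)
  qed
qed

text \<open>The two factors \<open>denominators_prod I\<close> stem from the weights and the
  probabilities, the third factor from the penalties.\<close>

lemma sum_job_cost:
  assumes I: "valid_inst I" and \<pi>: "\<pi> \<in> schedules I"
  shows "of_int (\<Sum>j<num_jobs I. job_cost Q I j (finish (job_time I) \<pi> j)) =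
    of_int (denominators_prod I * denominators_prod I * penalty_scale Q I) * expected_cost Q I \<pi>"
proof -
  let ?D = "of_int (denominators_prod I) :: rat" and ?E = "of_int (penalty_scale Q I) :: rat"
  let ?K = "num_scenarios I" and ?n = "num_jobs I"
  have job: "of_int (job_cost Q I j (finish (job_time I) \<pi> j)) =
      (\<Sum>i<?K. ?D * ?D * ?E * (prob I i * (weights I ! j * late_penalty Q (due I i j) (completion I \<pi> j))))"
    if j: "j < ?n" for j
  proof -
    have "of_int (\<Sum>s\<leftarrow>scenarios I. to_int I (fst s) * penalty Q (to_int I (snd s ! j)) (finish (job_time I) \<pi> j))
      = (\<Sum>s\<leftarrow>scenarios I. (fst s * ?D) * (late_penalty Q (snd s ! j) (completion I \<pi> j) * ?E))"
      unfolding of_int_sum_list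
    proof (intro arg_cong[where f = sum_list] map_cong refl)
      fix s assume s: "s \<in> set (scenarios I)"
      have "snd s ! j \<in> set (snd s)" using valid_mems(3)[OF I s] j by simp
      then have "snd s ! j \<in> set (all_rats I)" using valid_mems(4)[OF I s] by blast
      from of_int_penalty[OF of_int_to_int[OF this] of_int_finish[OF I \<pi> j]]
      show "of_int (to_int I (fst s) * penalty Q (to_int I (snd s ! j)) (finish (job_time I) \<pi> j)) =
         fst s * ?D * (late_penalty Q (snd s ! j) (completion I \<pi> j) * ?E)"
        using valid_mems(3)[OF I s] by (simp add: of_int_to_int)
    qed
    also have "\<dots> = (\<Sum>i<?K. (prob I i * ?D) * (late_penalty Q (due I i j) (completion I \<pi> j) * ?E))"
      by (simp add: sum_list_sum_nth atLeast0LessThan prob_def due_def num_scenarios_def)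
    finally show ?thesis
      using valid_mems(2)[OF I j] unfolding job_cost_def
      by (simp add: of_int_to_int sum_distrib_left mult_ac)
  qed
  have "of_int (\<Sum>j<?n. job_cost Q I j (finish (job_time I) \<pi> j)) = (\<Sum>j<?n. \<Sum>i<?K. 
      ?D * ?D * ?E * (prob I i * (weights I ! j * late_penalty Q (due I i j) (completion I \<pi> j))))"
    using job by simp
  also have "\<dots> = (\<Sum>i<?K. \<Sum>j<?n.
      ?D * ?D * ?E * (prob I i * (weights I ! j * late_penalty Q (due I i j) (completion I \<pi> j))))"
    by (rule sum.swap)
  also have "\<dots> = ?D * ?D * ?E * expected_cost Q I \<pi>"
    unfolding expected_cost_def cost_eq by (simp only: sum_distrib_left)
  finally show ?thesis by simp
qed

lemma expected_cost_schedule_le: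
  assumes I: "valid_inst I" and \<pi>: "\<pi> \<in> schedules I" and m: "0 < m"
  shows "of_int m * expected_cost Q I (schedule Q m I) \<le> of_int (4 * (m + 1)) * expected_cost Q I \<pi>"
proof -
  let ?S = "denominators_prod I * denominators_prod I * penalty_scale Q I"
  have S: "0 < (of_int ?S :: rat)"
    unfolding of_int_0_less_iff using denominators_prod_pos by (cases Q) (auto simp: penalty_scale_def)
  have "(of_int (m * (\<Sum>j<num_jobs I. job_cost Q I j (finish (job_time I) (schedule Q m I) j))) :: rat)
    \<le> of_int (4 * (m + 1) * (\<Sum>j<num_jobs I. job_cost Q I j (finish (job_time I) \<pi> j)))"
    by (subst of_int_le_iff) (rule schedule_cost_le[OF assms])
  then have "of_int m * (of_int ?S * expected_cost Q I (schedule Q m I)) \<le>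
      of_int (4 * (m + 1)) * (of_int ?S * expected_cost Q I \<pi>)"
    by (simp only: of_int_mult[of m] of_int_mult[of "4 * (m + 1)"] sum_job_cost[OF I \<pi>]
      sum_job_cost[OF I schedule_in_schedules[OF I]])
  then have "of_int ?S * (of_int m * expected_cost Q I (schedule Q m I)) \<le>
      of_int ?S * (of_int (4 * (m + 1)) * expected_cost Q I \<pi>)"
    by (simp only: mult.left_commute)
  then show ?thesis using S by (simp only: mult_le_cancel_left_pos)
qed

lemma cost_nonneg:
  assumes "valid_inst I" "i < num_scenarios I"
  shows "0 \<le> cost Q I \<pi> i"
  unfolding cost_eq using assms(1)
  by (intro sum_nonneg mult_nonneg_nonneg) (auto simp: valid_inst_def late_penalty_def split: problem.split)

lemma valid_inst_prob:
  assumes "valid_inst I"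
  shows "\<And>i. i < num_scenarios I \<Longrightarrow> 0 < (of_rat (prob I i) :: real)"
    and "(\<Sum>i<num_scenarios I. of_rat (prob I i)) = (1 :: real)"
proof -
  show "\<And>i. i < num_scenarios I \<Longrightarrow> 0 < (of_rat (prob I i) :: real)"
    using assms by (auto simp: valid_inst_def)
  have "(of_rat (\<Sum>i<num_scenarios I. prob I i) :: real) = 1" using assms by (simp add: valid_inst_def)
  then show "(\<Sum>i<num_scenarios I. of_rat (prob I i)) = (1 :: real)" by (simp add: of_rat_sum)
qed

lemma expectation_random_cost:
  fixes h :: "real \<Rightarrow> real"
  assumes I: "valid_inst I"
  shows "measure_pmf.expectation (random_cost Q I \<pi>) h =
    (\<Sum>i<num_scenarios I. of_rat (prob I i) * h (of_rat (cost Q I \<pi> i)))"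
proof -
  let ?K = "num_scenarios I"
  let ?xs = "map (\<lambda>i. (i, of_rat (prob I i) :: real)) [0..<?K]"
  have wf: "pmf_of_list_wf ?xs"
    using valid_inst_prob[OF I]
    by (intro pmf_of_list_wfI)
      (auto simp: comp_def sum_list_distinct_conv_sum_set atLeast0LessThan less_imp_le)
  have filter: "filter (\<lambda>j. j = i) [0..<k] = (if i < k then [i] else [])" for i k :: nat
    by (induction k) auto
  have pmf: "pmf (scenario_pmf I) i = of_rat (prob I i)" if "i < ?K" for i
    unfolding scenario_pmf_def pmf_pmf_of_list[OF wf] using that
    by (simp add: filter_map comp_def filter)
  have "set_pmf (scenario_pmf I) \<subseteq> {..<?K}"
    using set_pmf_of_list[OF wf] by (auto simp: scenario_pmf_def)
  then have "measure_pmf.expectation (scenario_pmf I) (\<lambda>i. h (of_rat (cost Q I \<pi> i))) =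
      (\<Sum>i<?K. h (of_rat (cost Q I \<pi> i)) * pmf (scenario_pmf I) i)"
    by (intro integral_measure_pmf_real) auto
  also have "\<dots> = (\<Sum>i<?K. of_rat (prob I i) * h (of_rat (cost Q I \<pi> i)))"
    by (rule sum.cong) (simp_all add: pmf mult.commute)
  finally show ?thesis by (simp add: random_cost_def)
qed

lemma min_exp_objective_eq:
  assumes "valid_inst I"
  shows "min_exp_objective Q I \<pi> = of_rat (expected_cost Q I \<pi>)"
  unfolding min_exp_objective_def expectation_random_cost[OF assms] expected_cost_def
  by (simp add: of_rat_sum of_rat_mult)

text \<open>The lower bound holds for every \<open>\<gamma>\<close>, since \<open>v i\<close> is at
  most \<open>\<gamma> + max 0 (v i - \<gamma>)\<close> and \<open>1 / (1 - \<alpha>)\<close> is at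
  least 1. The upper bounds evaluate the infimum at two values of \<open>\<gamma>\<close>: at 0, and
  at the mean divided by \<open>c\<close>, which no cost exceeds.\<close>

lemma CVaR_bounds:
  fixes v q :: "nat \<Rightarrow> real"
  assumes E: "\<And>h. measure_pmf.expectation X h = (\<Sum>i<K. q i * h (v i))"
    and q: "\<And>i. i < K \<Longrightarrow> 0 < q i" "(\<Sum>i<K. q i) = 1" and v: "\<And>i. i < K \<Longrightarrow> 0 \<le> v i"
    and \<alpha>: "0 \<le> \<alpha>" "\<alpha> < 1"
  shows "(\<Sum>i<K. q i * v i) \<le> CVaR \<alpha> X"
    and "CVaR \<alpha> X \<le> (\<Sum>i<K. q i * v i) / (1 - \<alpha>)"
    and "0 < c \<Longrightarrow> (\<And>i. i < K \<Longrightarrow> c \<le> q i) \<Longrightarrow> CVaR \<alpha> X \<le> (\<Sum>i<K. q i * v i) / c"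
proof -
  let ?E = "\<Sum>i<K. q i * v i"
  define g where "g \<gamma> = \<gamma> + 1 / (1 - \<alpha>) * (\<Sum>i<K. q i * max 0 (v i - \<gamma>))" for \<gamma>
  have CVaR: "CVaR \<alpha> X = (INF \<gamma>. g \<gamma>)" unfolding CVaR_def E g_def ..
  have lower: "?E \<le> g \<gamma>" for \<gamma>
  proof -
    have "?E = \<gamma> * (\<Sum>i<K. q i) + (\<Sum>i<K. q i * (v i - \<gamma>))"
      by (simp add: algebra_simps sum.distrib sum_subtractf sum_distrib_left)
    also have "(\<Sum>i<K. q i * (v i - \<gamma>)) \<le> (\<Sum>i<K. q i * max 0 (v i - \<gamma>))"
      using q(1) by (intro sum_mono mult_left_mono) (auto intro: less_imp_le)
    also have "\<dots> \<le> 1 / (1 - \<alpha>) * (\<Sum>i<K. q i * max 0 (v i - \<gamma>))"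
    proof -
      have "0 \<le> (\<Sum>i<K. q i * max 0 (v i - \<gamma>))"
        using q(1) by (intro sum_nonneg mult_nonneg_nonneg) (auto intro: less_imp_le)
      moreover have "1 \<le> 1 / (1 - \<alpha>)" using \<alpha> by simp
      ultimately show ?thesis using mult_right_mono[of 1 "1 / (1 - \<alpha>)"] by simp
    qed
    finally show ?thesis using q(2) by (simp add: g_def)
  qed
  show "?E \<le> CVaR \<alpha> X" unfolding CVaR by (rule cINF_greatest) (use lower in auto)
  have upper: "CVaR \<alpha> X \<le> g \<gamma>" for \<gamma>
    unfolding CVaR by (rule cINF_lower[OF bdd_belowI2[OF lower]]) simp
  have "g 0 = ?E / (1 - \<alpha>)" using v by (simp add: g_def max_absorb2)
  then show "CVaR \<alpha> X \<le> ?E / (1 - \<alpha>)" using upper[of 0] by simp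
  assume c: "0 < c" "\<And>i. i < K \<Longrightarrow> c \<le> q i"
  have "v i \<le> ?E / c" if i: "i < K" for i
  proof -
    have "c * v i \<le> q i * v i" using c(2)[OF i] v[OF i] by (rule mult_right_mono)
    also have "\<dots> \<le> ?E" by (rule member_le_sum) (use i q v in \<open>auto intro: less_imp_le mult_nonneg_nonneg\<close>)
    finally show ?thesis using c(1) by (simp add: field_simps)
  qed
  then have "g (?E / c) = ?E / c" by (simp add: g_def max_absorb1)
  then show "CVaR \<alpha> X \<le> ?E / c" using upper[of "?E / c"] by simp
qed

lemma min_cvar_objective_bounds:
  assumes I: "valid_inst I" and \<alpha>: "0 \<le> \<alpha>" "\<alpha> < 1"
  shows "min_exp_objective Q I \<pi> \<le> min_cvar_objective \<alpha> Q I \<pi>"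
    and "min_cvar_objective \<alpha> Q I \<pi> \<le> min_exp_objective Q I \<pi> / (1 - \<alpha>)"
    and "min_cvar_objective \<alpha> Q I \<pi> \<le> min_exp_objective Q I \<pi> / prob_min I"
    and "0 < prob_min I"
proof -
  note * = CVaR_bounds[OF expectation_random_cost[OF I] valid_inst_prob[OF I] _ \<alpha>]
  have nn: "\<And>i. i < num_scenarios I \<Longrightarrow> 0 \<le> (of_rat (cost Q I \<pi> i) :: real)"
    using cost_nonneg[OF I] by simp
  have eq: "min_exp_objective Q I \<pi> = (\<Sum>i<num_scenarios I. of_rat (prob I i) * of_rat (cost Q I \<pi> i))"
    unfolding min_exp_objective_def by (rule expectation_random_cost[OF I])
  show "min_exp_objective Q I \<pi> \<le> min_cvar_objective \<alpha> Q I \<pi>"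
    "min_cvar_objective \<alpha> Q I \<pi> \<le> min_exp_objective Q I \<pi> / (1 - \<alpha>)"
    unfolding min_cvar_objective_def eq by (intro * nn; assumption)+
  have "num_scenarios I \<noteq> 0"
  proof
    assume "num_scenarios I = 0"
    then show False using I unfolding valid_inst_def by simp
  qed
  then have fin: "finite (prob I ` {..<num_scenarios I})" "prob I ` {..<num_scenarios I} \<noteq> {}" by auto
  then have "Min (prob I ` {..<num_scenarios I}) \<in> prob I ` {..<num_scenarios I}" by (rule Min_in)
  then show pos: "0 < prob_min I" using valid_inst_prob(1)[OF I] by (auto simp: prob_min_def)
  have le: "prob_min I \<le> of_rat (prob I i)" if "i < num_scenarios I" for i
    unfolding prob_min_def of_rat_less_eq using fin that by (intro Min_le) auto
  show "min_cvar_objective \<alpha> Q I \<pi> \<le> min_exp_objective Q I \<pi> / prob_min I"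
    unfolding min_cvar_objective_def eq by (rule *(3)[OF _ nn pos le])
qed

lemma approximable_if_polynomial_time:
  assumes \<epsilon>: "\<epsilon> > 0" and \<alpha>: "0 \<le> \<alpha>" "\<alpha> < 1"
    and poly: "\<And>m. 0 < m \<Longrightarrow> polynomial_time_on {I. valid_inst I} enc_inst enc_schedule (schedule Q m)"
  shows "approximable_within (min_exp_objective Q) (\<lambda>I. 4 + \<epsilon>) \<and>
    approximable_within (min_cvar_objective \<alpha> Q)
      (\<lambda>I. min ((4 + \<epsilon>) / prob_min I) ((4 + \<epsilon>) / (1 - \<alpha>)))"
proof -
  \<comment> \<open>Rounding and covering together lose the factor
    \<open>4 * (m + 1) / m = 4 + 4 / m\<close>.\<close>
  define m where "m = max 1 \<lceil>4 / \<epsilon>\<rceil>"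
  have m: "0 < m" by (simp add: m_def)
  have "4 / \<epsilon> \<le> of_int m" unfolding m_def by linarith
  then have m\<epsilon>: "4 \<le> of_int m * \<epsilon>" using \<epsilon> by (simp add: field_simps)
  have obj_nonneg: "0 \<le> min_exp_objective Q I \<pi>" if "valid_inst I" for I \<pi>
    unfolding min_exp_objective_def expectation_random_cost[OF that]
    using valid_inst_prob(1)[OF that] cost_nonneg[OF that]
    by (intro sum_nonneg mult_nonneg_nonneg) (auto intro: less_imp_le)
  have main: "min_exp_objective Q I (schedule Q m I) \<le> (4 + \<epsilon>) * min_exp_objective Q I \<pi>"
    if I: "valid_inst I" and \<pi>: "\<pi> \<in> schedules I" for I \<pi>
  proof -
    have "(of_rat (of_int m * expected_cost Q I (schedule Q m I)) :: real) \<le>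
        of_rat (of_int (4 * (m + 1)) * expected_cost Q I \<pi>)"
      unfolding of_rat_less_eq by (rule expected_cost_schedule_le[OF I \<pi> m])
    then have "real_of_int m * min_exp_objective Q I (schedule Q m I)
        \<le> real_of_int (4 * (m + 1)) * min_exp_objective Q I \<pi>"
      by (simp only: min_exp_objective_eq[OF I] of_rat_mult of_rat_of_int_eq)
    also have "\<dots> \<le> (of_int m * (4 + \<epsilon>)) * min_exp_objective Q I \<pi>"
      using m\<epsilon> by (intro mult_right_mono obj_nonneg I) (simp add: algebra_simps)
    finally have "real_of_int m * min_exp_objective Q I (schedule Q m I)
        \<le> real_of_int m * ((4 + \<epsilon>) * min_exp_objective Q I \<pi>)" by (simp only: mult.assoc)
    then show ?thesis using m by simp
  qed
  have Min: "\<exists>\<pi>\<in>schedules I. Min (obj ` schedules I) = obj \<pi>" for obj :: "nat list \<Rightarrow> real" and I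
    using Min_in[of "obj ` schedules I"] finite_schedules schedules_nonempty by blast
  have 1: "min_exp_objective Q I (schedule Q m I) \<le> (4 + \<epsilon>) * Min (min_exp_objective Q I ` schedules I)"
    if I: "valid_inst I" for I
    using main[OF I] Min[where obj = "min_exp_objective Q I" and I = I] by auto
  have 2: "min_cvar_objective \<alpha> Q I (schedule Q m I) \<le> min ((4 + \<epsilon>) / prob_min I) ((4 + \<epsilon>) / (1 - \<alpha>))
       * Min (min_cvar_objective \<alpha> Q I ` schedules I)" if I: "valid_inst I" for I
  proof -
    obtain \<pi> where \<pi>: "\<pi> \<in> schedules I"
      "Min (min_cvar_objective \<alpha> Q I ` schedules I) = min_cvar_objective \<alpha> Q I \<pi>"
      using Min by blast
    note b = min_cvar_objective_bounds[OF I \<alpha>]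
    \<comment> \<open>\<open>\<pi>\<close> is optimal for CVaR; its expected cost is at most its
      CVaR, so the guarantee for the expectation transfers.\<close>
    have "min_exp_objective Q I (schedule Q m I) \<le> (4 + \<epsilon>) * min_cvar_objective \<alpha> Q I \<pi>"
      using main[OF I \<pi>(1)] mult_left_mono[OF b(1)[where Q = Q and \<pi> = \<pi>], of "4 + \<epsilon>"] \<epsilon> by linarith
    then have "min_cvar_objective \<alpha> Q I (schedule Q m I) \<le> (4 + \<epsilon>) / x * min_cvar_objective \<alpha> Q I \<pi>"
      if "x = prob_min I \<or> x = 1 - \<alpha>" for x
      using that b(2,3)[where Q = Q and \<pi> = "schedule Q m I"] b(4) \<alpha>
        divide_right_mono[of "min_exp_objective Q I (schedule Q m I)" "(4 + \<epsilon>) * min_cvar_objective \<alpha> Q I \<pi>" x]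
      by auto
    then show ?thesis unfolding \<pi>(2) by (simp add: min_def)
  qed
  show ?thesis unfolding approximable_within_def
    using poly[OF m] schedule_in_schedules 1 2 by blast
qed

section \<open>A calculus for polynomial-time computation\<close>

text \<open>Bounds refer to the size \<open>sz\<close> of the original input rather than to
  intermediate values, so polynomials are added and multiplied but never composed.\<close>

definition poly_bounded :: "'x set \<Rightarrow> ('x \<Rightarrow> nat) \<Rightarrow> ('x \<Rightarrow> nat) \<Rightarrow> bool" where
  "poly_bounded D sz f \<longleftrightarrow> (\<exists>q :: nat poly. \<forall>x\<in>D. f x \<le> poly q (sz x))"

lemma poly_bounded_mono:
  assumes "poly_bounded D sz g" "\<And>x. x \<in> D \<Longrightarrow> f x \<le> g x"
  shows "poly_bounded D sz f"
  using assms order_trans unfolding poly_bounded_def by metis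

lemma poly_bounded_const: "poly_bounded D sz (\<lambda>x. c)"
  unfolding poly_bounded_def by (rule exI[of _ "[:c:]"]) simp

lemma poly_bounded_add:
  assumes "poly_bounded D sz f" "poly_bounded D sz g"
  shows "poly_bounded D sz (\<lambda>x. f x + g x)"
proof -
  obtain p q where "\<forall>x\<in>D. f x \<le> poly p (sz x)" "\<forall>x\<in>D. g x \<le> poly q (sz x)"
    using assms unfolding poly_bounded_def by blast
  then show ?thesis unfolding poly_bounded_def
    by (intro exI[of _ "p + q"]) (simp add: add_mono)
qed

lemma poly_bounded_mult:
  assumes "poly_bounded D sz f" "poly_bounded D sz g"
  shows "poly_bounded D sz (\<lambda>x. f x * g x)"
proof -
  obtain p q where "\<forall>x\<in>D. f x \<le> poly p (sz x)" "\<forall>x\<in>D. g x \<le> poly q (sz x)"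
    using assms unfolding poly_bounded_def by blast
  then show ?thesis unfolding poly_bounded_def
    by (intro exI[of _ "p * q"]) (simp add: mult_le_mono)
qed

lemma poly_bounded_Suc: "poly_bounded D sz f \<Longrightarrow> poly_bounded D sz (\<lambda>x. Suc (f x))"
  using poly_bounded_add[OF poly_bounded_const[of D sz 1]] by simp

lemma poly_bounded_size: "poly_bounded D sz sz"
  unfolding poly_bounded_def by (rule exI[of _ "[:0, 1:]"]) simp

lemma poly_bounded_sum_list:
  assumes "\<And>f. f \<in> set fs \<Longrightarrow> poly_bounded D sz f"
  shows "poly_bounded D sz (\<lambda>x. \<Sum>f\<leftarrow>fs. f x)"
  using assms by (induction fs) (simp_all add: poly_bounded_const poly_bounded_add)

lemma poly_bounded_transport:
  assumes "poly_bounded D sz f" "\<And>y. y \<in> D' \<Longrightarrow> h y \<in> D"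
  shows "poly_bounded D' (\<lambda>y. sz (h y)) (\<lambda>y. f (h y))"
  using assms unfolding poly_bounded_def by blast

text \<open>Relocation of a program placed behind \<open>k\<close> other functions: calls are by
  position, so linking two programs shifts the calls of the second.\<close>

fun shift_calls :: "nat \<Rightarrow> expr \<Rightarrow> expr" where
  "shift_calls k (Var i) = Var i"
| "shift_calls k (Const c) = Const c"
| "shift_calls k (Prim f es) = Prim f (map (shift_calls k) es)"
| "shift_calls k (Let a b) = Let (shift_calls k a) (shift_calls k b)"
| "shift_calls k (If a b c) = If (shift_calls k a) (shift_calls k b) (shift_calls k c)"
| "shift_calls k (Call f es) = Call (k + f) (map (shift_calls k) es)"

lemma eval_append_program:
  "eval P env e v t \<Longrightarrow> eval (P @ Q) env e v t"
  "evals P env es vs t \<Longrightarrow> evals (P @ Q) env es vs t"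
proof (induction rule: eval_evals.inducts)
  case (eval_Const env c)
  show ?case by (rule eval_evals.eval_Const)
qed (auto intro: eval_evals.intros simp: nth_append)

lemma eval_shift_calls:
  "eval P env e v t \<Longrightarrow>
     eval (Q @ map (shift_calls (length Q)) P) env (shift_calls (length Q) e) v t"
  "evals P env es vs t \<Longrightarrow>
     evals (Q @ map (shift_calls (length Q)) P) env (map (shift_calls (length Q)) es) vs t"
proof (induction rule: eval_evals.inducts)
  case (eval_Const env c)
  show ?case unfolding shift_calls.simps by (rule eval_evals.eval_Const)
next
  case (eval_Call env es vs t1 f v t2)
  then show ?case by (auto intro!: eval_evals.eval_Call simp: nth_append)
qed (auto intro: eval_evals.intros)

lemma bitsize_pos: "bitsize v > 0"
  by (cases v) auto

text \<open>Leaves and primitives are charged for the values they produce, and the other nodes pass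
  a value on. Hence whatever is computed in polynomial time has polynomial size, and many size
  estimates come for free.\<close>

lemma bitsize_le_cost:
  "eval P env e v t \<Longrightarrow> bitsize v \<le> t"
  "evals P env es vs t \<Longrightarrow> (\<Sum>v\<leftarrow>vs. bitsize v) \<le> t"
  by (induction rule: eval_evals.inducts) auto

lemma floorlog_mult_le: "floorlog 2 (a * b) \<le> floorlog 2 a + floorlog 2 b"
proof (cases "a = 0 \<or> b = 0")
  case False
  have "a < 2 ^ floorlog 2 a" "b < 2 ^ floorlog 2 b"
    using floorlog_leD[OF order_refl, of 2] by auto
  then have "a * b < 2 ^ (floorlog 2 a + floorlog 2 b)"
    using False by (auto simp: power_add intro: mult_strict_mono)
  then show ?thesis using False by (simp add: floorlog_le_iff)
qed (auto simp: floorlog_def)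

lemma floorlog_add_le: "floorlog 2 (a + b) \<le> floorlog 2 a + floorlog 2 b"
proof (cases "a = 0 \<or> b = 0")
  case False
  have a: "a < 2 ^ floorlog 2 a" and b: "b < 2 ^ floorlog 2 b"
    using floorlog_leD[OF order_refl, of 2] by auto
  have "a + b < 2 ^ floorlog 2 a * 2 ^ floorlog 2 b" 
  proof -
    have "a + 1 \<le> 2 ^ floorlog 2 a" "b + 1 \<le> 2 ^ floorlog 2 b" using a b by auto
    then have "(a + 1) * (b + 1) \<le> 2 ^ floorlog 2 a * 2 ^ floorlog 2 b" by (rule mult_le_mono)
    then show ?thesis by simp
  qed
  then show ?thesis using False by (simp add: floorlog_le_iff power_add)
qed (auto simp: floorlog_def)

abbreviation BoolV :: "bool \<Rightarrow> dat" where "BoolV b \<equiv> IntV (of_bool b)"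

abbreviation ibits :: "int \<Rightarrow> nat" where "ibits z \<equiv> floorlog 2 (nat \<bar>z\<bar>)"

lemma ibits_mono: "\<bar>a\<bar> \<le> \<bar>b\<bar> \<Longrightarrow> ibits a \<le> ibits b"
  by (intro floorlog_mono) auto

lemma ibits_add: "ibits (x + y) \<le> ibits x + ibits y"
proof -
  have "nat \<bar>x + y\<bar> \<le> nat \<bar>x\<bar> + nat \<bar>y\<bar>" by linarith
  then show ?thesis using floorlog_add_le floorlog_mono order_trans by meson
qed

lemma ibits_diff: "ibits (x - y) \<le> ibits x + ibits y"
  using ibits_add[of x "- y"] by simp

lemma ibits_mult: "ibits (x * y) \<le> ibits x + ibits y"
  using floorlog_mult_le[of "nat \<bar>x\<bar>" "nat \<bar>y\<bar>"] by (simp add: abs_mult nat_mult_distrib)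

text \<open>Division rounds towards minus infinity; for negative \<open>x\<close> the quotient is
  still at least \<open>x\<close>, as a positive divisor is at least 1. A negative divisor reduces
  to this by changing both signs.\<close>

lemma abs_div_le: "\<bar>x div y\<bar> \<le> \<bar>x :: int\<bar>"
proof (cases "y = 0")
  case False
  have pos: "\<bar>x div y\<bar> \<le> \<bar>x\<bar>" if "y > 0" for x y :: int
  proof (cases "x \<ge> 0")
    case True
    then have nn: "x div y \<ge> 0"
      using that by (simp add: pos_imp_zdiv_nonneg_iff)
    then have "x div y * 1 \<le> x div y * y" using that by (intro mult_left_mono) auto
    moreover have "x div y * y \<le> x" using that nn pos_mod_sign[of y x] div_mult_mod_eq[of x y] by linarith
    ultimately show ?thesis using nn True by linarith
  next
    case False
    have "x \<le> x div y"
    proof (rule ccontr)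
      assume "\<not> x \<le> x div y"
      then have "x div y + 1 \<le> x" by simp
      then have "(x div y + 1) * y \<le> x * y" using that by (intro mult_right_mono) auto
      moreover have "x < (x div y + 1) * y"
        using pos_mod_bound[OF that, of x] div_mult_mod_eq[of x y]
        unfolding distrib_right mult_1 by linarith
      moreover have "x * y \<le> x * 1" using False that by (intro mult_left_mono_neg) auto
      ultimately show False by linarith
    qed
    moreover have "x div y < 0" using False that by (simp add: div_neg_pos_less0)
    ultimately show ?thesis by linarith
  qed
  show ?thesis using pos[of y x] pos[of "-y" "-x"] False by (cases "y > 0") auto
qed simp

text \<open>The additive 2 pays for results not built from the arguments: truth values, the empty
  list and the default 0.\<close>

lemma bitsize_apply_prim: "bitsize (apply_prim f vs) \<le> (\<Sum>v\<leftarrow>vs. bitsize v) + 2"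
proof (cases "(f, vs)" rule: apply_prim.cases)
  case (1 x y) then show ?thesis using ibits_add[of x y] by auto
next
  case (2 x y) then show ?thesis using ibits_diff[of x y] by auto
next
  case (3 x y) then show ?thesis using ibits_mult[of x y] by auto
next
  case (4 x y) then show ?thesis using ibits_mono[OF abs_div_le[of x y]] by auto
qed (auto simp: compute_floorlog)

section \<open>Polynomial-time computability, uniformly over a context\<close>

definition bounded_env :: "'x set \<Rightarrow> ('x \<Rightarrow> nat) \<Rightarrow> ('x \<Rightarrow> dat) list \<Rightarrow> bool" where
  "bounded_env D sz env \<longleftrightarrow> (\<forall>f\<in>set env. poly_bounded D sz (\<lambda>x. bitsize (f x)))"

definition realizes_list :: "program \<Rightarrow> expr list \<Rightarrow> nat poly \<Rightarrow> 'x set \<Rightarrow> ('x \<Rightarrow> nat) \<Rightarrow>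
    ('x \<Rightarrow> dat) list \<Rightarrow> ('x \<Rightarrow> dat) list \<Rightarrow> bool" where
  "realizes_list P es q D sz env Fs \<longleftrightarrow>
     (\<forall>x\<in>D. \<exists>t\<le>poly q (sz x). evals P (map (\<lambda>f. f x) env) es (map (\<lambda>F. F x) Fs) t)"

definition realizes :: "program \<Rightarrow> expr \<Rightarrow> nat poly \<Rightarrow> 'x set \<Rightarrow> ('x \<Rightarrow> nat) \<Rightarrow>
    ('x \<Rightarrow> dat) list \<Rightarrow> ('x \<Rightarrow> dat) \<Rightarrow> bool" where
  "realizes P e q D sz env F \<longleftrightarrow>
     (\<forall>x\<in>D. \<exists>t\<le>poly q (sz x). eval P (map (\<lambda>f. f x) env) e (F x) t)"

text \<open>
  \<open>F\<close> is computed by an expression in the environment \<open>env\<close>, in time polynomial in \<open>sz\<close>, uniformly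
  over the context \<open>x \<in> D\<close>.  The context may carry more information than the program can see.
\<close>

definition computes :: "'x set \<Rightarrow> ('x \<Rightarrow> nat) \<Rightarrow> ('x \<Rightarrow> dat) list \<Rightarrow> ('x \<Rightarrow> dat) \<Rightarrow> bool" where
  "computes D sz env F \<longleftrightarrow> bounded_env D sz env \<and> (\<exists>P e q. realizes P e q D sz env F)"

lemma realizes_append: "realizes P e q D sz env F \<Longrightarrow> realizes (P @ Q) e q D sz env F"
  unfolding realizes_def by (meson eval_append_program(1))

lemma realizes_shift: "realizes P e q D sz env F \<Longrightarrow>
    realizes (Q @ map (shift_calls (length Q)) P) (shift_calls (length Q) e) q D sz env F"
  unfolding realizes_def by (meson eval_shift_calls(1))

lemma realizes_list_append:
  "realizes_list P es q D sz env Fs \<Longrightarrow> realizes_list (P @ Q) es q D sz env Fs"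
  unfolding realizes_list_def by (meson eval_append_program(2))

lemma realizes_list_shift: "realizes_list P es q D sz env Fs \<Longrightarrow>
    realizes_list (Q @ map (shift_calls (length Q)) P) (map (shift_calls (length Q)) es) q D sz env Fs"
  unfolding realizes_list_def by (meson eval_shift_calls(2))

lemma computes_bounded_env: "computes D sz env F \<Longrightarrow> bounded_env D sz env"
  by (simp add: computes_def)

lemma computes_imp_poly_bounded:
  assumes "computes D sz env F"
  shows "poly_bounded D sz (\<lambda>x. bitsize (F x))"
  using assms unfolding computes_def realizes_def poly_bounded_def
  by (meson bitsize_le_cost(1) order_trans)

lemma computes_cong:
  assumes "computes D sz env F" "\<And>x. x \<in> D \<Longrightarrow> F x = G x"
  shows "computes D sz env G"
  using assms unfolding computes_def realizes_def by simp

lemma computes_Var: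
  assumes "bounded_env D sz env" "f \<in> set env"
  shows "computes D sz env f"
proof -
  obtain i where i: "i < length env" "env ! i = f" using assms(2) by (auto simp: in_set_conv_nth)
  obtain q where q: "\<forall>x\<in>D. bitsize (f x) \<le> poly q (sz x)"
    using assms unfolding bounded_env_def poly_bounded_def by blast
  have "eval [] (map (\<lambda>f. f x) env) (Var i) (f x) (bitsize (f x))" for x
    using eval_Var[of i "map (\<lambda>f. f x) env" "[]"] i by simp
  then have "realizes [] (Var i) q D sz env f" unfolding realizes_def using q by blast
  with assms(1) show ?thesis unfolding computes_def by blast
qed

lemma computes_Const:
  assumes "bounded_env D sz env"
  shows "computes D sz env (\<lambda>x. IntV c)"
proof -
  have "realizes [] (Const c) [:bitsize (IntV c):] D sz env (\<lambda>x. IntV c)"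
    unfolding realizes_def using eval_Const[of "[]" _ c] by auto
  then show ?thesis using assms unfolding computes_def by blast
qed

lemma computes_list:
  assumes "bounded_env D sz env" "\<And>F. F \<in> set Fs \<Longrightarrow> computes D sz env F"
  obtains P es q where "realizes_list P es q D sz env Fs"
proof -
  have "\<exists>P es q. realizes_list P es q D sz env Fs"
    using assms(2)
  proof (induction Fs)
    case Nil
    have "realizes_list [] [] 0 D sz env []"
      unfolding realizes_list_def by (auto intro: evals_Nil)
    then show ?case by blast
  next
    case (Cons F Fs)
    obtain P e q where 1: "realizes P e q D sz env F"
      using Cons.prems[of F] unfolding computes_def by auto
    obtain Q es r where 2: "realizes_list Q es r D sz env Fs" using Cons by auto
    let ?R = "P @ map (shift_calls (length P)) Q"
    have "realizes ?R e q D sz env F"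
      "realizes_list ?R (map (shift_calls (length P)) es) r D sz env Fs"
      using realizes_append[OF 1] realizes_list_shift[OF 2] by auto
    then have "realizes_list ?R (e # map (shift_calls (length P)) es) (q + r) D sz env (F # Fs)"
      unfolding realizes_def realizes_list_def
      by (auto intro!: add_mono) (meson add_mono evals_Cons)
    then show ?case by blast
  qed
  with that show thesis by blast
qed

lemma computes_Prim:
  assumes "bounded_env D sz env" "\<And>F. F \<in> set Fs \<Longrightarrow> computes D sz env F"
  shows "computes D sz env (\<lambda>x. apply_prim f (map (\<lambda>F. F x) Fs))"
proof -
  obtain P es q where r: "realizes_list P es q D sz env Fs" using computes_list[OF assms] .
  \<comment> \<open>Cost \<open>t\<close> for computing the arguments, at most \<open>t\<close> for
    reading them and at most \<open>t + 2\<close> for writing the result.\<close>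
  have "realizes P (Prim f es) ([:3:] * q + [:2:]) D sz env (\<lambda>x. apply_prim f (map (\<lambda>F. F x) Fs))"
    unfolding realizes_def
  proof
    fix x assume "x \<in> D"
    then obtain t where t: "t \<le> poly q (sz x)" "evals P (map (\<lambda>f. f x) env) es (map (\<lambda>F. F x) Fs) t"
      using r unfolding realizes_list_def by blast
    let ?vs = "map (\<lambda>F. F x) Fs"
    have "(\<Sum>u\<leftarrow>?vs. bitsize u) \<le> t" using bitsize_le_cost(2)[OF t(2)] .
    then have "t + (\<Sum>u\<leftarrow>?vs. bitsize u) + bitsize (apply_prim f ?vs) \<le> poly ([:3:] * q + [:2:]) (sz x)"
      using bitsize_apply_prim[of f ?vs] t(1) by simp
    with eval_Prim[OF t(2) refl, of f]
    show "\<exists>t\<le>poly ([:3:] * q + [:2:]) (sz x). eval P (map (\<lambda>f. f x) env) (Prim f es) (apply_prim f ?vs) t"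
      by blast
  qed
  with assms(1) show ?thesis unfolding computes_def by blast
qed

text \<open>The program sees the context only through the environment, so it works unchanged after
  reindexing the context by \<open>h\<close>.\<close>

lemma computes_transport:
  assumes "computes D sz env F" "\<And>y. y \<in> D' \<Longrightarrow> h y \<in> D"
  shows "computes D' (\<lambda>y. sz (h y)) (map (\<lambda>f y. f (h y)) env) (\<lambda>y. F (h y))"
proof -
  obtain P e q where "realizes P e q D sz env F" using assms(1) unfolding computes_def by blast
  then have "realizes P e q D' (\<lambda>y. sz (h y)) (map (\<lambda>f y. f (h y)) env) (\<lambda>y. F (h y))"
    using assms(2) unfolding realizes_def by (simp add: comp_def)
  moreover have "bounded_env D' (\<lambda>y. sz (h y)) (map (\<lambda>f y. f (h y)) env)"
    using computes_bounded_env[OF assms(1)] poly_bounded_transport[of D sz _ D' h, OF _ assms(2)]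
    unfolding bounded_env_def by auto
  ultimately show ?thesis unfolding computes_def by blast
qed

text \<open>A change of environment is implemented as a function call: the expression for
  \<open>F\<close> becomes a function whose arguments are the values of \<open>env'\<close>, which
  avoids renaming de Bruijn indices.\<close>

lemma computes_subst:
  assumes "bounded_env D sz env" "computes D sz env' F" "\<And>f. f \<in> set env' \<Longrightarrow> computes D sz env f"
  shows "computes D sz env F"
proof -
  obtain P es q where 1: "realizes_list P es q D sz env env'" using computes_list[OF assms(1,3)] .
  obtain Q e r where 2: "realizes Q e r D sz env' F" using assms(2) unfolding computes_def by blast
  let ?k = "length P"
  define R where "R = P @ map (shift_calls ?k) Q"
  have 1: "realizes_list (R @ [shift_calls ?k e]) es q D sz env env'"
    and 2: "realizes (R @ [shift_calls ?k e]) (shift_calls ?k e) r D sz env' F"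
    using realizes_list_append[OF realizes_list_append[OF 1]]
      realizes_append[OF realizes_shift[OF 2]] by (auto simp: R_def)
  have "realizes (R @ [shift_calls ?k e]) (Call (length R) es) (q + r + [:1:]) D sz env F"
    unfolding realizes_def
  proof
    fix x assume "x \<in> D"
    then obtain t t' where "t \<le> poly q (sz x)" "t' \<le> poly r (sz x)"
      "evals (R @ [shift_calls ?k e]) (map (\<lambda>f. f x) env) es (map (\<lambda>f. f x) env') t"
      "eval (R @ [shift_calls ?k e]) (map (\<lambda>f. f x) env') (shift_calls ?k e) (F x) t'"
      using 1 2 unfolding realizes_list_def realizes_def by blast
    then show "\<exists>t\<le>poly (q + r + [:1:]) (sz x).
        eval (R @ [shift_calls ?k e]) (map (\<lambda>f. f x) env) (Call (length R) es) (F x) t"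
      by (intro exI[of _ "Suc (t + t')"]) (auto intro!: eval_Call)
  qed
  with assms(1) show ?thesis unfolding computes_def by blast
qed

lemma computes_subset: "computes D sz env F \<Longrightarrow> D' \<subseteq> D \<Longrightarrow> computes D' sz env F"
  using computes_transport[of D sz env F D' "\<lambda>x. x"] by auto

lemma realizes_If:
  assumes "realizes P e0 q0 D sz env (\<lambda>x. BoolV (b x))"
    "realizes P e1 q1 {x\<in>D. b x} sz env F" "realizes P e2 q2 {x\<in>D. \<not> b x} sz env G"
  shows "realizes P (If e0 e1 e2) (q0 + q1 + q2 + [:1:]) D sz env (\<lambda>x. if b x then F x else G x)"
  unfolding realizes_def
proof
  fix x assume x: "x \<in> D"
  obtain t0 where t0: "t0 \<le> poly q0 (sz x)" "eval P (map (\<lambda>f. f x) env) e0 (BoolV (b x)) t0"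
    using assms(1) x unfolding realizes_def by blast
  show "\<exists>t\<le>poly (q0 + q1 + q2 + [:1:]) (sz x).
      eval P (map (\<lambda>f. f x) env) (If e0 e1 e2) (if b x then F x else G x) t"
  proof (cases "b x")
    case True
    then obtain t1 where "t1 \<le> poly q1 (sz x)" "eval P (map (\<lambda>f. f x) env) e1 (F x) t1"
      using assms(2) x unfolding realizes_def by blast
    then show ?thesis using t0 True
      by (intro exI[of _ "Suc (t0 + t1)"]) (auto intro: eval_If_true)
  next
    case False
    then obtain t2 where "t2 \<le> poly q2 (sz x)" "eval P (map (\<lambda>f. f x) env) e2 (G x) t2"
      using assms(3) x unfolding realizes_def by blast
    then show ?thesis using t0 False
      by (intro exI[of _ "Suc (t0 + t2)"]) (auto intro: eval_If_false)
  qed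
qed

text \<open>Each branch has to be correct only where it is taken; this admits partial operations,
  such as selecting from a list known to be nonempty just in that case.\<close>

lemma computes_If_cases:
  assumes "computes D sz env (\<lambda>x. BoolV (b x))"
    "computes {x\<in>D. b x} sz env F" "computes {x\<in>D. \<not> b x} sz env G"
  shows "computes D sz env (\<lambda>x. if b x then F x else G x)"
proof -
  obtain P0 e0 q0 where 0: "realizes P0 e0 q0 D sz env (\<lambda>x. BoolV (b x))"
    using assms(1) unfolding computes_def by blast
  obtain P1 e1 q1 where 1: "realizes P1 e1 q1 {x\<in>D. b x} sz env F"
    using assms(2) unfolding computes_def by blast
  obtain P2 e2 q2 where 2: "realizes P2 e2 q2 {x\<in>D. \<not> b x} sz env G"
    using assms(3) unfolding computes_def by blast
  note realizes_If[OF realizes_append[OF realizes_append[OF 0]] realizes_append[OF realizes_shift[OF 1]]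
    realizes_shift[OF 2]]
  then show ?thesis using computes_bounded_env[OF assms(1)] unfolding computes_def by blast
qed

lemma computes_If:
  assumes "computes D sz env (\<lambda>x. BoolV (b x))" "computes D sz env F" "computes D sz env G"
  shows "computes D sz env (\<lambda>x. if b x then F x else G x)"
  by (intro computes_If_cases assms(1) computes_subset[OF assms(2)] computes_subset[OF assms(3)]) auto

lemma evals_Var:
  assumes "\<And>i. i \<in> set is \<Longrightarrow> i < length env"
  shows "evals P env (map Var is) (map ((!) env) is) (\<Sum>i\<leftarrow>is. bitsize (env ! i))"
  using assms by (induction "is") (auto intro: eval_evals.intros)

text \<open>
  The iterates of a loop are given by a ghost trajectory \<open>st x 0, st x 1, \<dots>\<close>; neither the iteration
  number nor the number \<open>N x\<close> of iterations is visible to the program.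
\<close>

lemma computes_while_concrete:
  assumes init: "computes D sz env (\<lambda>x. st x 0)"
    and N: "poly_bounded D sz N"
    and test: "computes (SIGMA x:D. {..N x}) (\<lambda>y. sz (fst y))
      ((\<lambda>y. st (fst y) (snd y)) # map (\<lambda>f y. f (fst y)) env)
      (\<lambda>y. BoolV (snd y = N (fst y)))"
    and step: "computes (SIGMA x:D. {..<N x}) (\<lambda>y. sz (fst y))
      ((\<lambda>y. st (fst y) (snd y)) # map (\<lambda>f y. f (fst y)) env)
      (\<lambda>y. st (fst y) (Suc (snd y)))"
  shows "computes D sz env (\<lambda>x. st x (N x))"
proof -
  obtain P0 e0 q0 where 0: "realizes P0 e0 q0 D sz env (\<lambda>x. st x 0)"
    using init unfolding computes_def by blast
  let ?env = "(\<lambda>y. st (fst y) (snd y)) # map (\<lambda>f y. f (fst y)) env"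
  let ?sz = "\<lambda>y. sz (fst y)"
  let ?T = "\<lambda>y. BoolV (snd y = N (fst y))"
  let ?S = "\<lambda>y. st (fst y) (Suc (snd y))"
  obtain P1 e1 q1 where 1: "realizes P1 e1 q1 (SIGMA x:D. {..N x}) ?sz ?env ?T"
    using test unfolding computes_def by blast
  obtain P2 e2 q2 where 2: "realizes P2 e2 q2 (SIGMA x:D. {..<N x}) ?sz ?env ?S"
    using step unfolding computes_def by blast
  define P01 where "P01 = P0 @ map (shift_calls (length P0)) P1"
  define P where "P = P01 @ map (shift_calls (length P01)) P2"
  define f1 where "f1 = shift_calls (length P0) e1"
  define f2 where "f2 = shift_calls (length P01) e2"
  define n where "n = length env"
  \<comment> \<open>The loop is a function calling itself: slot 0 holds the state, slots
    \<open>1\<close> to \<open>n\<close> the unchanged environment.\<close>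
  define body where "body = If f1 (Var 0) (Call (length P) (f2 # map Var [1..<Suc n]))"
  define R where "R = P @ [body]"
  have r0: "realizes R e0 q0 D sz env (\<lambda>x. st x 0)"
    unfolding R_def P_def P01_def by (intro realizes_append 0)
  have r1: "realizes R f1 q1 (SIGMA x:D. {..N x}) ?sz ?env ?T"
    unfolding R_def P_def P01_def f1_def by (intro realizes_append realizes_shift 1)
  have r2: "realizes R f2 q2 (SIGMA x:D. {..<N x}) ?sz ?env ?S"
    unfolding R_def P_def f2_def by (intro realizes_append realizes_shift 2)
  obtain qN where qN: "\<And>x. x \<in> D \<Longrightarrow> N x \<le> poly qN (sz x)"
    using N unfolding poly_bounded_def by blast
  have "poly_bounded D sz (\<lambda>x. \<Sum>f\<leftarrow>map (\<lambda>f x. bitsize (f x)) env. f x)"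
    using computes_bounded_env[OF init] unfolding bounded_env_def
    by (intro poly_bounded_sum_list) auto
  then obtain qE where qE: "\<And>x. x \<in> D \<Longrightarrow> (\<Sum>f\<leftarrow>env. bitsize (f x)) \<le> poly qE (sz x)"
    unfolding poly_bounded_def by (auto simp: comp_def)
  have "poly_bounded (SIGMA x:D. {..N x}) ?sz (\<lambda>y. bitsize (st (fst y) (snd y)))"
    using test unfolding computes_def bounded_env_def by simp
  then obtain qS where qS: "\<And>x i. x \<in> D \<Longrightarrow> i \<le> N x \<Longrightarrow> bitsize (st x i) \<le> poly qS (sz x)"
    unfolding poly_bounded_def by fastforce
  \<comment> \<open>Bounds the cost of one round: test, step, copying the environment, returning the
    state, and the unit charges of the conditional and the call.\<close>
  define C where "C = q1 + q2 + qE + qS + [:3:]"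
  have loop: "\<exists>t\<le>Suc (N x - i) * poly C (sz x).
      eval R (st x i # map (\<lambda>f. f x) env) body (st x (N x)) t"
    if x: "x \<in> D" and i: "i \<le> N x" for x i
    using i
  proof (induction "N x - i" arbitrary: i)
    case 0
    then have i: "i = N x" by simp
    obtain t where "t \<le> poly q1 (sz x)"
      "eval R (st x i # map (\<lambda>f. f x) env) f1 (IntV 1) t"
      using bspec[OF r1[unfolded realizes_def], of "(x, N x)"] x i by (auto simp: comp_def)
    moreover have "eval R (st x i # map (\<lambda>f. f x) env) (Var 0) (st x i) (bitsize (st x i))"
      using eval_Var[of 0 "st x i # map (\<lambda>f. f x) env"] by simp
    ultimately show ?case using qS[OF x, of i] i unfolding body_def
      by (intro exI[of _ "Suc (t + bitsize (st x i))"]) (auto intro!: eval_If_true simp: C_def)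
  next
    case (Suc d)
    then have i: "i < N x" by simp
    let ?e = "st x i # map (\<lambda>f. f x) env"
    obtain t1 where t1: "t1 \<le> poly q1 (sz x)" "eval R ?e f1 (IntV 0) t1"
      using bspec[OF r1[unfolded realizes_def], of "(x, i)"] x i by (auto simp: comp_def)
    obtain t2 where t2: "t2 \<le> poly q2 (sz x)" "eval R ?e f2 (st x (Suc i)) t2"
      using bspec[OF r2[unfolded realizes_def], of "(x, i)"] x i by (auto simp: comp_def)
    obtain t3 where t3: "t3 \<le> Suc (N x - Suc i) * poly C (sz x)"
      "eval R (st x (Suc i) # map (\<lambda>f. f x) env) body (st x (N x)) t3"
    proof -
      have "d = N x - Suc i" "Suc i \<le> N x" using Suc.hyps(2) i by auto
      then show ?thesis using Suc.hyps(1)[of "Suc i"] that by blast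
    qed
    have v: "map ((!) ?e) [1..<Suc n] = map (\<lambda>f. f x) env"
      by (rule nth_equalityI) (auto simp: n_def simp del: upt_Suc)
    have vb: "(\<Sum>i\<leftarrow>[1..<Suc n]. bitsize (?e ! i)) = (\<Sum>f\<leftarrow>env. bitsize (f x))"
      using arg_cong[OF v, of "\<lambda>l. sum_list (map bitsize l)"] by (simp add: comp_def del: upt_Suc)
    have "evals R ?e (map Var [1..<Suc n]) (map (\<lambda>f. f x) env) (\<Sum>f\<leftarrow>env. bitsize (f x))"
      using evals_Var[of "[1..<Suc n]" ?e R] unfolding v vb by (simp add: n_def less_Suc_eq_le del: upt_Suc)
    then have "evals R ?e (f2 # map Var [1..<Suc n]) (st x (Suc i) # map (\<lambda>f. f x) env)
        (t2 + (\<Sum>f\<leftarrow>env. bitsize (f x)))"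
      by (rule evals_Cons[OF t2(2)])
    then have "eval R ?e (Call (length P) (f2 # map Var [1..<Suc n])) (st x (N x))
        (Suc ((t2 + (\<Sum>f\<leftarrow>env. bitsize (f x))) + t3))"
      using t3(2) by (intro eval_Call) (auto simp: R_def)
    then have ev: "eval R ?e body (st x (N x)) (Suc (t1 + Suc ((t2 + (\<Sum>f\<leftarrow>env. bitsize (f x))) + t3)))"
      unfolding body_def using t1(2) by (intro eval_If_false) auto
    have "Suc (N x - i) = Suc (Suc (N x - Suc i))" using i by simp
    then have "Suc (N x - i) * poly C (sz x) = poly C (sz x) + Suc (N x - Suc i) * poly C (sz x)" by simp
    then have "Suc (t1 + Suc ((t2 + (\<Sum>f\<leftarrow>env. bitsize (f x))) + t3)) \<le> Suc (N x - i) * poly C (sz x)"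
      using t1(1) t2(1) t3(1) qE[OF x] unfolding C_def by simp
    with ev show ?case by blast
  qed
  have "realizes R (Call (length P) (e0 # map Var [0..<n])) (q0 + qE + [:1:] + (qN + [:1:]) * C) D sz env
      (\<lambda>x. st x (N x))"
    unfolding realizes_def
  proof
    fix x assume x: "x \<in> D"
    let ?e = "map (\<lambda>f. f x) env"
    obtain t0 where t0: "t0 \<le> poly q0 (sz x)" "eval R ?e e0 (st x 0) t0"
      using r0 x unfolding realizes_def by blast
    obtain t1 where t1: "t1 \<le> Suc (N x) * poly C (sz x)" "eval R (st x 0 # ?e) body (st x (N x)) t1"
      using loop[OF x, of 0] by auto
    have v: "map ((!) ?e) [0..<n] = ?e"
      by (rule nth_equalityI) (auto simp: n_def)
    have vb: "(\<Sum>i\<leftarrow>[0..<n]. bitsize (?e ! i)) = (\<Sum>f\<leftarrow>env. bitsize (f x))"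
      using arg_cong[OF v, of "\<lambda>l. sum_list (map bitsize l)"] by (simp add: comp_def)
    have "evals R ?e (map Var [0..<n]) ?e (\<Sum>f\<leftarrow>env. bitsize (f x))"
      using evals_Var[of "[0..<n]" ?e R] unfolding v vb by (auto simp: n_def)
    from evals_Cons[OF t0(2) this]
    have "eval R ?e (Call (length P) (e0 # map Var [0..<n])) (st x (N x))
        (Suc ((t0 + (\<Sum>f\<leftarrow>env. bitsize (f x))) + t1))"
      using t1(2) by (intro eval_Call) (auto simp: R_def)
    moreover have "t1 \<le> Suc (poly qN (sz x)) * poly C (sz x)"
      using t1(1) qN[OF x] by (elim order_trans) (intro mult_le_mono; simp)
    ultimately show "\<exists>t\<le>poly (q0 + qE + [:1:] + (qN + [:1:]) * C) (sz x).
        eval R ?e (Call (length P) (e0 # map Var [0..<n])) (st x (N x)) t"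
      using t0(1) qE[OF x]
      by (intro exI[of _ "Suc ((t0 + (\<Sum>f\<leftarrow>env. bitsize (f x))) + t1)"]) (simp add: algebra_simps)
  qed
  with init show ?thesis unfolding computes_def by blast
qed

text \<open>An interface hiding the environment of a loop body: everything computable outside
  remains computable through the projection \<open>h\<close>, so that proofs about loop bodies never
  mention positions in \<open>env'\<close>.\<close>

definition lifts :: "'x set \<Rightarrow> ('x \<Rightarrow> nat) \<Rightarrow> ('x \<Rightarrow> dat) list \<Rightarrow>
    'y set \<Rightarrow> ('y \<Rightarrow> nat) \<Rightarrow> ('y \<Rightarrow> dat) list \<Rightarrow> ('y \<Rightarrow> 'x) \<Rightarrow> bool" where
  "lifts D sz env D' sz' env' h \<longleftrightarrow> bounded_env D' sz' env' \<and> (\<forall>y\<in>D'. h y \<in> D) \<and>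
     (\<forall>F. computes D sz env F \<longrightarrow> computes D' sz' env' (\<lambda>y. F (h y)))"

lemma liftsD: "lifts D sz env D' sz' env' h \<Longrightarrow> computes D sz env F \<Longrightarrow> computes D' sz' env' (\<lambda>y. F (h y))"
  by (simp add: lifts_def)

lemma lifts_bounded_env: "lifts D sz env D' sz' env' h \<Longrightarrow> bounded_env D' sz' env'"
  by (simp add: lifts_def)

lemma lifts_Cons:
  assumes "bounded_env D sz env" "\<And>y. y \<in> D' \<Longrightarrow> h y \<in> D"
    and "poly_bounded D' (\<lambda>y. sz (h y)) (\<lambda>y. bitsize (v y))"
  shows "lifts D sz env D' (\<lambda>y. sz (h y)) (v # map (\<lambda>f y. f (h y)) env) h" (is "lifts D sz env D' ?sz ?env h")
    and "computes D' (\<lambda>y. sz (h y)) (v # map (\<lambda>f y. f (h y)) env) v"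
proof -
  have b: "bounded_env D' ?sz ?env"
    using assms(1,3) poly_bounded_transport[of D sz _ D' h, OF _ assms(2)] unfolding bounded_env_def by fastforce
  show "computes D' ?sz ?env v" using b by (rule computes_Var) simp
  show "lifts D sz env D' ?sz ?env h"
    unfolding lifts_def
  proof (intro conjI allI impI ballI)
    fix F assume "computes D sz env F"
    then have "computes D' ?sz (map (\<lambda>f y. f (h y)) env) (\<lambda>y. F (h y))"
      by (rule computes_transport) (rule assms(2))
    then show "computes D' ?sz ?env (\<lambda>y. F (h y))"
      by (rule computes_subst[OF b]) (rule computes_Var[OF b], simp)
  qed (use b assms(2) in auto)
qed

text \<open>The size bound on the states is a premise of its own, since polynomially many cheap
  rounds, such as repeated squaring, may still blow up numbers.\<close>

lemma computes_while:
  assumes init: "computes D sz env (\<lambda>x. st x 0)"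
    and N: "poly_bounded D sz N"
    and st: "poly_bounded (SIGMA x:D. {..N x}) (\<lambda>y. sz (fst y)) (\<lambda>y. bitsize (st (fst y) (snd y)))"
    and test: "\<And>env'. lifts D sz env (SIGMA x:D. {..N x}) (\<lambda>y. sz (fst y)) env' fst \<Longrightarrow>
      computes (SIGMA x:D. {..N x}) (\<lambda>y. sz (fst y)) env' (\<lambda>y. st (fst y) (snd y)) \<Longrightarrow>
      computes (SIGMA x:D. {..N x}) (\<lambda>y. sz (fst y)) env' (\<lambda>y. BoolV (snd y = N (fst y)))"
    and step: "\<And>env'. lifts D sz env (SIGMA x:D. {..<N x}) (\<lambda>y. sz (fst y)) env' fst \<Longrightarrow>
      computes (SIGMA x:D. {..<N x}) (\<lambda>y. sz (fst y)) env' (\<lambda>y. st (fst y) (snd y)) \<Longrightarrow>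
      computes (SIGMA x:D. {..<N x}) (\<lambda>y. sz (fst y)) env' (\<lambda>y. st (fst y) (Suc (snd y)))"
  shows "computes D sz env (\<lambda>x. st x (N x))"
proof (rule computes_while_concrete[where st = st, OF init N])
  note b = computes_bounded_env[OF init]
  have st': "poly_bounded (SIGMA x:D. {..<N x}) (\<lambda>y. sz (fst y)) (\<lambda>y. bitsize (st (fst y) (snd y)))"
    using st unfolding poly_bounded_def by fastforce
  show "computes (SIGMA x:D. {..N x}) (\<lambda>y. sz (fst y))
      ((\<lambda>y. st (fst y) (snd y)) # map (\<lambda>f y. f (fst y)) env)
      (\<lambda>y. BoolV (snd y = N (fst y)))"
    by (rule test; rule lifts_Cons) (use st b in auto)
  show "computes (SIGMA x:D. {..<N x}) (\<lambda>y. sz (fst y))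
      ((\<lambda>y. st (fst y) (snd y)) # map (\<lambda>f y. f (fst y)) env)
      (\<lambda>y. st (fst y) (Suc (snd y)))"
    by (rule step; rule lifts_Cons) (use st' b in auto)
qed

section \<open>Arithmetic, comparisons and conditionals\<close>

lemma computes_prim1:
  assumes "computes D sz env F"
  shows "computes D sz env (\<lambda>x. apply_prim f [F x])"
  using computes_Prim[of D sz env "[F]" f] assms computes_bounded_env by fastforce

lemma computes_prim2:
  assumes "computes D sz env F" "computes D sz env G"
  shows "computes D sz env (\<lambda>x. apply_prim f [F x, G x])"
proof -
  have "computes D sz env (\<lambda>x. apply_prim f (map (\<lambda>F. F x) [F, G]))"
    by (rule computes_Prim) (use assms computes_bounded_env in auto)
  then show ?thesis by simp
qed

lemma computes_add:
  "computes D sz env (\<lambda>x. IntV (a x)) \<Longrightarrow> computes D sz env (\<lambda>x. IntV (b x)) \<Longrightarrow>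
   computes D sz env (\<lambda>x. IntV (a x + b x))"
  using computes_prim2[of D sz env "\<lambda>x. IntV (a x)" "\<lambda>x. IntV (b x)" Add] by simp

lemma computes_diff:
  "computes D sz env (\<lambda>x. IntV (a x)) \<Longrightarrow> computes D sz env (\<lambda>x. IntV (b x)) \<Longrightarrow>
   computes D sz env (\<lambda>x. IntV (a x - b x))"
  using computes_prim2[of D sz env "\<lambda>x. IntV (a x)" "\<lambda>x. IntV (b x)" Sub] by simp

lemma computes_mult:
  "computes D sz env (\<lambda>x. IntV (a x)) \<Longrightarrow> computes D sz env (\<lambda>x. IntV (b x)) \<Longrightarrow>
   computes D sz env (\<lambda>x. IntV (a x * b x))"
  using computes_prim2[of D sz env "\<lambda>x. IntV (a x)" "\<lambda>x. IntV (b x)" Mul] by simp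

lemma computes_div:
  "computes D sz env (\<lambda>x. IntV (a x)) \<Longrightarrow> computes D sz env (\<lambda>x. IntV (b x)) \<Longrightarrow>
   computes D sz env (\<lambda>x. IntV (a x div b x))"
  using computes_prim2[of D sz env "\<lambda>x. IntV (a x)" "\<lambda>x. IntV (b x)" Div] by simp

lemma computes_le:
  "computes D sz env (\<lambda>x. IntV (a x)) \<Longrightarrow> computes D sz env (\<lambda>x. IntV (b x)) \<Longrightarrow>
   computes D sz env (\<lambda>x. BoolV (a x \<le> b x))"
  using computes_prim2[of D sz env "\<lambda>x. IntV (a x)" "\<lambda>x. IntV (b x)" Leq]
  by (simp add: of_bool_def)

lemma computes_not:
  assumes "computes D sz env (\<lambda>x. BoolV (a x))"
  shows "computes D sz env (\<lambda>x. BoolV (\<not> a x))"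
  by (rule computes_cong[OF computes_diff[OF computes_Const[OF computes_bounded_env[OF assms], of 1] assms]])
    simp

lemma computes_conj:
  assumes "computes D sz env (\<lambda>x. BoolV (a x))" "computes D sz env (\<lambda>x. BoolV (b x))"
  shows "computes D sz env (\<lambda>x. BoolV (a x \<and> b x))"
  by (rule computes_cong[OF computes_mult[OF assms]]) simp

lemma computes_less:
  assumes "computes D sz env (\<lambda>x. IntV (a x))" "computes D sz env (\<lambda>x. IntV (b x))"
  shows "computes D sz env (\<lambda>x. BoolV (a x < b x))"
  using computes_not[OF computes_le[OF assms(2,1)]] by (simp add: not_le)

lemma computes_eq:
  assumes "computes D sz env (\<lambda>x. IntV (a x))" "computes D sz env (\<lambda>x. IntV (b x))"
  shows "computes D sz env (\<lambda>x. BoolV (a x = b x))"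
  using computes_conj[OF computes_le[OF assms] computes_le[OF assms(2,1)]]
  by (simp add: eq_iff)

lemma computes_If_int:
  assumes "computes D sz env (\<lambda>x. BoolV (b x))" "computes D sz env (\<lambda>x. IntV (f x))"
    "computes D sz env (\<lambda>x. IntV (g x))"
  shows "computes D sz env (\<lambda>x. IntV (if b x then f x else g x))"
  by (rule computes_cong[OF computes_If[OF assms]]) simp

lemma computes_min:
  assumes "computes D sz env (\<lambda>x. IntV (a x))" "computes D sz env (\<lambda>x. IntV (b x))"
  shows "computes D sz env (\<lambda>x. IntV (min (a x) (b x)))"
  using computes_If_int[OF computes_le[OF assms] assms] by (simp add: min_def)

lemma computes_max:
  assumes "computes D sz env (\<lambda>x. IntV (a x))" "computes D sz env (\<lambda>x. IntV (b x))"
  shows "computes D sz env (\<lambda>x. IntV (max (a x) (b x)))"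
  using computes_If_int[OF computes_le[OF assms] assms(2,1)] by (simp add: max_def)

section \<open>Lists and loops over them\<close>

lemma computes_Nil: "bounded_env D sz env \<Longrightarrow> computes D sz env (\<lambda>x. ListV [])"
  using computes_Prim[of D sz env "[]" Empty] by simp

lemma computes_Cons:
  "computes D sz env a \<Longrightarrow> computes D sz env (\<lambda>x. ListV (M x)) \<Longrightarrow>
   computes D sz env (\<lambda>x. ListV (a x # M x))"
  using computes_prim2[of D sz env a "\<lambda>x. ListV (M x)" Cons_op] by simp

lemma computes_head: "computes D sz env (\<lambda>x. ListV (a x # M x)) \<Longrightarrow> computes D sz env a"
  using computes_prim1[of D sz env "\<lambda>x. ListV (a x # M x)" Head] by simp

lemma computes_tail: "computes D sz env (\<lambda>x. ListV (a x # M x)) \<Longrightarrow> computes D sz env (\<lambda>x. ListV (M x))"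
  using computes_prim1[of D sz env "\<lambda>x. ListV (a x # M x)" Tail] by simp

lemma computes_is_Nil:
  "computes D sz env (\<lambda>x. ListV (M x)) \<Longrightarrow> computes D sz env (\<lambda>x. BoolV (M x = []))"
  using computes_prim1[of D sz env "\<lambda>x. ListV (M x)" Is_Empty] by (simp add: of_bool_def)

lemma computes_hd:
  assumes "computes D sz env (\<lambda>x. ListV (M x))" "\<And>x. x \<in> D \<Longrightarrow> M x \<noteq> []"
  shows "computes D sz env (\<lambda>x. hd (M x))"
proof (rule computes_head)
  show "computes D sz env (\<lambda>x. ListV (hd (M x) # tl (M x)))"
    by (rule computes_cong[OF assms(1)]) (simp add: assms(2))
qed

lemma computes_tl:
  assumes "computes D sz env (\<lambda>x. ListV (M x))" "\<And>x. x \<in> D \<Longrightarrow> M x \<noteq> []"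
  shows "computes D sz env (\<lambda>x. ListV (tl (M x)))"
proof (rule computes_tail)
  show "computes D sz env (\<lambda>x. ListV (hd (M x) # tl (M x)))"
    by (rule computes_cong[OF assms(1)]) (simp add: assms(2))
qed

lemma bitsize_ListV_append: "bitsize (ListV (xs @ ys)) \<le> bitsize (ListV xs) + bitsize (ListV ys)"
  by simp

lemma bitsize_mem: "v \<in> set vs \<Longrightarrow> bitsize v \<le> bitsize (ListV vs)"
  by (induction vs) auto

lemma length_le_bitsize: "length vs \<le> bitsize (ListV vs)"
proof (induction vs)
  case (Cons v vs) then show ?case using bitsize_pos[of v] by simp
qed simp


lemma bitsize_take: "bitsize (ListV (take i vs)) \<le> bitsize (ListV vs)"
proof -
  have "bitsize (ListV vs) = bitsize (ListV (take i vs @ drop i vs))" by simp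
  then show ?thesis by (simp del: append_take_drop_id)
qed

lemma bitsize_drop: "bitsize (ListV (drop i vs)) \<le> bitsize (ListV vs)"
proof -
  have "bitsize (ListV vs) = bitsize (ListV (take i vs @ drop i vs))" by simp
  then show ?thesis by (simp del: append_take_drop_id)
qed

lemma bitsize_rev: "bitsize (ListV (rev vs)) = bitsize (ListV vs)"
  by (simp add: rev_map[symmetric])

lemma sum_list_bound: "(\<And>v. v \<in> set vs \<Longrightarrow> f v \<le> (b :: nat)) \<Longrightarrow> (\<Sum>v\<leftarrow>vs. f v) \<le> length vs * b"
  by (induction vs) (auto simp: add_mono)

lemma poly_bounded_fst:
  "poly_bounded D sz f \<Longrightarrow> poly_bounded (SIGMA x:D. A x) (\<lambda>y. sz (fst y)) (\<lambda>y. f (fst y))"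
  by (rule poly_bounded_transport) auto

lemma poly_bounded_length:
  assumes "computes D sz env (\<lambda>x. ListV (map (e x) (L x)))"
  shows "poly_bounded D sz (\<lambda>x. length (L x))"
  by (rule poly_bounded_mono[OF computes_imp_poly_bounded[OF assms]])
    (metis length_le_bitsize length_map)

lemma poly_bounded_elem:
  assumes "computes D sz env (\<lambda>x. ListV (map (e x) (L x)))"
  shows "poly_bounded (SIGMA x:D. set (L x)) (\<lambda>y. sz (fst y)) (\<lambda>y. bitsize (e (fst y) (snd y)))"
  by (rule poly_bounded_mono[OF poly_bounded_fst[OF computes_imp_poly_bounded[OF assms]]])
    (auto intro: bitsize_mem simp del: bitsize.simps)

text \<open>The loop state pairs the unread rest of the list with the accumulator, so that emptiness
  of the rest is a visible termination test. The accumulator after \<open>i\<close> elements is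
  prescribed as \<open>acc x i\<close>.\<close>

lemma computes_fold:
  assumes list: "computes D sz env (\<lambda>x. ListV (map (e x) (L x)))"
    and init: "computes D sz env (\<lambda>x. acc x 0)"
    and acc: "poly_bounded (SIGMA x:D. {..length (L x)}) (\<lambda>y. sz (fst y)) (\<lambda>y. bitsize (acc (fst y) (snd y)))"
    and step: "\<And>env'. lifts D sz env (SIGMA x:D. {..<length (L x)}) (\<lambda>y. sz (fst y)) env' fst \<Longrightarrow>
      computes (SIGMA x:D. {..<length (L x)}) (\<lambda>y. sz (fst y)) env' (\<lambda>y. e (fst y) (L (fst y) ! snd y)) \<Longrightarrow>
      computes (SIGMA x:D. {..<length (L x)}) (\<lambda>y. sz (fst y)) env' (\<lambda>y. acc (fst y) (snd y)) \<Longrightarrow>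
      computes (SIGMA x:D. {..<length (L x)}) (\<lambda>y. sz (fst y)) env' (\<lambda>y. acc (fst y) (Suc (snd y)))"
  shows "computes D sz env (\<lambda>x. acc x (length (L x)))"
proof -
  define st where "st x i = ListV [ListV (map (e x) (drop i (L x))), acc x i]" for x i
  have "computes D sz env (\<lambda>x. st x (length (L x)))"
  proof (rule computes_while)
    show "computes D sz env (\<lambda>x. st x 0)" unfolding st_def drop_0
      by (intro computes_Cons list init computes_Nil[OF computes_bounded_env[OF list]])
    show "poly_bounded D sz (\<lambda>x. length (L x))" by (rule poly_bounded_length[OF list])
    have "poly_bounded (SIGMA x:D. {..length (L x)}) (\<lambda>y. sz (fst y))
       (\<lambda>y. bitsize (ListV (map (e (fst y)) (L (fst y)))) + bitsize (acc (fst y) (snd y)) + 1)"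
      by (intro poly_bounded_add acc poly_bounded_const
        poly_bounded_fst[OF computes_imp_poly_bounded[OF list]])
    then show "poly_bounded (SIGMA x:D. {..length (L x)}) (\<lambda>y. sz (fst y)) (\<lambda>y. bitsize (st (fst y) (snd y)))"
    proof (rule poly_bounded_mono)
      fix y
      show "bitsize (st (fst y) (snd y))
        \<le> bitsize (ListV (map (e (fst y)) (L (fst y)))) + bitsize (acc (fst y) (snd y)) + 1"
        using bitsize_drop[of "snd y" "map (e (fst y)) (L (fst y))"]
        by (simp add: st_def drop_map[symmetric] del: bitsize.simps(2)) (simp add: drop_map[symmetric])
    qed
  next
    fix env' let ?D = "SIGMA x:D. {..length (L x)}" and ?sz = "\<lambda>y. sz (fst y)"
    assume "computes ?D ?sz env' (\<lambda>y. st (fst y) (snd y))"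
    then have "computes ?D ?sz env' (\<lambda>y. ListV (map (e (fst y)) (drop (snd y) (L (fst y)))))"
      unfolding st_def by (rule computes_head)
    from computes_is_Nil[OF this]
    show "computes ?D ?sz env' (\<lambda>y. BoolV (snd y = length (L (fst y))))"
      by (rule computes_cong) auto
  next
    fix env' let ?D = "SIGMA x:D. {..<length (L x)}" and ?sz = "\<lambda>y. sz (fst y)"
    assume l: "lifts D sz env ?D ?sz env' fst" and "computes ?D ?sz env' (\<lambda>y. st (fst y) (snd y))"
    then have s: "computes ?D ?sz env' (\<lambda>y. ListV [ListV (map (e (fst y)) (drop (snd y) (L (fst y)))),
        acc (fst y) (snd y)])"
      by (simp add: st_def)
    note 1 = computes_head[OF s] and 2 = computes_head[OF computes_tail[OF s]]
    have "computes ?D ?sz env' (\<lambda>y. hd (map (e (fst y)) (drop (snd y) (L (fst y)))))"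
      by (rule computes_hd[OF 1]) auto
    then have "computes ?D ?sz env' (\<lambda>y. e (fst y) (L (fst y) ! snd y))"
      by (rule computes_cong) (auto simp: hd_map hd_drop_conv_nth)
    from step[OF l this 2] have 3: "computes ?D ?sz env' (\<lambda>y. acc (fst y) (Suc (snd y)))" .
    have "computes ?D ?sz env' (\<lambda>y. ListV (tl (map (e (fst y)) (drop (snd y) (L (fst y))))))"
      by (rule computes_tl[OF 1]) auto
    then have 4: "computes ?D ?sz env' (\<lambda>y. ListV (map (e (fst y)) (drop (Suc (snd y)) (L (fst y)))))"
      by (rule computes_cong) (auto simp: map_tl[symmetric] tl_drop drop_Suc)
    show "computes ?D ?sz env' (\<lambda>y. st (fst y) (Suc (snd y)))"
      unfolding st_def by (intro computes_Cons 3 4 computes_Nil[OF computes_bounded_env[OF 3]])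
  qed
  then show ?thesis unfolding st_def by (rule computes_head[OF computes_tail])
qed

text \<open>A body verified for an arbitrary element of \<open>A x\<close> is applied to the
  specific element \<open>k y\<close> of a loop round; its encoding \<open>v\<close> is passed as
  the argument.\<close>

lemma computes_instance:
  assumes G: "computes (SIGMA x:D. A x) (\<lambda>z. sz (fst z)) (v # map (\<lambda>f z. f (fst z)) env) G"
    and l: "lifts D sz env D' (\<lambda>y. sz (fst y)) env' fst"
    and k: "\<And>y. y \<in> D' \<Longrightarrow> k y \<in> A (fst y)"
    and v: "computes D' (\<lambda>y. sz (fst y)) env' (\<lambda>y. v (fst y, k y))"
    and env: "bounded_env D sz env"
  shows "computes D' (\<lambda>y. sz (fst y)) env' (\<lambda>y. G (fst y, k y))"
proof -
  have "(fst y, k y) \<in> (SIGMA x:D. A x)" if "y \<in> D'" for y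
    using l k that unfolding lifts_def by auto
  then have "computes D' (\<lambda>y. sz (fst y)) ((\<lambda>y. v (fst y, k y)) # map (\<lambda>f y. f (fst y)) env) (\<lambda>y. G (fst y, k y))"
    using computes_transport[OF G, of D' "\<lambda>y. (fst y, k y)"] by (simp add: comp_def)
  then show ?thesis
    by (rule computes_subst[OF computes_bounded_env[OF v]])
      (use v liftsD[OF l] computes_Var[OF env] in auto)
qed

text \<open>Lists grow at the front only, so reversal onto a second list is the basic operation;
  appending takes two reversals.\<close>

lemma computes_rev_append:
  assumes "computes D sz env (\<lambda>x. ListV (M x))" "computes D sz env (\<lambda>x. ListV (M' x))"
  shows "computes D sz env (\<lambda>x. ListV (rev (M x) @ M' x))"
proof -
  have "computes D sz env (\<lambda>x. (\<lambda>x i. ListV (rev (take i (M x)) @ M' x)) x (length (M x)))"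
  proof (rule computes_fold[where e = "\<lambda>x v. v"])
    show "computes D sz env (\<lambda>x. ListV (map (\<lambda>v. v) (M x)))" using assms(1) by simp
    show "computes D sz env (\<lambda>x. ListV (rev (take 0 (M x)) @ M' x))" using assms(2) by simp
    have "poly_bounded (SIGMA x:D. {..length (M x)}) (\<lambda>y. sz (fst y))
       (\<lambda>y. bitsize (ListV (M (fst y))) + bitsize (ListV (M' (fst y))))"
      by (intro poly_bounded_add poly_bounded_fst computes_imp_poly_bounded[OF assms(1)]
        computes_imp_poly_bounded[OF assms(2)])
    then show "poly_bounded (SIGMA x:D. {..length (M x)}) (\<lambda>y. sz (fst y))
       (\<lambda>y. bitsize (ListV (rev (take (snd y) (M (fst y))) @ M' (fst y))))"
    proof (rule poly_bounded_mono)
      fix y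
      show "bitsize (ListV (rev (take (snd y) (M (fst y))) @ M' (fst y)))
        \<le> bitsize (ListV (M (fst y))) + bitsize (ListV (M' (fst y)))"
        using bitsize_ListV_append[of "rev (take (snd y) (M (fst y)))" "M' (fst y)"]
          bitsize_take[of "snd y" "M (fst y)"] unfolding bitsize_rev by linarith
    qed
  next
    fix env' let ?D = "SIGMA x:D. {..<length (M x)}" and ?sz = "\<lambda>y. sz (fst y)"
    assume "computes ?D ?sz env' (\<lambda>y. M (fst y) ! snd y)"
      "computes ?D ?sz env' (\<lambda>y. ListV (rev (take (snd y) (M (fst y))) @ M' (fst y)))"
    from computes_Cons[OF this]
    show "computes ?D ?sz env' (\<lambda>y. ListV (rev (take (Suc (snd y)) (M (fst y))) @ M' (fst y)))"
      by (rule computes_cong) (auto simp: take_Suc_conv_app_nth)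
  qed
  then show ?thesis by simp
qed

lemma computes_rev:
  assumes "computes D sz env (\<lambda>x. ListV (M x))"
  shows "computes D sz env (\<lambda>x. ListV (rev (M x)))"
  using computes_rev_append[OF assms computes_Nil[OF computes_bounded_env[OF assms]]] by simp

lemma computes_append:
  assumes "computes D sz env (\<lambda>x. ListV (M x))" "computes D sz env (\<lambda>x. ListV (M' x))"
  shows "computes D sz env (\<lambda>x. ListV (M x @ M' x))"
  using computes_rev_append[OF computes_rev[OF assms(1)] assms(2)] by simp

lemma computes_concat_map:
  assumes list: "computes D sz env (\<lambda>x. ListV (map (e x) (L x)))"
    and f: "\<And>env'. lifts D sz env (SIGMA x:D. set (L x)) (\<lambda>y. sz (fst y)) env' fst \<Longrightarrow>
      computes (SIGMA x:D. set (L x)) (\<lambda>y. sz (fst y)) env' (\<lambda>y. e (fst y) (snd y)) \<Longrightarrow>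
      computes (SIGMA x:D. set (L x)) (\<lambda>y. sz (fst y)) env' (\<lambda>y. ListV (f (fst y) (snd y)))"
  shows "computes D sz env (\<lambda>x. ListV (concat (map (f x) (L x))))"
proof -
  note env = computes_bounded_env[OF list]
  let ?D = "SIGMA x:D. set (L x)" and ?env = "(\<lambda>y. e (fst y) (snd y)) # map (\<lambda>f y. f (fst y)) env"
  have c: "computes ?D (\<lambda>y. sz (fst y)) ?env (\<lambda>y. ListV (f (fst y) (snd y)))"
    by (rule f; rule lifts_Cons[OF env _ poly_bounded_elem[OF list]]) auto
  \<comment> \<open>The body is verified once over all elements, which yields one polynomial
    \<open>q\<close> bounding the output for every element.\<close>
  obtain q where q: "\<And>x l. x \<in> D \<Longrightarrow> l \<in> set (L x) \<Longrightarrow> bitsize (ListV (f x l)) \<le> poly q (sz x)"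
    using computes_imp_poly_bounded[OF c] unfolding poly_bounded_def by fastforce
  have "computes D sz env (\<lambda>x. (\<lambda>x i. ListV (concat (map (f x) (take i (L x))))) x (length (L x)))"
  proof (rule computes_fold[OF list])
    show "computes D sz env (\<lambda>x. ListV (concat (map (f x) (take 0 (L x)))))"
      using computes_Nil[OF env] by simp
    have "poly_bounded (SIGMA x:D. {..length (L x)}) (\<lambda>y. sz (fst y))
       (\<lambda>y. length (L (fst y)) * poly q (sz (fst y)) + 1)"
      by (intro poly_bounded_add poly_bounded_mult poly_bounded_const
         poly_bounded_fst[OF poly_bounded_length[OF list]]) (auto simp: poly_bounded_def)
    then show "poly_bounded (SIGMA x:D. {..length (L x)}) (\<lambda>y. sz (fst y))
        (\<lambda>y. bitsize (ListV (concat (map (f (fst y)) (take (snd y) (L (fst y)))))))"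
    proof (rule poly_bounded_mono)
      fix y assume "y \<in> (SIGMA x:D. {..length (L x)})"
      then have y: "fst y \<in> D" by auto
      let ?l = "take (snd y) (L (fst y))"
      have "bitsize (ListV (concat (map (f (fst y)) xs))) \<le> length xs * poly q (sz (fst y)) + 1"
        if "set xs \<subseteq> set (L (fst y))" for xs
        using that by (induction xs) (use q[OF y] in \<open>fastforce+\<close>)
      from this[of ?l] have "bitsize (ListV (concat (map (f (fst y)) ?l))) \<le> length ?l * poly q (sz (fst y)) + 1"
        by (meson set_take_subset)
      also have "\<dots> \<le> length (L (fst y)) * poly q (sz (fst y)) + 1" by simp
      finally show "bitsize (ListV (concat (map (f (fst y)) ?l))) \<le> length (L (fst y)) * poly q (sz (fst y)) + 1" .
    qed
  next
    fix env' let ?D = "SIGMA x:D. {..<length (L x)}" and ?sz = "\<lambda>y. sz (fst y)"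
    assume l: "lifts D sz env ?D ?sz env' fst"
      and v: "computes ?D ?sz env' (\<lambda>y. e (fst y) (L (fst y) ! snd y))"
      and a: "computes ?D ?sz env' (\<lambda>y. ListV (concat (map (f (fst y)) (take (snd y) (L (fst y))))))"
    have "computes ?D ?sz env' (\<lambda>y. ListV (f (fst y) (L (fst y) ! snd y)))"
      using computes_instance[OF c l _ _ env, of "\<lambda>y. L (fst y) ! snd y"] v by fastforce
    from computes_append[OF a this]
    show "computes ?D ?sz env' (\<lambda>y. ListV (concat (map (f (fst y)) (take (Suc (snd y)) (L (fst y))))))"
      by (rule computes_cong) (auto simp: take_Suc_conv_app_nth)
  qed
  then show ?thesis by simp
qed

lemma computes_map:
  assumes "computes D sz env (\<lambda>x. ListV (map (e x) (L x)))"
    and "\<And>env'. lifts D sz env (SIGMA x:D. set (L x)) (\<lambda>y. sz (fst y)) env' fst \<Longrightarrow>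
      computes (SIGMA x:D. set (L x)) (\<lambda>y. sz (fst y)) env' (\<lambda>y. e (fst y) (snd y)) \<Longrightarrow>
      computes (SIGMA x:D. set (L x)) (\<lambda>y. sz (fst y)) env' (\<lambda>y. f (fst y) (snd y))"
  shows "computes D sz env (\<lambda>x. ListV (map (f x) (L x)))"
proof -
  have "computes D sz env (\<lambda>x. ListV (concat (map (\<lambda>l. [f x l]) (L x))))"
    by (rule computes_concat_map[OF assms(1)])
      (intro computes_Cons assms(2) computes_Nil lifts_bounded_env)
  moreover have "concat (map (\<lambda>l. [f x l]) xs) = map (f x) xs" for x xs by (induction xs) auto
  ultimately show ?thesis by simp
qed

lemma computes_filter:
  assumes "computes D sz env (\<lambda>x. ListV (map (e x) (L x)))"
    and "\<And>env'. lifts D sz env (SIGMA x:D. set (L x)) (\<lambda>y. sz (fst y)) env' fst \<Longrightarrow>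
      computes (SIGMA x:D. set (L x)) (\<lambda>y. sz (fst y)) env' (\<lambda>y. e (fst y) (snd y)) \<Longrightarrow>
      computes (SIGMA x:D. set (L x)) (\<lambda>y. sz (fst y)) env' (\<lambda>y. BoolV (Q (fst y) (snd y)))"
  shows "computes D sz env (\<lambda>x. ListV (map (e x) (filter (Q x) (L x))))"
proof -
  have "computes D sz env (\<lambda>x. ListV (concat (map (\<lambda>l. if Q x l then [e x l] else []) (L x))))"
  proof (rule computes_concat_map[OF assms(1)])
    fix env' let ?D = "SIGMA x:D. set (L x)" and ?sz = "\<lambda>y. sz (fst y)"
    assume l: "lifts D sz env ?D ?sz env' fst" and v: "computes ?D ?sz env' (\<lambda>y. e (fst y) (snd y))"
    have "computes ?D ?sz env' (\<lambda>y. if Q (fst y) (snd y) then ListV [e (fst y) (snd y)] else ListV [])"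
      by (intro computes_If computes_Cons assms(2) v l computes_Nil computes_bounded_env[OF v])
    then show "computes ?D ?sz env' (\<lambda>y. ListV (if Q (fst y) (snd y) then [e (fst y) (snd y)] else []))"
      by (rule computes_cong) simp
  qed
  moreover have "concat (map (\<lambda>l. if Q x l then [e x l] else []) xs) = map (e x) (filter (Q x) xs)" for x xs
    by (induction xs) auto
  ultimately show ?thesis by simp
qed

text \<open>Subadditivity of bit lengths keeps the accumulator polynomial: each element adds at most
  the bits of one value. This covers sums and products alike. The loop runs over the reversed list,
  since \<open>foldr\<close> starts at the right end.\<close>

lemma computes_foldr:
  assumes list: "computes D sz env (\<lambda>x. ListV (map (e x) (L x)))"
    and f: "\<And>env'. lifts D sz env (SIGMA x:D. set (L x)) (\<lambda>y. sz (fst y)) env' fst \<Longrightarrow>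
      computes (SIGMA x:D. set (L x)) (\<lambda>y. sz (fst y)) env' (\<lambda>y. e (fst y) (snd y)) \<Longrightarrow>
      computes (SIGMA x:D. set (L x)) (\<lambda>y. sz (fst y)) env' (\<lambda>y. IntV (f (fst y) (snd y)))"
    and bits: "\<And>a b. ibits (op a b) \<le> ibits a + ibits b"
    and op: "\<And>D sz env a b. computes D sz env (\<lambda>x :: 'x \<times> nat. IntV (a x)) \<Longrightarrow>
      computes D sz env (\<lambda>x. IntV (b x)) \<Longrightarrow> computes D sz env (\<lambda>x. IntV (op (a x) (b x)))"
  shows "computes D sz env (\<lambda>x :: 'x. IntV (foldr (\<lambda>l. op (f x l)) (L x) c))"
proof -
  note env = computes_bounded_env[OF list]
  let ?D = "SIGMA x:D. set (L x)" and ?env = "(\<lambda>y. e (fst y) (snd y)) # map (\<lambda>f y. f (fst y)) env"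
  have v: "computes ?D (\<lambda>y. sz (fst y)) ?env (\<lambda>y. IntV (f (fst y) (snd y)))"
    by (rule f; rule lifts_Cons[OF env _ poly_bounded_elem[OF list]]) auto
  obtain q where q: "\<And>x l. x \<in> D \<Longrightarrow> l \<in> set (L x) \<Longrightarrow> bitsize (IntV (f x l)) \<le> poly q (sz x)"
    using computes_imp_poly_bounded[OF v] unfolding poly_bounded_def by fastforce
  define g where "g x ls = foldr (\<lambda>l. op (f x l)) ls c" for x ls
  have g_bits: "ibits (g x ls) \<le> length ls * poly q (sz x) + ibits c" if "x \<in> D" "set ls \<subseteq> set (L x)" for x ls
    using that(2)
  proof (induction ls)
    case (Cons l ls)
    then show ?case using bits[of "f x l" "g x ls"] q[OF that(1), of l] by (simp add: g_def)
  qed (simp add: g_def)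
  have rev: "computes D sz env (\<lambda>x. ListV (map (e x) (rev (L x))))"
    using computes_rev[OF list] by (simp add: rev_map)
  have "computes D sz env (\<lambda>x. (\<lambda>x i. IntV (g x (rev (take i (rev (L x)))))) x (length (rev (L x))))"
  proof (rule computes_fold[OF rev])
    show "computes D sz env (\<lambda>x. IntV (g x (rev (take 0 (rev (L x))))))"
      using computes_Const[OF env] by (simp add: g_def)
    have "poly_bounded (SIGMA x:D. {..length (rev (L x))}) (\<lambda>y. sz (fst y))
       (\<lambda>y. length (L (fst y)) * poly q (sz (fst y)) + ibits c + 1)"
      by (intro poly_bounded_add poly_bounded_mult poly_bounded_const
         poly_bounded_fst[OF poly_bounded_length[OF list]]) (auto simp: poly_bounded_def)
    then show "poly_bounded (SIGMA x:D. {..length (rev (L x))}) (\<lambda>y. sz (fst y))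
        (\<lambda>y. bitsize (IntV (g (fst y) (rev (take (snd y) (rev (L (fst y))))))))"
    proof (rule poly_bounded_mono)
      fix y assume "y \<in> (SIGMA x:D. {..length (rev (L x))})"
      then have y: "fst y \<in> D" by auto
      let ?ls = "rev (take (snd y) (rev (L (fst y))))"
      have "ibits (g (fst y) ?ls) \<le> length ?ls * poly q (sz (fst y)) + ibits c"
        by (rule g_bits[OF y]) (use set_take_subset[of "snd y" "rev (L (fst y))"] in auto)
      also have "length ?ls * poly q (sz (fst y)) \<le> length (L (fst y)) * poly q (sz (fst y))" by simp
      finally show "bitsize (IntV (g (fst y) ?ls)) \<le> length (L (fst y)) * poly q (sz (fst y)) + ibits c + 1" by simp
    qed
  next
    fix env' let ?D' = "SIGMA x:D. {..<length (rev (L x))}" and ?sz = "\<lambda>y. sz (fst y)"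
    assume l: "lifts D sz env ?D' ?sz env' fst"
      and w: "computes ?D' ?sz env' (\<lambda>y. e (fst y) (rev (L (fst y)) ! snd y))"
      and a: "computes ?D' ?sz env' (\<lambda>y. IntV (g (fst y) (rev (take (snd y) (rev (L (fst y)))))))"
    have mem: "rev (L (fst y)) ! snd y \<in> set (L (fst y))" if "y \<in> ?D'" for y
      using that nth_mem[of "snd y" "rev (L (fst y))"] by auto
    have "computes ?D' ?sz env' (\<lambda>y. IntV (f (fst y) (rev (L (fst y)) ! snd y)))"
      using computes_instance[OF v l mem _ env] w by simp
    from op[OF this a]
    show "computes ?D' ?sz env' (\<lambda>y. IntV (g (fst y) (rev (take (Suc (snd y)) (rev (L (fst y)))))))"
      by (rule computes_cong) (auto simp: g_def take_Suc_conv_app_nth)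
  qed
  then show ?thesis by (simp add: g_def)
qed

lemma computes_sum:
  assumes "computes D sz env (\<lambda>x. ListV (map (e x) (L x)))"
    and "\<And>env'. lifts D sz env (SIGMA x:D. set (L x)) (\<lambda>y. sz (fst y)) env' fst \<Longrightarrow>
      computes (SIGMA x:D. set (L x)) (\<lambda>y. sz (fst y)) env' (\<lambda>y. e (fst y) (snd y)) \<Longrightarrow>
      computes (SIGMA x:D. set (L x)) (\<lambda>y. sz (fst y)) env' (\<lambda>y. IntV (f (fst y) (snd y)))"
  shows "computes D sz env (\<lambda>x. IntV (\<Sum>l\<leftarrow>L x. f x l))"
proof -
  have "computes D sz env (\<lambda>x. IntV (foldr (\<lambda>l. (+) (f x l)) (L x) 0))"
  proof (rule computes_foldr[where f = f and op = "(+)", OF assms(1)])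
  qed (intro assms(2) ibits_add computes_add; assumption)+
  then show ?thesis by (simp add: sum_list.eq_foldr foldr_map comp_def)
qed

lemma computes_prod:
  assumes "computes D sz env (\<lambda>x. ListV (map (e x) (L x)))"
    and "\<And>env'. lifts D sz env (SIGMA x:D. set (L x)) (\<lambda>y. sz (fst y)) env' fst \<Longrightarrow>
      computes (SIGMA x:D. set (L x)) (\<lambda>y. sz (fst y)) env' (\<lambda>y. e (fst y) (snd y)) \<Longrightarrow>
      computes (SIGMA x:D. set (L x)) (\<lambda>y. sz (fst y)) env' (\<lambda>y. IntV (f (fst y) (snd y)))"
  shows "computes D sz env (\<lambda>x. IntV (\<Prod>l\<leftarrow>L x. f x l))"
proof -
  have "computes D sz env (\<lambda>x. IntV (foldr (\<lambda>l. times (f x l)) (L x) 1))"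
  proof (rule computes_foldr[where f = f and op = "times", OF assms(1)])
  qed (intro assms(2) ibits_mult computes_mult; assumption)+
  then show ?thesis by (simp add: prod_list.eq_foldr foldr_map comp_def)
qed

lemma computes_length:
  assumes "computes D sz env (\<lambda>x. ListV (M x))"
  shows "computes D sz env (\<lambda>x. IntV (int (length (M x))))"
proof -
  have "computes D sz env (\<lambda>x. ListV (map (\<lambda>v. v) (M x)))" using assms by simp
  then have "computes D sz env (\<lambda>x. IntV (\<Sum>l\<leftarrow>M x. 1))"
    by (rule computes_sum) (rule computes_Const[OF lifts_bounded_env])
  then show ?thesis by (simp add: sum_list_triv)
qed

lemma ibits_le_self: "ibits (int n) \<le> n"
  by (simp add: floorlog_le_iff less_exp)

abbreviation enc_nat :: "nat \<Rightarrow> dat" where "enc_nat i \<equiv> IntV (int i)"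

lemma bitsize_ListV_le:
  assumes "\<And>v. v \<in> set vs \<Longrightarrow> bitsize v \<le> b" "length vs \<le> m"
  shows "bitsize (ListV vs) \<le> m * b + 1"
proof -
  have "(\<Sum>v\<leftarrow>vs. bitsize v) \<le> length vs * b" by (rule sum_list_bound) (rule assms(1))
  also have "\<dots> \<le> m * b" using assms(2) by simp
  finally show ?thesis by simp
qed

lemma computes_upt:
  assumes "computes D sz env (\<lambda>x. ListV (M x))"
  shows "computes D sz env (\<lambda>x. ListV (map enc_nat [0..<length (M x)]))"
proof (rule computes_fold[where e = "\<lambda>x v. v" and acc = "\<lambda>x i. ListV (map enc_nat [0..<i])"])
  show M: "computes D sz env (\<lambda>x. ListV (map (\<lambda>v. v) (M x)))" using assms by simp
  show "computes D sz env (\<lambda>x. ListV (map enc_nat [0..<0]))"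
    using computes_Nil[OF computes_bounded_env[OF assms]] by simp
  have "poly_bounded (SIGMA x:D. {..length (M x)}) (\<lambda>y. sz (fst y))
      (\<lambda>y. length (M (fst y)) * Suc (length (M (fst y))) + 1)"
    by (intro poly_bounded_add poly_bounded_mult poly_bounded_Suc poly_bounded_const
      poly_bounded_fst[OF poly_bounded_length[OF M]])
  then show "poly_bounded (SIGMA x:D. {..length (M x)}) (\<lambda>y. sz (fst y))
     (\<lambda>y. bitsize (ListV (map enc_nat [0..<snd y])))"
  proof (rule poly_bounded_mono)
    fix y assume y: "y \<in> (SIGMA x:D. {..length (M x)})"
    show "bitsize (ListV (map enc_nat [0..<snd y])) \<le> length (M (fst y)) * Suc (length (M (fst y))) + 1"
    proof (rule bitsize_ListV_le)
      fix v assume "v \<in> set (map enc_nat [0..<snd y])"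
      then obtain i where i: "v = enc_nat i" "i < snd y" by auto
      then show "bitsize v \<le> Suc (length (M (fst y)))"
        using ibits_le_self[of i] y by auto
    qed (use y in auto)
  qed
next
  fix env' let ?D = "SIGMA x:D. {..<length (M x)}" and ?sz = "\<lambda>y. sz (fst y)"
  assume a: "computes ?D ?sz env' (\<lambda>y. ListV (map enc_nat [0..<snd y]))"
  \<comment> \<open>The round number is invisible to the program and is recovered as the length of
    the list built so far.\<close>
  have "computes ?D ?sz env' (\<lambda>y. ListV (map enc_nat [0..<snd y] @ [enc_nat (length (map enc_nat [0..<snd y]))]))"
    by (intro computes_append a computes_Cons computes_length computes_Nil computes_bounded_env[OF a])
  then show "computes ?D ?sz env' (\<lambda>y. ListV (map enc_nat [0..<Suc (snd y)]))" by simp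
qed

lemma computes_drop:
  assumes M: "computes D sz env (\<lambda>x. ListV (M x))"
    and i: "computes D sz env (\<lambda>x. enc_nat (i x))" and le: "\<And>x. x \<in> D \<Longrightarrow> i x \<le> length (M x)"
  shows "computes D sz env (\<lambda>x. ListV (drop (i x) (M x)))"
proof -
  note env = computes_bounded_env[OF M]
  \<comment> \<open>A countdown makes the end of the loop visible: the counter reaches 0 after
    \<open>i x\<close> rounds.\<close>
  define st where "st x k = ListV [IntV (int (i x) - int k), ListV (drop k (M x))]" for x k
  have M': "computes D sz env (\<lambda>x. ListV (map (\<lambda>v. v) (M x)))" using M by simp
  have "computes D sz env (\<lambda>x. st x (i x))"
  proof (rule computes_while)
    show "computes D sz env (\<lambda>x. st x 0)"
      unfolding st_def by (auto intro!: computes_Cons computes_Nil env i M)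
    show "poly_bounded D sz i" by (rule poly_bounded_mono[OF poly_bounded_length[OF M'] le])
    have "poly_bounded (SIGMA x:D. {..i x}) (\<lambda>y. sz (fst y))
       (\<lambda>y. bitsize (enc_nat (i (fst y))) + bitsize (ListV (M (fst y))) + 1)"
      by (intro poly_bounded_add poly_bounded_const poly_bounded_fst computes_imp_poly_bounded[OF M]
        computes_imp_poly_bounded[OF i])
    then show "poly_bounded (SIGMA x:D. {..i x}) (\<lambda>y. sz (fst y)) (\<lambda>y. bitsize (st (fst y) (snd y)))"
    proof (rule poly_bounded_mono)
      fix y assume "y \<in> (SIGMA x:D. {..i x})"
      then have "bitsize (IntV (int (i (fst y)) - int (snd y))) \<le> bitsize (enc_nat (i (fst y)))"
        using ibits_mono[of "int (i (fst y)) - int (snd y)" "int (i (fst y))"] by auto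
      with bitsize_drop[of "snd y" "M (fst y)"]
      show "bitsize (st (fst y) (snd y)) \<le> bitsize (enc_nat (i (fst y))) + bitsize (ListV (M (fst y))) + 1"
        by (simp add: st_def)
    qed
  next
    fix env' let ?D = "SIGMA x:D. {..i x}" and ?sz = "\<lambda>y. sz (fst y)"
    assume s: "computes ?D ?sz env' (\<lambda>y. st (fst y) (snd y))"
    have "computes ?D ?sz env' (\<lambda>y. BoolV (int (i (fst y)) - int (snd y) = 0))"
      by (intro computes_eq computes_Const computes_bounded_env[OF s]
        computes_head[OF s[unfolded st_def]])
    then show "computes ?D ?sz env' (\<lambda>y. BoolV (snd y = i (fst y)))"
      by (rule computes_cong) auto
  next
    fix env' let ?D = "SIGMA x:D. {..<i x}" and ?sz = "\<lambda>y. sz (fst y)"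
    assume s: "computes ?D ?sz env' (\<lambda>y. st (fst y) (snd y))"
    have 1: "computes ?D ?sz env' (\<lambda>y. IntV (int (i (fst y)) - int (snd y) - 1))"
      by (intro computes_diff computes_Const computes_bounded_env[OF s]
        computes_head[OF s[unfolded st_def]])
    have "computes ?D ?sz env' (\<lambda>y. ListV (tl (drop (snd y) (M (fst y)))))"
      by (rule computes_tl[OF computes_head[OF computes_tail[OF s[unfolded st_def]]]])
        (use le in fastforce)
    then have 2: "computes ?D ?sz env' (\<lambda>y. ListV (drop (Suc (snd y)) (M (fst y))))"
      by (simp add: drop_Suc tl_drop)
    have "computes ?D ?sz env' (\<lambda>y. ListV [IntV (int (i (fst y)) - int (snd y) - 1),
        ListV (drop (Suc (snd y)) (M (fst y)))])"
      by (intro computes_Cons 1 2 computes_Nil computes_bounded_env[OF s])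
    then show "computes ?D ?sz env' (\<lambda>y. st (fst y) (Suc (snd y)))"
      by (rule computes_cong) (simp add: st_def)
  qed
  then show ?thesis unfolding st_def by (rule computes_head[OF computes_tail])
qed

lemma computes_nth:
  assumes M: "computes D sz env (\<lambda>x. ListV (M x))"
    and i: "computes D sz env (\<lambda>x. enc_nat (i x))" and less: "\<And>x. x \<in> D \<Longrightarrow> i x < length (M x)"
  shows "computes D sz env (\<lambda>x. M x ! i x)"
proof -
  have "computes D sz env (\<lambda>x. hd (drop (i x) (M x)))"
    by (rule computes_hd[OF computes_drop[OF M i]]) (use less in \<open>auto simp: less_imp_le not_le\<close>)
  then show ?thesis by (rule computes_cong) (simp add: less hd_drop_conv_nth)
qed

lemma computes_select:
  assumes list: "computes D sz env (\<lambda>x. ListV (map (e x) (L x)))"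
    and ne: "\<And>x. x \<in> D \<Longrightarrow> L x \<noteq> []"
    and le: "\<And>env'. lifts D sz env (SIGMA x:D. set (L x) \<times> set (L x)) (\<lambda>y. sz (fst y)) env' fst \<Longrightarrow>
      computes (SIGMA x:D. set (L x) \<times> set (L x)) (\<lambda>y. sz (fst y)) env' (\<lambda>y. e (fst y) (fst (snd y))) \<Longrightarrow>
      computes (SIGMA x:D. set (L x) \<times> set (L x)) (\<lambda>y. sz (fst y)) env' (\<lambda>y. e (fst y) (snd (snd y))) \<Longrightarrow>
      computes (SIGMA x:D. set (L x) \<times> set (L x)) (\<lambda>y. sz (fst y)) env'
        (\<lambda>y. BoolV (le (fst y) (fst (snd y)) (snd (snd y))))"
  shows "computes D sz env (\<lambda>x. e x (select (le x) (L x)))"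
proof -
  note env = computes_bounded_env[OF list]
  let ?D = "SIGMA x:D. set (L x) \<times> set (L x)" and ?sz = "\<lambda>y. sz (fst y)"
  let ?v = "\<lambda>y. ListV [e (fst y) (fst (snd y)), e (fst y) (snd (snd y))]"
  let ?env = "?v # map (\<lambda>f y. f (fst y)) env"
  have "poly_bounded ?D ?sz (\<lambda>y. 2 * bitsize (ListV (map (e (fst y)) (L (fst y)))) + 1)"
    by (intro poly_bounded_add poly_bounded_mult poly_bounded_const poly_bounded_fst
      computes_imp_poly_bounded[OF list])
  then have b: "poly_bounded ?D ?sz (\<lambda>y. bitsize (?v y))"
  proof (rule poly_bounded_mono)
    fix y assume "y \<in> ?D"
    then have "fst (snd y) \<in> set (L (fst y))" "snd (snd y) \<in> set (L (fst y))" by auto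
    then have "bitsize (e (fst y) l) \<le> bitsize (ListV (map (e (fst y)) (L (fst y))))"
      if "l \<in> {fst (snd y), snd (snd y)}" for l
      by (intro bitsize_mem) (use that in auto)
    from this[of "fst (snd y)"] this[of "snd (snd y)"]
    show "bitsize (?v y) \<le> 2 * bitsize (ListV (map (e (fst y)) (L (fst y)))) + 1" by simp
  qed
  have l: "lifts D sz env ?D ?sz ?env fst" and v: "computes ?D ?sz ?env ?v"
    by (rule lifts_Cons[OF env _ b]; auto)+
  have c: "computes ?D ?sz ?env (\<lambda>y. BoolV (le (fst y) (fst (snd y)) (snd (snd y))))"
    by (rule le[OF l computes_head[OF v] computes_head[OF computes_tail[OF v]]])
  define sel where "sel x i = fold (\<lambda>l a. if le x l a then l else a) (take i (tl (L x))) (hd (L x))" for x i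
  have sel_mem: "sel x i \<in> set (L x)" if "x \<in> D" for x i
  proof -
    have "insert (hd (L x)) (set (take i (tl (L x)))) \<subseteq> set (L x)"
      using ne[OF that] by (cases "L x") (auto dest: in_set_takeD)
    then show ?thesis using fold_select_mem[of "le x" "take i (tl (L x))" "hd (L x)"]
      unfolding sel_def by blast
  qed
  have "computes D sz env (\<lambda>x. (\<lambda>x i. e x (sel x i)) x (length (tl (L x))))"
  proof (rule computes_fold)
    show "computes D sz env (\<lambda>x. ListV (map (e x) (tl (L x))))"
      using computes_tl[OF list] ne by (simp add: map_tl)
    have "computes D sz env (\<lambda>x. hd (map (e x) (L x)))"
      using computes_hd[OF list] ne by simp
    then show "computes D sz env (\<lambda>x. e x (sel x 0))"
      by (rule computes_cong) (simp add: sel_def hd_map ne)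
    show "poly_bounded (SIGMA x:D. {..length (tl (L x))}) ?sz (\<lambda>y. bitsize (e (fst y) (sel (fst y) (snd y))))"
      by (rule poly_bounded_mono[OF poly_bounded_fst[OF computes_imp_poly_bounded[OF list]]],
        rule bitsize_mem) (use sel_mem in auto)
  next
    fix env' let ?D' = "SIGMA x:D. {..<length (tl (L x))}"
    assume l: "lifts D sz env ?D' ?sz env' fst"
      and v: "computes ?D' ?sz env' (\<lambda>y. e (fst y) (tl (L (fst y)) ! snd y))"
      and a: "computes ?D' ?sz env' (\<lambda>y. e (fst y) (sel (fst y) (snd y)))"
    have mem: "tl (L (fst y)) ! snd y \<in> set (L (fst y))" if "y \<in> ?D'" for y
    proof -
      have "tl (L (fst y)) ! snd y \<in> set (tl (L (fst y)))" using that by (intro nth_mem) auto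
      then show ?thesis by (cases "L (fst y)") auto
    qed
    have "computes ?D' ?sz env' (\<lambda>y. BoolV (le (fst y) (tl (L (fst y)) ! snd y) (sel (fst y) (snd y))))"
      using computes_instance[OF c l _ _ env, of "\<lambda>y. (tl (L (fst y)) ! snd y, sel (fst y) (snd y))"]
        mem sel_mem computes_Cons[OF v computes_Cons[OF a computes_Nil[OF computes_bounded_env[OF a]]]]
      by auto
    from computes_If[OF this v a]
    show "computes ?D' ?sz env' (\<lambda>y. e (fst y) (sel (fst y) (Suc (snd y))))"
      by (rule computes_cong) (auto simp: sel_def take_Suc_conv_app_nth)
  qed
  then show ?thesis unfolding sel_def select_def by simp
qed

lemmas computes_snd = computes_head[OF computes_tail]
lemmas computes_thd = computes_head[OF computes_tail[OF computes_tail]]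
lemmas computes_fourth = computes_head[OF computes_tail[OF computes_tail[OF computes_tail]]]
lemmas computes_fifth = computes_head[OF computes_tail[OF computes_tail[OF computes_tail[OF computes_tail]]]]

lemmas computes_intros = computes_add computes_diff computes_mult computes_le computes_less computes_eq
  computes_not computes_conj computes_If_int computes_min computes_max

lemma computes_imp_polynomial_time:
  assumes "computes D (\<lambda>x. bitsize (enc_in x)) [enc_in] (\<lambda>x. enc_out (A x))"
  shows "polynomial_time_on D enc_in enc_out A"
proof -
  obtain P e q where r: "realizes P e q D (\<lambda>x. bitsize (enc_in x)) [enc_in] (\<lambda>x. enc_out (A x))"
    using assms unfolding computes_def by blast
  \<comment> \<open>The expression becomes function 0, the entry point, and all other functions move
    up by one.\<close>
  define R where "R = shift_calls 1 e # map (shift_calls 1) P"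
  have R: "realizes R (shift_calls 1 e) q D (\<lambda>x. bitsize (enc_in x)) [enc_in] (\<lambda>x. enc_out (A x))"
    using realizes_shift[OF r, of "[shift_calls 1 e]"] by (simp add: R_def)
  have "\<exists>t\<le>poly (q + [:1, 1:]) (bitsize (enc_in x)). runs R (enc_in x) (enc_out (A x)) t" if x: "x \<in> D" for x
  proof -
    obtain t where t: "t \<le> poly q (bitsize (enc_in x))" "eval R [enc_in x] (shift_calls 1 e) (enc_out (A x)) t"
      using R x unfolding realizes_def by auto
    have "evals R [enc_in x] [Var 0] [enc_in x] (bitsize (enc_in x) + 0)"
      by (intro evals_Cons evals_Nil) (use eval_Var[of 0 "[enc_in x]" R] in simp)
    then have "eval R [enc_in x] (Call 0 [Var 0]) (enc_out (A x)) (Suc (bitsize (enc_in x) + 0 + t))"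
      by (rule eval_Call) (use t in \<open>simp_all add: R_def\<close>)
    then show ?thesis unfolding runs_def
      by (intro exI[of _ "Suc (bitsize (enc_in x) + 0 + t)"]) (use t in simp)
  qed
  then show ?thesis unfolding polynomial_time_on_def by blast
qed


section \<open>The running time of the algorithm\<close>

text \<open>The increments never decrease, so each of the \<open>l\<close> further steps gains at
  least the present one.\<close>

lemma offset_add:
  assumes "0 < m"
  shows "offset m k + int l * max 1 (offset m k div m) \<le> offset m (k + l)"
proof (induction l)
  case (Suc l)
  have "0 \<le> int l * max 1 (offset m k div m)" by simp
  then have "offset m k \<le> offset m (k + l)" using Suc by linarith
  then have "offset m k div m \<le> offset m (k + l) div m" using assms by (rule zdiv_mono1)
  then show ?case using Suc by (simp add: algebra_simps)
qed simp

text \<open>With \<open>d\<close> the current offset, \<open>2 * m\<close> increments of at least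
  \<open>max 1 (d div m)\<close> add up to at least \<open>d\<close>: if \<open>d < m\<close>,
  increments of 1 suffice, otherwise \<open>m * (d div m)\<close> exceeds
  \<open>d / 2\<close>.\<close>

lemma offset_double:
  assumes m: "0 < m"
  shows "2 * offset m k \<le> offset m (k + nat (2 * m))"
proof -
  let ?d = "offset m k"
  have "?d \<le> 2 * m * max 1 (?d div m)"
  proof (cases "?d < m")
    case True
    have "2 * m * 1 \<le> 2 * m * max 1 (?d div m)" using m by (intro mult_left_mono) auto
    then show ?thesis using True m by linarith
  next
    case False
    then have 1: "1 \<le> ?d div m" using m by (simp add: pos_imp_zdiv_pos_iff int_one_le_iff_zero_less)
    have "?d < m * (?d div m) + m"
      using pos_mod_bound[OF m, of ?d] mult_div_mod_eq[of m ?d] by linarith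
    moreover have "m * 1 \<le> m * (?d div m)" using m 1 by (intro mult_left_mono) auto
    moreover have "2 * m * max 1 (?d div m) = 2 * (m * (?d div m))" using 1 by (simp add: max_def)
    ultimately show ?thesis by linarith
  qed
  then show ?thesis using offset_add[OF m, of k "nat (2 * m)"] m by simp
qed

lemma num_offsets_le_log:
  assumes m: "0 < m"
  shows "num_offsets m T \<le> nat (2 * m) * ibits T"
  unfolding num_offsets_def
proof (rule Least_le)
  have "2 ^ i \<le> offset m (nat (2 * m) * i)" for i
  proof (induction i)
    case (Suc i)
    have "nat (2 * m) * Suc i = nat (2 * m) * i + nat (2 * m)" by simp
    then show ?case using offset_double[OF m, of "nat (2 * m) * i"] Suc by (simp add: add.commute)
  qed simp
  moreover have "T \<le> 2 ^ ibits T"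
  proof -
    have "nat \<bar>T\<bar> < 2 ^ ibits T" using floorlog_leD[OF order_refl, of 2] by simp
    then have "int (nat \<bar>T\<bar>) < int (2 ^ ibits T)" by (simp only: of_nat_less_iff)
    then show ?thesis by simp
  qed
  ultimately show "T \<le> offset m (nat (2 * m) * ibits T)" using order_trans by blast
qed

lemma offset_pos: "0 < offset m k"
  using offset_ge[of k m] by linarith

text \<open>All but the last offset lie below \<open>T\<close>, and one step at most doubles. The
  bound \<open>2 * T + 1\<close> also covers the first offset 1, whatever the sign of
  \<open>T\<close>.\<close>

lemma offset_le:
  assumes m: "0 < m" and k: "k \<le> num_offsets m T"
  shows "\<bar>offset m k\<bar> \<le> \<bar>2 * T + 1\<bar>"
proof (cases k)
  case (Suc l)
  then have l: "offset m l < T" using k offset_less by simp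
  have "offset m l div m \<le> offset m l" using abs_div_le[of "offset m l" m] offset_pos[of m l] by linarith
  then have "offset m k \<le> 2 * T" using Suc l offset_pos[of m l] by simp
  then show ?thesis using offset_pos[of m k] by simp
next
  case 0
  have "1 \<le> \<bar>2 * T + 1\<bar>" by presburger
  then show ?thesis using 0 by simp
qed

lemma computes_offsets:
  assumes m: "0 < m" and T: "computes D sz env (\<lambda>x. IntV (T x))"
  shows "computes D sz env (\<lambda>x. ListV (map IntV (offsets m (T x))))"
proof -
  note env = computes_bounded_env[OF T]
  define st where "st k = ListV (map (\<lambda>i. IntV (offset m i)) (rev [0..<Suc k]))" for k
  define N where "N x = num_offsets m (T x)" for x
  have N: "poly_bounded D sz N"
    by (rule poly_bounded_mono[OF poly_bounded_mult[OF poly_bounded_const[of _ _ "nat (2 * m)"]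
          computes_imp_poly_bounded[OF T]]])
      (auto intro!: order_trans[OF num_offsets_le_log[OF m]] simp: N_def)
  have "computes D sz env (\<lambda>x. (\<lambda>x k. st k) x (N x))"
  proof (rule computes_while[OF _ N])
    show "computes D sz env (\<lambda>x. st 0)"
      unfolding st_def by (auto intro!: computes_Cons computes_Nil computes_Const env)
    have "computes D sz env (\<lambda>x. IntV (2 * T x + 1))" by (intro computes_intros computes_Const env T)
    from computes_imp_poly_bounded[OF this]
    have "poly_bounded (SIGMA x:D. {..N x}) (\<lambda>y. sz (fst y))
        (\<lambda>y. Suc (N (fst y)) * bitsize (IntV (2 * T (fst y) + 1)) + 1)"
      by (intro poly_bounded_add poly_bounded_mult poly_bounded_Suc poly_bounded_const
        poly_bounded_fst[OF N] poly_bounded_fst)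
    then show "poly_bounded (SIGMA x:D. {..N x}) (\<lambda>y. sz (fst y)) (\<lambda>y. bitsize (st (snd y)))"
    proof (rule poly_bounded_mono)
      fix y assume y: "y \<in> (SIGMA x:D. {..N x})"
      show "bitsize (st (snd y)) \<le> Suc (N (fst y)) * bitsize (IntV (2 * T (fst y) + 1)) + 1"
        unfolding st_def
      proof (rule bitsize_ListV_le)
        fix v assume "v \<in> set (map (\<lambda>i. IntV (offset m i)) (rev [0..<Suc (snd y)]))"
        then obtain i where i: "v = IntV (offset m i)" "i \<le> num_offsets m (T (fst y))"
          using y by (auto simp: N_def simp del: upt_Suc)
        show "bitsize v \<le> bitsize (IntV (2 * T (fst y) + 1))"
          unfolding i(1) using ibits_mono[OF offset_le[OF m i(2)]] by simp
      qed (use y in auto)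
    qed
  next
    fix env' let ?D = "SIGMA x:D. {..N x}" and ?sz = "\<lambda>y. sz (fst y)"
    assume l: "lifts D sz env ?D ?sz env' fst" and s: "computes ?D ?sz env' (\<lambda>y. st (snd y))"
    have "computes ?D ?sz env' (\<lambda>y. IntV (offset m (snd y)))"
      by (rule computes_head) (use s in \<open>simp add: st_def\<close>)
    \<comment> \<open>The number of rounds is invisible, but by minimality of
      \<open>num_offsets\<close> the latest offset first reaches \<open>T\<close> exactly at index
      \<open>N\<close>.\<close>
    then have "computes ?D ?sz env' (\<lambda>y. BoolV (T (fst y) \<le> offset m (snd y)))"
      by (intro computes_intros liftsD[OF l T])
    then show "computes ?D ?sz env' (\<lambda>y. BoolV (snd y = N (fst y)))"
    proof (rule computes_cong)
      fix y assume "y \<in> ?D"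
      then have "snd y \<le> N (fst y)" by auto
      have "T (fst y) \<le> offset m (snd y) \<longleftrightarrow> snd y = N (fst y)"
      proof
        assume "T (fst y) \<le> offset m (snd y)"
        then have "N (fst y) \<le> snd y" unfolding N_def num_offsets_def by (rule Least_le)
        with \<open>snd y \<le> N (fst y)\<close> show "snd y = N (fst y)" by (rule le_antisym)
      qed (simp add: N_def num_offsets_le)
      then show "BoolV (T (fst y) \<le> offset m (snd y)) = BoolV (snd y = N (fst y))" by simp
    qed
  next
    fix env' let ?D = "SIGMA x:D. {..<N x}" and ?sz = "\<lambda>y. sz (fst y)"
    assume s: "computes ?D ?sz env' (\<lambda>y. st (snd y))"
    have h: "computes ?D ?sz env' (\<lambda>y. IntV (offset m (snd y)))"
      by (rule computes_head) (use s in \<open>simp add: st_def\<close>)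
    have "computes ?D ?sz env' (\<lambda>y. ListV (IntV (offset m (snd y) + max 1 (offset m (snd y) div m)) #
       map (\<lambda>i. IntV (offset m i)) (rev [0..<Suc (snd y)])))"
      by (intro computes_Cons computes_intros computes_div h computes_Const computes_bounded_env[OF h])
        (use s in \<open>simp add: st_def\<close>)
    then show "computes ?D ?sz env' (\<lambda>y. st (Suc (snd y)))" by (simp add: st_def)
  qed
  then have "computes D sz env (\<lambda>x. ListV (map (\<lambda>i. IntV (offset m i)) (rev [0..<Suc (N x)])))"
    by (simp add: st_def)
  from computes_Cons[OF computes_Const[OF env, of 0] this]
  show ?thesis by (simp add: offsets_def N_def comp_def)
qed

text \<open>A function \<open>r\<close> on the jobs is represented by the list of rows \<open>[j, p j, r j, \<dots>]\<close>.\<close>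

lemma computes_demand:
  assumes rows: "computes D sz env (\<lambda>x. ListV (map (\<lambda>j. ListV (enc_nat j # IntV (p x j) # IntV (r x j) # M x j)) [0..<n x]))"
    and T: "computes D sz env (\<lambda>x. IntV (load (n x) (p x)))"
    and b: "computes D sz env (\<lambda>x. IntV (b x))"
  shows "computes D sz env (\<lambda>x. IntV (demand (n x) (p x) (r x) (b x)))"
proof -
  have "computes D sz env (\<lambda>x. IntV (\<Sum>j\<leftarrow>[0..<n x]. if b x < r x j then p x j else 0))"
  proof (rule computes_sum[OF rows])
    fix env' let ?D = "SIGMA x:D. set [0..<n x]" and ?sz = "\<lambda>y. sz (fst y)"
    assume l: "lifts D sz env ?D ?sz env' fst"
      and v: "computes ?D ?sz env' (\<lambda>y. ListV (enc_nat (snd y) # IntV (p (fst y) (snd y)) #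
        IntV (r (fst y) (snd y)) # M (fst y) (snd y)))"
    show "computes ?D ?sz env' (\<lambda>y. IntV (if b (fst y) < r (fst y) (snd y) then p (fst y) (snd y) else 0))"
      by (intro computes_intros liftsD[OF l b] computes_snd[OF v] computes_thd[OF v] computes_Const
        lifts_bounded_env[OF l])
  qed
  then show ?thesis unfolding demand_def by (intro computes_intros T b)
qed

lemma computes_worst:
  assumes rows: "computes D sz env (\<lambda>x. ListV (map (\<lambda>j. ListV (enc_nat j # IntV (p x j) # IntV (r x j) # M x j)) [0..<n x]))"
    and T: "computes D sz env (\<lambda>x. IntV (load (n x) (p x)))"
    and B: "computes D sz env (\<lambda>x. ListV (map IntV (B x)))" "\<And>x. x \<in> D \<Longrightarrow> B x \<noteq> []"
  shows "computes D sz env (\<lambda>x. IntV (worst (n x) (p x) (B x) (r x)))"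
  unfolding worst_def
proof (rule computes_select[where e = "\<lambda>x. IntV", OF B])
  fix env' let ?D = "SIGMA x:D. set (B x) \<times> set (B x)" and ?sz = "\<lambda>y. sz (fst y)"
  assume l: "lifts D sz env ?D ?sz env' fst" and v: "computes ?D ?sz env' (\<lambda>y. IntV (fst (snd y)))"
    and w: "computes ?D ?sz env' (\<lambda>y. IntV (snd (snd y)))"
  show "computes ?D ?sz env' (\<lambda>y. BoolV (demand (n (fst y)) (p (fst y)) (r (fst y)) (snd (snd y))
      \<le> demand (n (fst y)) (p (fst y)) (r (fst y)) (fst (snd y))))"
    by (intro computes_le computes_demand[OF liftsD[OF l rows] liftsD[OF l T]] v w)
qed

lemma computes_covers:
  assumes rows: "computes D sz env (\<lambda>x. ListV (map (\<lambda>j. ListV (enc_nat j # IntV (p x j) # IntV (r x j) # M x j)) [0..<n x]))"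
    and T: "computes D sz env (\<lambda>x. IntV (load (n x) (p x)))"
    and B: "computes D sz env (\<lambda>x. ListV (map IntV (B x)))" "\<And>x. x \<in> D \<Longrightarrow> B x \<noteq> []"
  shows "computes D sz env (\<lambda>x. BoolV (covers (n x) (p x) (B x) (r x)))"
  unfolding covers_def
  by (intro computes_le computes_demand[OF rows T] computes_worst[OF assms] computes_Const
    computes_bounded_env[OF T])

text \<open>A cost function is tabulated at the breakpoints, each value next to its breakpoint, so
  that traversing the row replaces lookups.\<close>

definition enc_row :: "(nat \<Rightarrow> int) \<Rightarrow> int list \<Rightarrow> (nat \<Rightarrow> int) \<Rightarrow> (nat \<Rightarrow> int \<Rightarrow> int) \<Rightarrow> nat \<Rightarrow> dat" where
  "enc_row p B r g j = ListV [enc_nat j, IntV (p j), IntV (r j),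
     ListV (map (\<lambda>u. ListV [IntV u, IntV (g j u)]) B)]"

definition enc_entry :: "nat \<times> int \<times> int \<Rightarrow> dat" where
  "enc_entry x = ListV [enc_nat (fst x), IntV (fst (snd x)), IntV (snd (snd x))]"

definition enc_state :: "nat \<Rightarrow> (nat \<Rightarrow> int) \<Rightarrow> int list \<Rightarrow> state \<Rightarrow> dat" where
  "enc_state n p B s = ListV [ListV (map (enc_row p B (fst s) (fst (snd s))) [0..<n]),
     ListV (map enc_entry (snd (snd s)))]"

text \<open>A candidate carries its cost, its capped size and the present deadline of its job: all
  that comparing, reducing and logging require of a picked move.\<close>

definition enc_candidate :: "nat \<Rightarrow> (nat \<Rightarrow> int) \<Rightarrow> int list \<Rightarrow> (nat \<Rightarrow> int) \<Rightarrow> (nat \<Rightarrow> int \<Rightarrow> int) \<Rightarrow>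
    nat \<times> int \<Rightarrow> dat" where
  "enc_candidate n p B r g c = ListV [enc_nat (fst c), IntV (snd c), IntV (g (fst c) (snd c)),
     IntV (cap n p B r (fst c)), IntV (r (fst c))]"

lemma computes_step:
  assumes state: "computes D sz env (\<lambda>x. enc_state (n x) (p x) (B x) (s x))"
    and T: "computes D sz env (\<lambda>x. IntV (load (n x) (p x)))"
    and B: "computes D sz env (\<lambda>x. ListV (map IntV (B x)))"
    and inst: "\<And>x. x \<in> D \<Longrightarrow> cover_instance (n x) (p x) (B x)"
  shows "computes D sz env (\<lambda>x. enc_state (n x) (p x) (B x) (step (n x) (p x) (B x) (s x)))"
proof -
  define r where "r x = fst (s x)" for x
  define g where "g x = fst (snd (s x))" for x
  define w where "w x = worst (n x) (p x) (B x) (r x)" for x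
  define c where "c x = cap (n x) (p x) (B x) (r x)" for x
  define cov where "cov x = covers (n x) (p x) (B x) (r x)" for x
  have B_ne: "\<And>x. x \<in> D \<Longrightarrow> B x \<noteq> []" using cover_instance.B_ne[OF inst] .
  have rows: "computes D sz env (\<lambda>x. ListV (map (enc_row (p x) (B x) (r x) (g x)) [0..<n x]))"
    and log: "computes D sz env (\<lambda>x. ListV (map enc_entry (snd (snd (s x)))))"
    unfolding r_def g_def
    by (rule computes_head[OF state[unfolded enc_state_def]], rule computes_snd[OF state[unfolded enc_state_def]])
  have rows': "computes D sz env (\<lambda>x. ListV (map (\<lambda>j. ListV (enc_nat j # IntV (p x j) # IntV (r x j) #
      [ListV (map (\<lambda>u. ListV [IntV u, IntV (g x j u)]) (B x))])) [0..<n x]))"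
    using rows unfolding enc_row_def .
  have w: "computes D sz env (\<lambda>x. IntV (w x))"
    unfolding w_def by (rule computes_worst[OF rows' T B B_ne])
  have R: "computes D sz env (\<lambda>x. IntV (demand (n x) (p x) (r x) (w x)))"
    by (rule computes_demand[OF rows' T w])
  have cov: "computes D sz env (\<lambda>x. BoolV (cov x))"
    unfolding cov_def by (rule computes_covers[OF rows' T B B_ne])
  have c_eq: "c x j = min (p x j) (demand (n x) (p x) (r x) (w x))" for x j
    by (simp add: c_def cap_def w_def)
  let ?e = "\<lambda>x. enc_candidate (n x) (p x) (B x) (r x) (g x)"
  have "computes D sz env (\<lambda>x. ListV (map (enc_row (p x) (B x) (r x) (g x))
      (filter (\<lambda>j. r x j \<le> w x \<and> 0 < p x j) [0..<n x])))"
  proof (rule computes_filter[OF rows])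
    fix env' let ?D = "SIGMA x:D. set [0..<n x]" and ?sz = "\<lambda>y. sz (fst y)"
    assume l: "lifts D sz env ?D ?sz env' fst"
      and v: "computes ?D ?sz env' (\<lambda>y. enc_row (p (fst y)) (B (fst y)) (r (fst y)) (g (fst y)) (snd y))"
    note v = v[unfolded enc_row_def]
    show "computes ?D ?sz env' (\<lambda>y. BoolV (r (fst y) (snd y) \<le> w (fst y) \<and> 0 < p (fst y) (snd y)))"
      by (intro computes_intros computes_snd[OF v] computes_thd[OF v] liftsD[OF l w] computes_Const
        lifts_bounded_env[OF l])
  qed
  then have "computes D sz env (\<lambda>x. ListV (concat (map (\<lambda>j. map (\<lambda>u. ?e x (j, u)) (filter (\<lambda>u. w x < u) (B x)))
      (filter (\<lambda>j. r x j \<le> w x \<and> 0 < p x j) [0..<n x]))))"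
  proof (rule computes_concat_map)
    fix env' let ?D = "SIGMA x:D. set (filter (\<lambda>j. r x j \<le> w x \<and> 0 < p x j) [0..<n x])"
      and ?sz = "\<lambda>y. sz (fst y)"
    assume l: "lifts D sz env ?D ?sz env' fst"
      and v: "computes ?D ?sz env' (\<lambda>y. enc_row (p (fst y)) (B (fst y)) (r (fst y)) (g (fst y)) (snd y))"
    note v = v[unfolded enc_row_def]
    note w' = liftsD[OF l w] and R' = liftsD[OF l R]
    have "computes ?D ?sz env' (\<lambda>y. ListV (map (\<lambda>u. ListV [IntV u, IntV (g (fst y) (snd y) u)])
        (filter (\<lambda>u. w (fst y) < u) (B (fst y)))))"
    proof (rule computes_filter[OF computes_fourth[OF v]])
      fix env'' let ?D' = "SIGMA y:?D. set (B (fst y))" and ?sz' = "\<lambda>z. sz (fst (fst z))"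
      assume l': "lifts ?D ?sz env' ?D' ?sz' env'' fst"
        and v': "computes ?D' ?sz' env'' (\<lambda>z. ListV [IntV (snd z), IntV (g (fst (fst z)) (snd (fst z)) (snd z))])"
      show "computes ?D' ?sz' env'' (\<lambda>z. BoolV (w (fst (fst z)) < snd z))"
        by (intro computes_intros computes_head[OF v'] liftsD[OF l' w'])
    qed
    then show "computes ?D ?sz env' (\<lambda>y. ListV (map (\<lambda>u. ?e (fst y) (snd y, u))
        (filter (\<lambda>u. w (fst y) < u) (B (fst y)))))"
    proof (rule computes_map)
      fix env'' let ?D' = "SIGMA y:?D. set (filter (\<lambda>u. w (fst y) < u) (B (fst y)))" and ?sz' = "\<lambda>z. sz (fst (fst z))"
      assume l': "lifts ?D ?sz env' ?D' ?sz' env'' fst"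
        and v': "computes ?D' ?sz' env'' (\<lambda>z. ListV [IntV (snd z), IntV (g (fst (fst z)) (snd (fst z)) (snd z))])"
      show "computes ?D' ?sz' env'' (\<lambda>z. ?e (fst (fst z)) (snd (fst z), snd z))"
        unfolding enc_candidate_def fst_conv snd_conv c_def[symmetric] c_eq
        by (intro computes_Cons computes_min computes_Nil lifts_bounded_env[OF l'] computes_head[OF v'] computes_snd[OF v']
          liftsD[OF l' computes_head[OF v]] liftsD[OF l' computes_snd[OF v]] liftsD[OF l' computes_thd[OF v]]
          liftsD[OF l' R'])
    qed
  qed
  then have "computes D sz env (\<lambda>x. ListV (map (?e x) (candidates (n x) (p x) (B x) (r x))))"
    unfolding candidates_def w_def[symmetric] by (simp add: map_concat comp_def)
  \<comment> \<open>Candidates are guaranteed to exist only while demand is unmet, so the rest is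
    computed on those contexts, and \<open>computes_If_cases\<close> joins the branches.\<close>
  then have cands: "computes {x\<in>D. \<not> cov x} sz env (\<lambda>x. ListV (map (?e x) (candidates (n x) (p x) (B x) (r x))))"
    by (rule computes_subset) auto
  define pk where "pk x = pick (n x) (p x) (B x) (r x) (g x)" for x
  have pick: "computes {x\<in>D. \<not> cov x} sz env (\<lambda>x. ?e x (pk x))"
    unfolding pk_def pick_def
  proof (rule computes_select[OF cands])
    show "\<And>x. x \<in> {x\<in>D. \<not> cov x} \<Longrightarrow> candidates (n x) (p x) (B x) (r x) \<noteq> []"
      using cover_instance.candidates_ne[OF inst] by (auto simp: cov_def)
    fix env' let ?C = "\<lambda>x. set (candidates (n x) (p x) (B x) (r x))"
    let ?D = "SIGMA x:{x\<in>D. \<not> cov x}. ?C x \<times> ?C x" and ?sz = "\<lambda>y. sz (fst y)"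
    assume v: "computes ?D ?sz env' (\<lambda>y. ?e (fst y) (fst (snd y)))"
      and v': "computes ?D ?sz env' (\<lambda>y. ?e (fst y) (snd (snd y)))"
    note v = v[unfolded enc_candidate_def] and v' = v'[unfolded enc_candidate_def]
    show "computes ?D ?sz env' (\<lambda>y. BoolV (
        g (fst y) (fst (fst (snd y))) (snd (fst (snd y))) *
          cap (n (fst y)) (p (fst y)) (B (fst y)) (r (fst y)) (fst (snd (snd y)))
        \<le> g (fst y) (fst (snd (snd y))) (snd (snd (snd y))) *
          cap (n (fst y)) (p (fst y)) (B (fst y)) (r (fst y)) (fst (fst (snd y)))))"
      by (intro computes_le computes_mult computes_thd[OF v] computes_fourth[OF v] computes_thd[OF v'] computes_fourth[OF v'])
  qed
  note pick = pick[unfolded enc_candidate_def]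
  let ?D1 = "{x\<in>D. \<not> cov x}"
  have sub: "?D1 \<subseteq> D" by auto
  have rows1: "computes ?D1 sz env (\<lambda>x. ListV (map (enc_row (p x) (B x) ((r x)(fst (pk x) := snd (pk x)))
      (reduce (n x) (p x) (B x) (r x) (g x) (fst (pk x)) (snd (pk x)))) [0..<n x]))"
  proof (rule computes_map[OF computes_subset[OF rows sub]])
    fix env' let ?D = "SIGMA x:?D1. set [0..<n x]" and ?sz = "\<lambda>y. sz (fst y)"
    assume l: "lifts ?D1 sz env ?D ?sz env' fst"
      and v: "computes ?D ?sz env' (\<lambda>y. enc_row (p (fst y)) (B (fst y)) (r (fst y)) (g (fst y)) (snd y))"
    note v = v[unfolded enc_row_def]
    note w' = liftsD[OF l computes_subset[OF w sub]] and R' = liftsD[OF l computes_subset[OF R sub]]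
    note pick' = liftsD[OF l pick]
    have g': "computes ?D ?sz env' (\<lambda>y. ListV (map (\<lambda>u. ListV [IntV u, IntV (reduce (n (fst y)) (p (fst y)) (B (fst y))
        (r (fst y)) (g (fst y)) (fst (pk (fst y))) (snd (pk (fst y))) (snd y) u)]) (B (fst y))))"
    proof (rule computes_map[OF computes_fourth[OF v]])
      fix env'' let ?D' = "SIGMA y:?D. set (B (fst y))" and ?sz' = "\<lambda>z. sz (fst (fst z))"
      assume l': "lifts ?D ?sz env' ?D' ?sz' env'' fst"
        and v': "computes ?D' ?sz' env'' (\<lambda>z. ListV [IntV (snd z), IntV (g (fst (fst z)) (snd (fst z)) (snd z))])"
      note pick'' = liftsD[OF l' pick']
      note c'' = computes_fourth[OF pick'', folded c_def]
      show "computes ?D' ?sz' env'' (\<lambda>z. ListV [IntV (snd z), IntV (reduce (n (fst (fst z))) (p (fst (fst z)))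
          (B (fst (fst z))) (r (fst (fst z))) (g (fst (fst z))) (fst (pk (fst (fst z)))) (snd (pk (fst (fst z))))
          (snd (fst z)) (snd z))])"
        unfolding reduce_def w_def[symmetric] c_def[symmetric]
        by (intro computes_Cons computes_Nil computes_If_int computes_conj computes_le computes_less computes_diff
          computes_mult c'' computes_head[OF v'] computes_snd[OF v']
          liftsD[OF l' computes_thd[OF v]] liftsD[OF l' w'] computes_thd[OF pick'']
          computes_min[OF liftsD[OF l' computes_snd[OF v]] liftsD[OF l' R'], folded c_eq] lifts_bounded_env[OF l'])
    qed
    \<comment> \<open>Updating the function \<open>r\<close> at one point is a pass over all rows
      that compares job numbers.\<close>
    have "computes ?D ?sz env' (\<lambda>y. IntV (if int (snd y) = int (fst (pk (fst y))) then snd (pk (fst y)) else r (fst y) (snd y)))"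
      by (intro computes_If_int computes_eq computes_head[OF v] computes_thd[OF v] computes_head[OF pick'] computes_snd[OF pick'])
    then have r': "computes ?D ?sz env' (\<lambda>y. IntV (((r (fst y))(fst (pk (fst y)) := snd (pk (fst y)))) (snd y)))"
      by (rule computes_cong) simp
    show "computes ?D ?sz env' (\<lambda>y. enc_row (p (fst y)) (B (fst y)) ((r (fst y))(fst (pk (fst y)) := snd (pk (fst y))))
        (reduce (n (fst y)) (p (fst y)) (B (fst y)) (r (fst y)) (g (fst y)) (fst (pk (fst y))) (snd (pk (fst y)))) (snd y))"
      unfolding enc_row_def
      by (intro computes_Cons computes_Nil computes_head[OF v] computes_snd[OF v] r' g' lifts_bounded_env[OF l])
  qed
  have log1: "computes ?D1 sz env (\<lambda>x. ListV (enc_entry (fst (pk x), r x (fst (pk x)), snd (pk x)) #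
      map enc_entry (snd (snd (s x)))))"
    unfolding enc_entry_def fst_conv snd_conv
    by (intro computes_Cons computes_Nil computes_head[OF pick] computes_snd[OF pick] computes_fifth[OF pick]
      computes_bounded_env[OF pick] computes_subset[OF log[unfolded enc_entry_def] sub])
  have "computes ?D1 sz env (\<lambda>x. enc_state (n x) (p x) (B x)
     ((r x)(fst (pk x) := snd (pk x)), reduce (n x) (p x) (B x) (r x) (g x) (fst (pk x)) (snd (pk x)),
      (fst (pk x), r x (fst (pk x)), snd (pk x)) # snd (snd (s x))))"
    unfolding enc_state_def fst_conv snd_conv list.map(2)
    by (rule computes_Cons[OF rows1 computes_Cons[OF log1 computes_Nil[OF computes_bounded_env[OF pick]]]])
  then have "computes D sz env (\<lambda>x. if cov x then enc_state (n x) (p x) (B x) (s x) else enc_state (n x) (p x) (B x)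
     ((r x)(fst (pk x) := snd (pk x)), reduce (n x) (p x) (B x) (r x) (g x) (fst (pk x)) (snd (pk x)),
      (fst (pk x), r x (fst (pk x)), snd (pk x)) # snd (snd (s x))))"
    by (intro computes_If_cases cov computes_subset[OF state]) auto
  then show ?thesis
    by (rule computes_cong) (simp add: step_def cov_def pk_def r_def g_def split: prod.split)
qed

definition enc_levels :: "nat \<Rightarrow> (nat \<Rightarrow> int) \<Rightarrow> (nat \<Rightarrow> int) \<Rightarrow> dat" where
  "enc_levels n p \<sigma> = ListV (map (\<lambda>j. ListV [enc_nat j, IntV (p j), IntV (\<sigma> j)]) [0..<n])"

lemma computes_undo:
  assumes levels: "computes D sz env (\<lambda>x. enc_levels (n x) (p x) (\<sigma> x))"
    and T: "computes D sz env (\<lambda>x. IntV (load (n x) (p x)))"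
    and B: "computes D sz env (\<lambda>x. ListV (map IntV (B x)))" "\<And>x. x \<in> D \<Longrightarrow> B x \<noteq> []"
    and a: "computes D sz env (\<lambda>x. enc_entry (a x))" "\<And>x. x \<in> D \<Longrightarrow> fst (a x) < n x"
  shows "computes D sz env (\<lambda>x. enc_levels (n x) (p x) (undo (n x) (p x) (B x) (a x) (\<sigma> x)))"
proof -
  note a' = a(1)[unfolded enc_entry_def] and levels' = levels[unfolded enc_levels_def]
  note env = computes_bounded_env[OF T]
  define \<sigma>' where "\<sigma>' x = (\<sigma> x)(fst (a x) := fst (snd (a x)))" for x
  have new: "computes D sz env (\<lambda>x. ListV (map (\<lambda>j. ListV [enc_nat j, IntV (p x j), IntV (\<sigma>' x j)]) [0..<n x]))"
  proof (rule computes_map[OF levels'])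
    fix env' let ?D = "SIGMA x:D. set [0..<n x]" and ?sz = "\<lambda>y. sz (fst y)"
    assume l: "lifts D sz env ?D ?sz env' fst"
      and v: "computes ?D ?sz env' (\<lambda>y. ListV [enc_nat (snd y), IntV (p (fst y) (snd y)), IntV (\<sigma> (fst y) (snd y))])"
    have "computes ?D ?sz env' (\<lambda>y. IntV (if int (snd y) = int (fst (a (fst y))) then fst (snd (a (fst y)))
        else \<sigma> (fst y) (snd y)))"
      by (intro computes_If_int computes_eq computes_head[OF v] computes_thd[OF v]
        liftsD[OF l computes_head[OF a']] liftsD[OF l computes_snd[OF a']])
    then have "computes ?D ?sz env' (\<lambda>y. IntV (\<sigma>' (fst y) (snd y)))"
      by (rule computes_cong) (simp add: \<sigma>'_def)
    then show "computes ?D ?sz env' (\<lambda>y. ListV [enc_nat (snd y), IntV (p (fst y) (snd y)), IntV (\<sigma>' (fst y) (snd y))])"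
      by (intro computes_Cons computes_Nil computes_head[OF v] computes_snd[OF v] lifts_bounded_env[OF l])
  qed
  have cov: "computes D sz env (\<lambda>x. BoolV (covers (n x) (p x) (B x) (\<sigma>' x)))"
    using computes_covers[OF new T B] .
  have "computes D sz env (\<lambda>x. map (\<lambda>j. ListV [enc_nat j, IntV (p x j), IntV (\<sigma> x j)]) [0..<n x] ! fst (a x))"
    by (rule computes_nth[OF levels' computes_head[OF a']]) (simp add: a(2))
  then have row: "computes D sz env (\<lambda>x. ListV [enc_nat (fst (a x)), IntV (p x (fst (a x))), IntV (\<sigma> x (fst (a x)))])"
    by (rule computes_cong) (simp add: a(2))
  have "computes D sz env (\<lambda>x. BoolV (\<sigma> x (fst (a x)) = snd (snd (a x)) \<and> covers (n x) (p x) (B x) (\<sigma>' x)))"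
    by (intro computes_conj cov computes_eq computes_thd[OF row] computes_thd[OF a'])
  from computes_If[OF this new levels'] show ?thesis
    by (rule computes_cong) (simp add: enc_levels_def undo_def \<sigma>'_def split: prod.split)
qed

text \<open>Rows instead of bare job numbers are sorted, so that the deadlines travel along as keys;
  the job numbers are extracted at the end.\<close>

lemma computes_edd:
  assumes levels: "computes D sz env (\<lambda>x. enc_levels (n x) (p x) (\<sigma> x))"
  shows "computes D sz env (\<lambda>x. enc_schedule (edd (n x) (\<sigma> x)))"
proof -
  note levels = levels[unfolded enc_levels_def]
  define row where "row x j = ListV [enc_nat j, IntV (p x j), IntV (\<sigma> x j)]" for x j
  note rows = levels[folded row_def]
  define xs where "xs x i = fold (insert_by (\<sigma> x)) [0..<i] []" for x i
  have set_xs: "distinct (xs x i)" "set (xs x i) = {..<i}" for x i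
    using edd_props[where n = i and \<sigma> = "\<sigma> x"] by (simp_all add: edd_def xs_def)
  have xs_Suc: "xs x (Suc i) = insert_by (\<sigma> x) i (xs x i)" for x i by (simp add: xs_def)
  have "computes D sz env (\<lambda>x. (\<lambda>x i. ListV (map (row x) (xs x i))) x (length [0..<n x]))"
  proof (rule computes_fold[OF rows])
    show "computes D sz env (\<lambda>x. ListV (map (row x) (xs x 0)))"
      using computes_Nil[OF computes_bounded_env[OF rows]] by (simp add: xs_def)
    have "poly_bounded (SIGMA x:D. {..length [0..<n x]}) (\<lambda>y. sz (fst y))
        (\<lambda>y. length [0..<n (fst y)] * bitsize (ListV (map (row (fst y)) [0..<n (fst y)])) + 1)"
      by (intro poly_bounded_add poly_bounded_mult poly_bounded_const poly_bounded_fst[OF poly_bounded_length[OF rows]]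
        poly_bounded_fst[OF computes_imp_poly_bounded[OF rows]])
    then show "poly_bounded (SIGMA x:D. {..length [0..<n x]}) (\<lambda>y. sz (fst y))
        (\<lambda>y. bitsize (ListV (map (row (fst y)) (xs (fst y) (snd y)))))"
    proof (rule poly_bounded_mono)
      fix y assume "y \<in> (SIGMA x:D. {..length [0..<n x]})"
      then have y: "snd y \<le> n (fst y)" by auto
      show "bitsize (ListV (map (row (fst y)) (xs (fst y) (snd y)))) \<le>
          length [0..<n (fst y)] * bitsize (ListV (map (row (fst y)) [0..<n (fst y)])) + 1"
      proof (rule bitsize_ListV_le)
        fix v assume "v \<in> set (map (row (fst y)) (xs (fst y) (snd y)))"
        then show "bitsize v \<le> bitsize (ListV (map (row (fst y)) [0..<n (fst y)]))"
          using y by (intro bitsize_mem) (auto simp: set_xs)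
      next
        have "length (xs (fst y) (snd y)) = snd y"
          using distinct_card[OF set_xs(1)[of "fst y" "snd y"]] by (simp add: set_xs)
        then show "length (map (row (fst y)) (xs (fst y) (snd y))) \<le> length [0..<n (fst y)]" using y by simp
      qed
    qed
  next
    fix env' let ?D = "SIGMA x:D. {..<length [0..<n x]}" and ?sz = "\<lambda>y. sz (fst y)"
    assume l: "lifts D sz env ?D ?sz env' fst"
      and v: "computes ?D ?sz env' (\<lambda>y. row (fst y) ([0..<n (fst y)] ! snd y))"
      and acc: "computes ?D ?sz env' (\<lambda>y. ListV (map (row (fst y)) (xs (fst y) (snd y))))"
    have v: "computes ?D ?sz env' (\<lambda>y. row (fst y) (snd y))" by (rule computes_cong[OF v]) auto
    have "computes ?D ?sz env' (\<lambda>y. ListV (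
        map (row (fst y)) (filter (\<lambda>i. \<sigma> (fst y) i < \<sigma> (fst y) (snd y)) (xs (fst y) (snd y))) @
        row (fst y) (snd y) # map (row (fst y)) (filter (\<lambda>i. \<sigma> (fst y) (snd y) \<le> \<sigma> (fst y) i) (xs (fst y) (snd y)))))"
    proof (rule computes_append[OF _ computes_Cons[OF v]]; rule computes_filter[OF acc])
      fix env'' let ?D' = "SIGMA y:?D. set (xs (fst y) (snd y))" and ?sz' = "\<lambda>z. sz (fst (fst z))"
      assume l': "lifts ?D ?sz env' ?D' ?sz' env'' fst"
        and w: "computes ?D' ?sz' env'' (\<lambda>z. row (fst (fst z)) (snd z))"
      note c = computes_thd[OF w[unfolded row_def]] liftsD[OF l' computes_thd[OF v[unfolded row_def]]]
      show "computes ?D' ?sz' env'' (\<lambda>z. BoolV (\<sigma> (fst (fst z)) (snd z) < \<sigma> (fst (fst z)) (snd (fst z))))"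
        "computes ?D' ?sz' env'' (\<lambda>z. BoolV (\<sigma> (fst (fst z)) (snd (fst z)) \<le> \<sigma> (fst (fst z)) (snd z)))"
        by (intro computes_less computes_le c)+
    qed
    then show "computes ?D ?sz env' (\<lambda>y. ListV (map (row (fst y)) (xs (fst y) (Suc (snd y)))))"
      by (simp add: xs_Suc insert_by_def)
  qed
  then have "computes D sz env (\<lambda>x. ListV (map (row x) (edd (n x) (\<sigma> x))))" by (simp add: xs_def edd_def)
  then have "computes D sz env (\<lambda>x. ListV (map enc_nat (edd (n x) (\<sigma> x))))"
  proof (rule computes_map)
    fix env' let ?D = "SIGMA x:D. set (edd (n x) (\<sigma> x))" and ?sz = "\<lambda>y. sz (fst y)"
    assume "computes ?D ?sz env' (\<lambda>y. row (fst y) (snd y))"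
    then show "computes ?D ?sz env' (\<lambda>y. enc_nat (snd y))" unfolding row_def by (rule computes_head)
  qed
  then show ?thesis by (simp add: enc_schedule_def)
qed

section \<open>Computing the scaled data, the breakpoints and the initial state from the
  instance\<close>

definition enc_scenario :: "rat \<times> rat list \<Rightarrow> dat" where
  "enc_scenario s = ListV [enc_rat (fst s), ListV (map enc_rat (snd s))]"

lemma enc_rat_eq: "enc_rat r = ListV [IntV (fst (quotient_of r)), IntV (snd (quotient_of r))]"
  by (simp add: enc_rat_def split: prod.split)

lemma enc_inst_eq: "enc_inst I = ListV [ListV (map enc_rat (ptimes I)), ListV (map enc_rat (weights I)),
    ListV (map enc_scenario (scenarios I))]"
  by (simp add: enc_inst_def enc_scenario_def case_prod_beta)

abbreviation inst_computes :: "(sched \<Rightarrow> dat) \<Rightarrow> bool" where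
  "inst_computes \<equiv> computes {I. valid_inst I} (\<lambda>I. bitsize (enc_inst I)) [enc_inst]"

abbreviation inst_lifts :: "'y set \<Rightarrow> ('y \<Rightarrow> nat) \<Rightarrow> ('y \<Rightarrow> dat) list \<Rightarrow> ('y \<Rightarrow> sched) \<Rightarrow> bool" where
  "inst_lifts \<equiv> lifts {I. valid_inst I} (\<lambda>I. bitsize (enc_inst I)) [enc_inst]"

lemma inst_env: "bounded_env {I. valid_inst I} (\<lambda>I. bitsize (enc_inst I)) [enc_inst]"
  by (simp add: bounded_env_def poly_bounded_size)

lemma inst_computes_enc_inst: "inst_computes (\<lambda>I. ListV [ListV (map enc_rat (ptimes I)),
    ListV (map enc_rat (weights I)), ListV (map enc_scenario (scenarios I))])"
  using computes_Var[OF inst_env, of enc_inst] unfolding enc_inst_eq[abs_def] by simp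

lemmas inst_computes_ptimes = computes_head[OF inst_computes_enc_inst]
lemmas inst_computes_weights = computes_snd[OF inst_computes_enc_inst]
lemmas inst_computes_scenarios = computes_thd[OF inst_computes_enc_inst]

lemma inst_computes_denominators_prod: "inst_computes (\<lambda>I. IntV (denominators_prod I))"
proof -
  have "inst_computes (\<lambda>I. ListV (concat (map (\<lambda>s. enc_rat (fst s) # map enc_rat (snd s)) (scenarios I))))"
  proof (rule computes_concat_map[OF inst_computes_scenarios])
    fix env' let ?D = "SIGMA I:{I. valid_inst I}. set (scenarios I)" and ?sz = "\<lambda>y. bitsize (enc_inst (fst y))"
    assume "computes ?D ?sz env' (\<lambda>y. enc_scenario (snd y))"
    note s = this[unfolded enc_scenario_def]
    show "computes ?D ?sz env' (\<lambda>y. ListV (enc_rat (fst (snd y)) # map enc_rat (snd (snd y))))"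
      by (intro computes_Cons computes_head[OF s] computes_snd[OF s])
  qed
  from computes_append[OF inst_computes_ptimes computes_append[OF inst_computes_weights this]]
  have "inst_computes (\<lambda>I. ListV (map enc_rat (all_rats I)))"
    by (simp add: all_rats_def map_concat comp_def)
  then show ?thesis unfolding denominators_prod_def
  proof (rule computes_prod)
    fix env' let ?D = "SIGMA I:{I. valid_inst I}. set (all_rats I)" and ?sz = "\<lambda>y. bitsize (enc_inst (fst y))"
    assume "computes ?D ?sz env' (\<lambda>y. enc_rat (snd y))"
    from computes_snd[OF this[unfolded enc_rat_eq]]
    show "computes ?D ?sz env' (\<lambda>y. IntV (snd (quotient_of (snd y))))" .
  qed
qed

lemma computes_to_int:
  assumes l: "inst_lifts D sz env h" and r: "computes D sz env (\<lambda>y. enc_rat (r y))"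
  shows "computes D sz env (\<lambda>y. IntV (to_int (h y) (r y)))"
  unfolding to_int_def using r[unfolded enc_rat_eq]
  by (intro computes_mult computes_div computes_head[OF r[unfolded enc_rat_eq]]
    computes_snd[OF r[unfolded enc_rat_eq]] liftsD[OF l inst_computes_denominators_prod])

lemma inst_computes_jobs: "inst_computes (\<lambda>I. ListV (map enc_nat [0..<num_jobs I]))"
  using computes_upt[OF inst_computes_ptimes] by (simp add: num_jobs_def)

lemma computes_nth_rat:
  assumes M: "computes D sz env (\<lambda>y. ListV (map enc_rat (M y)))"
    and j: "computes D sz env (\<lambda>y. enc_nat (j y))" "\<And>y. y \<in> D \<Longrightarrow> j y < length (M y)"
  shows "computes D sz env (\<lambda>y. enc_rat (M y ! j y))"
proof -
  have "computes D sz env (\<lambda>y. map enc_rat (M y) ! j y)"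
    by (rule computes_nth[OF M j(1)]) (simp add: j(2))
  then show ?thesis by (rule computes_cong) (simp add: j(2))
qed

lemma lifts_mem: "inst_lifts D sz env h \<Longrightarrow> y \<in> D \<Longrightarrow> valid_inst (h y)"
  by (auto simp: lifts_def)

lemma computes_job_time:
  assumes l: "inst_lifts D sz env h" and j: "computes D sz env (\<lambda>y. enc_nat (j y))"
    and less: "\<And>y. y \<in> D \<Longrightarrow> j y < num_jobs (h y)"
  shows "computes D sz env (\<lambda>y. IntV (job_time (h y) (j y)))"
  unfolding job_time_def using less
  by (intro computes_to_int l computes_nth_rat j liftsD[OF l inst_computes_ptimes]) (simp add: num_jobs_def)

lemma inst_computes_load: "inst_computes (\<lambda>I. IntV (load (num_jobs I) (job_time I)))"
  unfolding load_def
proof (rule computes_sum[OF inst_computes_jobs])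
  fix env' let ?D = "SIGMA I:{I. valid_inst I}. set [0..<num_jobs I]" and ?sz = "\<lambda>y. bitsize (enc_inst (fst y))"
  assume "inst_lifts ?D ?sz env' fst" "computes ?D ?sz env' (\<lambda>y. enc_nat (snd y))"
  then show "computes ?D ?sz env' (\<lambda>y. IntV (job_time (fst y) (snd y)))"
    by (rule computes_job_time) auto
qed

lemma computes_penalty:
  assumes "computes D sz env (\<lambda>y. IntV (d y))" "computes D sz env (\<lambda>y. IntV (b y))"
  shows "computes D sz env (\<lambda>y. IntV (penalty Q (d y) (b y)))"
proof (cases Q)
  case Sum_wU
  then show ?thesis using computes_less[OF assms] by (simp add: penalty_def)
next
  case Sum_wT
  then show ?thesis
    using computes_max[OF computes_Const[OF computes_bounded_env[OF assms(1)], of 0] computes_diff[OF assms(2,1)]]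
    by (simp add: penalty_def)
qed

lemma computes_job_cost:
  assumes l: "inst_lifts D sz env h" and j: "computes D sz env (\<lambda>y. enc_nat (j y))"
    and less: "\<And>y. y \<in> D \<Longrightarrow> j y < num_jobs (h y)" and b: "computes D sz env (\<lambda>y. IntV (b y))"
  shows "computes D sz env (\<lambda>y. IntV (job_cost Q (h y) (j y) (b y)))"
  unfolding job_cost_def
proof (intro computes_mult)
  have "length (weights (h y)) = num_jobs (h y)" if "y \<in> D" for y
    using lifts_mem[OF l that] by (simp add: valid_inst_def)
  then show "computes D sz env (\<lambda>y. IntV (to_int (h y) (weights (h y) ! j y)))"
    using less by (intro computes_to_int l computes_nth_rat j liftsD[OF l inst_computes_weights]) simp
  show "computes D sz env (\<lambda>y. IntV (\<Sum>s\<leftarrow>scenarios (h y). to_int (h y) (fst s) *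
      penalty Q (to_int (h y) (snd s ! j y)) (b y)))"
  proof (rule computes_sum[OF liftsD[OF l inst_computes_scenarios]])
    fix env' let ?D = "SIGMA y:D. set (scenarios (h y))" and ?sz = "\<lambda>z. sz (fst z)"
    assume l': "lifts D sz env ?D ?sz env' fst" and "computes ?D ?sz env' (\<lambda>z. enc_scenario (snd z))"
    note s = this(2)[unfolded enc_scenario_def]
    have ll: "inst_lifts ?D ?sz env' (\<lambda>z. h (fst z))" using l l' by (auto simp: lifts_def)
    have len: "j (fst z) < length (snd (snd z))" if "z \<in> ?D" for z
      using that less[of "fst z"] valid_mems(3)[OF lifts_mem[OF l, of "fst z"], of "snd z"] by auto
    show "computes ?D ?sz env' (\<lambda>z. IntV (to_int (h (fst z)) (fst (snd z)) *
        penalty Q (to_int (h (fst z)) (snd (snd z) ! j (fst z))) (b (fst z))))"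
      by (intro computes_mult computes_penalty computes_to_int[OF ll] computes_head[OF s]
        computes_nth_rat[OF computes_snd[OF s] liftsD[OF l' j] len] liftsD[OF l' b])
  qed
qed

lemma inst_computes_breakpoints:
  assumes m: "0 < m"
  shows "inst_computes (\<lambda>I. ListV (map IntV (breakpoints m I)))"
proof -
  let ?T = "\<lambda>I. load (num_jobs I) (job_time I)"
  note offs = computes_offsets[OF m inst_computes_load]
  have "inst_computes (\<lambda>I. ListV (concat (map (\<lambda>s. concat (map (\<lambda>d.
     map (\<lambda>\<delta>. IntV (to_int I d + \<delta>)) (offsets m (?T I))) (snd s))) (scenarios I))))"
  proof (rule computes_concat_map[OF inst_computes_scenarios])
    fix env' let ?D = "SIGMA I:{I. valid_inst I}. set (scenarios I)" and ?sz = "\<lambda>y. bitsize (enc_inst (fst y))"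
    assume l: "inst_lifts ?D ?sz env' fst" and "computes ?D ?sz env' (\<lambda>y. enc_scenario (snd y))"
    note s = this(2)[unfolded enc_scenario_def]
    show "computes ?D ?sz env' (\<lambda>y. ListV (concat (map (\<lambda>d.
       map (\<lambda>\<delta>. IntV (to_int (fst y) d + \<delta>)) (offsets m (?T (fst y)))) (snd (snd y)))))"
    proof (rule computes_concat_map[OF computes_snd[OF s]])
      fix env'' let ?D' = "SIGMA y:?D. set (snd (snd y))" and ?sz' = "\<lambda>z. bitsize (enc_inst (fst (fst z)))"
      assume l': "lifts ?D ?sz env' ?D' ?sz' env'' fst" and d: "computes ?D' ?sz' env'' (\<lambda>z. enc_rat (snd z))"
      have ll: "inst_lifts ?D' ?sz' env'' (\<lambda>z. fst (fst z))" using l l' by (auto simp: lifts_def)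
      note d' = computes_to_int[OF ll d]
      show "computes ?D' ?sz' env'' (\<lambda>z. ListV (map (\<lambda>\<delta>. IntV (to_int (fst (fst z)) (snd z) + \<delta>)) (offsets m (?T (fst (fst z))))))"
        by (rule computes_map[OF liftsD[OF ll offs]]) (intro computes_add liftsD[OF _ d'])
    qed
  qed
  from computes_Cons[OF computes_Const[OF inst_env, of 0] computes_Cons[OF inst_computes_load this]]
  show ?thesis by (simp add: breakpoints_def map_concat comp_def)
qed

definition state_at :: "problem \<Rightarrow> int \<Rightarrow> sched \<Rightarrow> nat \<Rightarrow> state" where
  "state_at Q m I i = (step (num_jobs I) (job_time I) (breakpoints m I) ^^ i) (\<lambda>_. 0, job_cost Q I, [])"

abbreviation enc_state_at :: "problem \<Rightarrow> int \<Rightarrow> sched \<Rightarrow> nat \<Rightarrow> dat" where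
  "enc_state_at Q m I i \<equiv> enc_state (num_jobs I) (job_time I) (breakpoints m I) (state_at Q m I i)"

lemma inst_computes_initial_state:
  assumes m: "0 < m"
  shows "inst_computes (\<lambda>I. enc_state_at Q m I 0)"
proof -
  note bps = inst_computes_breakpoints[OF m]
  have "inst_computes (\<lambda>I. ListV (map (enc_row (job_time I) (breakpoints m I) (\<lambda>_. 0) (job_cost Q I)) [0..<num_jobs I]))"
  proof (rule computes_map[OF inst_computes_jobs])
    fix env' let ?D = "SIGMA I:{I. valid_inst I}. set [0..<num_jobs I]" and ?sz = "\<lambda>y. bitsize (enc_inst (fst y))"
    assume l: "inst_lifts ?D ?sz env' fst" and j: "computes ?D ?sz env' (\<lambda>y. enc_nat (snd y))"
    have g: "computes ?D ?sz env' (\<lambda>y. ListV (map (\<lambda>u. ListV [IntV u, IntV (job_cost Q (fst y) (snd y) u)]) (breakpoints m (fst y))))"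
    proof (rule computes_map[OF liftsD[OF l bps]])
      fix env'' let ?D' = "SIGMA y:?D. set (breakpoints m (fst y))" and ?sz' = "\<lambda>z. bitsize (enc_inst (fst (fst z)))"
      assume l': "lifts ?D ?sz env' ?D' ?sz' env'' fst" and u: "computes ?D' ?sz' env'' (\<lambda>z. IntV (snd z))"
      have ll: "inst_lifts ?D' ?sz' env'' (\<lambda>z. fst (fst z))" using l l' by (auto simp: lifts_def)
      have "computes ?D' ?sz' env'' (\<lambda>z. IntV (job_cost Q (fst (fst z)) (snd (fst z)) (snd z)))"
        by (rule computes_job_cost[OF ll liftsD[OF l' j] _ u]) auto
      then show "computes ?D' ?sz' env'' (\<lambda>z. ListV [IntV (snd z), IntV (job_cost Q (fst (fst z)) (snd (fst z)) (snd z))])"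
        by (intro computes_Cons computes_Nil u lifts_bounded_env[OF l'])
    qed
    have "computes ?D ?sz env' (\<lambda>y. IntV (job_time (fst y) (snd y)))"
      by (rule computes_job_time[OF l j]) auto
    then show "computes ?D ?sz env' (\<lambda>y. enc_row (job_time (fst y)) (breakpoints m (fst y)) (\<lambda>_. 0) (job_cost Q (fst y)) (snd y))"
      unfolding enc_row_def
      by (intro computes_Cons computes_Nil j computes_Const g lifts_bounded_env[OF l])
  qed
  then show ?thesis unfolding enc_state_def state_at_def
    by (auto intro!: computes_Cons computes_Nil inst_env)
qed

section \<open>Bit lengths during the iteration\<close>

context cover_instance
begin

lemma load_nonneg: "0 \<le> load n p"
  unfolding load_eq by (rule sum_nonneg) (use p_nonneg in auto)

text \<open>By \<open>reduce_le\<close> an effective step multiplies costs by at most the load. The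
  base \<open>load n p + 1\<close> is at least 1, so that rounds without effect satisfy the bound
  too.\<close>

lemma step_invariant:
  assumes "valid_state r0 g0" "(step n p B ^^ i) (r0, g0, []) = (r, g, l)"
  shows "valid_state r g \<and> (\<forall>j<n. \<forall>u\<in>set B. g j u \<le> g0 j u * (load n p + 1) ^ i) \<and> length l \<le> i \<and>
    (\<forall>e\<in>set l. fst e < n \<and> fst (snd e) \<in> set B \<and> snd (snd e) \<in> set B)"
  using assms(2)
proof (induction i arbitrary: r g l)
  case 0 then show ?case using assms(1) by simp
next
  case (Suc i)
  obtain r1 g1 l1 where st: "(step n p B ^^ i) (r0, g0, []) = (r1, g1, l1)"
    by (cases "(step n p B ^^ i) (r0, g0, [])") auto
  note IH = Suc.IH[OF st]
  have eq: "(r, g, l) = step n p B (r1, g1, l1)" using Suc.prems st by simp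
  let ?T = "load n p"
  have pow: "0 \<le> (?T + 1) ^ i" using load_nonneg by simp
  have mono: "x \<le> g0 j u * (?T + 1) ^ Suc i" if "x \<le> g1 j u * (?T + 1)" "j < n" "u \<in> set B" for x j u
  proof -
    have "g1 j u * (?T + 1) \<le> g0 j u * (?T + 1) ^ i * (?T + 1)"
      using IH that(2,3) load_nonneg by (intro mult_right_mono) auto
    then show ?thesis using that(1) by (simp add: mult_ac)
  qed
  have g1: "0 \<le> g1 j u" if "j < n" "u \<in> set B" for j u using IH that by (simp add: valid_state_def)
  show ?case
  proof (cases "covers n p B r1")
    case True
    then have "r = r1" "g = g1" "l = l1" using eq by (auto simp: step_def)
    moreover have "g1 j u \<le> g1 j u * (?T + 1)" if "j < n" "u \<in> set B" for j u
      using g1[OF that] load_nonneg by (simp add: algebra_simps)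
    ultimately show ?thesis using IH mono by auto
  next
    case False
    obtain j u where ju: "pick n p B r1 g1 = (j, u)" by fastforce
    have v: "valid_state r1 g1" using IH by simp
    have "r = r1(j := u)" "g = reduce n p B r1 g1 j u" "l = (j, r1 j, u) # l1"
      using eq False ju by (auto simp: step_def)
    moreover have "reduce n p B r1 g1 j u i' v' \<le> g1 i' v' * (?T + 1)" if "i' < n" "v' \<in> set B" for i' v'
      using reduce_le[OF v False ju that] g1[OF that] by (simp add: algebra_simps)
    ultimately show ?thesis
      using IH mono valid_state_step[OF v False ju] picked[OF v False ju] by (auto simp: valid_state_def)
  qed
qed

end

lemma ibits_power: "ibits (a ^ i) \<le> i * ibits a + 1"
proof (induction i)
  case (Suc i)
  then show ?case using ibits_mult[of a "a ^ i"] by simp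
qed (simp add: compute_floorlog)

lemma bitsize_enc_state_le:
  assumes r: "\<And>j. j < n \<Longrightarrow> bitsize (enc_nat j) \<le> M \<and> bitsize (IntV (p j)) \<le> M \<and> bitsize (IntV (r j)) \<le> M"
    and g: "\<And>j u. j < n \<Longrightarrow> u \<in> set B \<Longrightarrow> bitsize (IntV u) \<le> M \<and> bitsize (IntV (g j u)) \<le> M"
    and l: "\<And>e. e \<in> set l \<Longrightarrow> bitsize (enc_entry e) \<le> 3 * M + 1" "length l \<le> k"
  shows "bitsize (enc_state n p B (r, g, l)) \<le>
    n * (3 * M + (length B * (2 * M + 1) + 1) + 1) + 1 + (k * (3 * M + 1) + 1) + 1"
proof -
  have row: "bitsize (enc_row p B r g j) \<le> 3 * M + (length B * (2 * M + 1) + 1) + 1" if j: "j < n" for j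
  proof -
    have "bitsize (ListV (map (\<lambda>u. ListV [IntV u, IntV (g j u)]) B)) \<le> length B * (2 * M + 1) + 1"
    proof (rule bitsize_ListV_le)
      fix v assume "v \<in> set (map (\<lambda>u. ListV [IntV u, IntV (g j u)]) B)"
      then obtain u where u: "u \<in> set B" "v = ListV [IntV u, IntV (g j u)]" by auto
      show "bitsize v \<le> 2 * M + 1" using g[OF j u(1)] unfolding u(2) by simp
    qed simp
    then show ?thesis using r[OF j] unfolding enc_row_def by simp
  qed
  have "bitsize (ListV (map (enc_row p B r g) [0..<n])) \<le> n * (3 * M + (length B * (2 * M + 1) + 1) + 1) + 1"
    by (rule bitsize_ListV_le) (use row in auto)
  moreover have "bitsize (ListV (map enc_entry l)) \<le> k * (3 * M + 1) + 1"
    by (rule bitsize_ListV_le) (use l in auto)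
  ultimately show ?thesis unfolding enc_state_def by simp
qed

definition num_steps :: "int \<Rightarrow> sched \<Rightarrow> nat" where
  "num_steps m I = num_jobs I * length (breakpoints m I)"

lemma state_at_num_steps: "state_at Q m I (num_steps m I) = final_state Q m I"
  by (simp add: state_at_def num_steps_def final_state_def)

text \<open>Applied to the initial state, which is computed in polynomial time and hence has
  polynomial size: this bounds the initial numbers without explicit estimates of job costs.\<close>

lemma bitsize_row_le:
  assumes "j < n"
  shows "bitsize (enc_nat j) \<le> bitsize (enc_state n p B (r, g, l))"
    and "bitsize (IntV (p j)) \<le> bitsize (enc_state n p B (r, g, l))"
    and "u \<in> set B \<Longrightarrow> bitsize (IntV (g j u)) \<le> bitsize (enc_state n p B (r, g, l))"
proof -
  have "bitsize (enc_row p B r g j) \<le> bitsize (ListV (map (enc_row p B r g) [0..<n]))"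
    using assms by (intro bitsize_mem) auto
  then have row: "bitsize (enc_row p B r g j) \<le> bitsize (enc_state n p B (r, g, l))"
    by (simp add: enc_state_def)
  show "bitsize (enc_nat j) \<le> bitsize (enc_state n p B (r, g, l))"
    "bitsize (IntV (p j)) \<le> bitsize (enc_state n p B (r, g, l))"
    using row by (simp_all add: enc_row_def)
  assume u: "u \<in> set B"
  have "bitsize (IntV (g j u)) \<le> bitsize (ListV [IntV u, IntV (g j u)])" by simp
  also have "\<dots> \<le> bitsize (ListV (map (\<lambda>u. ListV [IntV u, IntV (g j u)]) B))"
    using u by (intro bitsize_mem) auto
  also have "\<dots> \<le> bitsize (enc_row p B r g j)" unfolding enc_row_def by (rule bitsize_mem) simp
  finally show "bitsize (IntV (g j u)) \<le> bitsize (enc_state n p B (r, g, l))" using row by simp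
qed

lemma poly_bounded_num_steps:
  assumes "0 < m"
  shows "poly_bounded {I. valid_inst I} (\<lambda>I. bitsize (enc_inst I)) (num_steps m)"
  unfolding num_steps_def[abs_def]
  using poly_bounded_length[OF inst_computes_jobs] poly_bounded_length[OF inst_computes_breakpoints[OF assms]]
  by (intro poly_bounded_mult) simp_all

context
  fixes Q :: problem and m :: int and I :: sched
  assumes m: "0 < m" and I: "valid_inst I"
begin

interpretation cover_instance "num_jobs I" "job_time I" "breakpoints m I"
  by (rule cover_instance[OF I])

lemma state_at_invariant:
  assumes "state_at Q m I i = (r, g, l)"
  shows "\<forall>j<num_jobs I. r j \<in> set (breakpoints m I)"
    "\<forall>j<num_jobs I. \<forall>u\<in>set (breakpoints m I). 0 \<le> g j u \<and>
      g j u \<le> job_cost Q I j u * (load (num_jobs I) (job_time I) + 1) ^ i"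
    "length l \<le> i"
    "\<forall>e\<in>set l. fst e < num_jobs I \<and> fst (snd e) \<in> set (breakpoints m I) \<and> snd (snd e) \<in> set (breakpoints m I)"
  using step_invariant[OF valid_init[OF I] assms[unfolded state_at_def]]
  unfolding valid_state_def by blast+

lemma fold_undo_mem:
  assumes "\<forall>j<num_jobs I. r j \<in> set (breakpoints m I)" "\<forall>e\<in>set l. fst (snd e) \<in> set (breakpoints m I)"
  shows "\<forall>j<num_jobs I. fold (undo (num_jobs I) (job_time I) (breakpoints m I)) l r j \<in> set (breakpoints m I)"
  using assms
proof (induction l arbitrary: r)
  case (Cons e l)
  have "\<forall>j<num_jobs I. undo (num_jobs I) (job_time I) (breakpoints m I) e r j \<in> set (breakpoints m I)"
    using Cons.prems by (auto simp: undo_def split: prod.split)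
  then show ?case using Cons by simp
qed simp

lemma bitsize_breakpoint: "u \<in> set (breakpoints m I) \<Longrightarrow> bitsize (IntV u) \<le> bitsize (ListV (map IntV (breakpoints m I)))"
  by (rule bitsize_mem) simp

text \<open>\<open>M\<close> bounds every number in the state: job numbers and sizes by the initial
  state, deadlines by the breakpoint list, residual costs by their initial bits plus those of a
  power of the load plus 1.\<close>

lemma bitsize_state_at_le:
  assumes i: "i \<le> num_steps m I"
    and M: "M = bitsize (enc_state_at Q m I 0) + bitsize (ListV (map IntV (breakpoints m I))) +
      num_steps m I * bitsize (IntV (load (num_jobs I) (job_time I) + 1)) + 1"
  shows "bitsize (enc_state_at Q m I i) \<le> num_jobs I * (3 * M + (length (breakpoints m I) * (2 * M + 1) + 1) + 1) + 1
    + (num_steps m I * (3 * M + 1) + 1) + 1"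
proof -
  obtain r g l where s: "state_at Q m I i = (r, g, l)" by (cases "state_at Q m I i") auto
  note inv = state_at_invariant[OF s]
  let ?T = "load (num_jobs I) (job_time I) + 1"
  have s0: "state_at Q m I 0 = (\<lambda>_. 0, job_cost Q I, [])" by (simp add: state_at_def)
  note row0 = bitsize_row_le[where n = "num_jobs I" and p = "job_time I" and B = "breakpoints m I" and
      r = "\<lambda>_. 0" and g = "job_cost Q I" and l = "[]", folded s0]
  have bp: "bitsize (IntV u) \<le> M" if "u \<in> set (breakpoints m I)" for u
    using bitsize_breakpoint[OF that] unfolding M by linarith
  have nat: "bitsize (enc_nat j) \<le> M" if "j < num_jobs I" for j
    using row0(1)[OF that] unfolding M by linarith
  show ?thesis unfolding s
  proof (rule bitsize_enc_state_le)
    fix j assume j: "j < num_jobs I"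
    have "bitsize (IntV (job_time I j)) \<le> M" using row0(2)[OF j] unfolding M by linarith
    then show "bitsize (enc_nat j) \<le> M \<and> bitsize (IntV (job_time I j)) \<le> M \<and> bitsize (IntV (r j)) \<le> M"
      using nat[OF j] bp inv(1) j by blast
    fix u assume u: "u \<in> set (breakpoints m I)"
    have "\<bar>g j u\<bar> \<le> \<bar>job_cost Q I j u * ?T ^ i\<bar>" using inv(2) j u by force
    then have "ibits (g j u) \<le> ibits (job_cost Q I j u * ?T ^ i)" by (rule ibits_mono)
    also have "\<dots> \<le> ibits (job_cost Q I j u) + (i * ibits ?T + 1)"
      using ibits_mult[of "job_cost Q I j u" "?T ^ i"] ibits_power[of ?T i] by linarith
    also have "i * ibits ?T \<le> num_steps m I * bitsize (IntV ?T)" using i by (intro mult_le_mono) auto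
    finally have "bitsize (IntV (g j u)) \<le> bitsize (IntV (job_cost Q I j u)) + num_steps m I * bitsize (IntV ?T) + 1"
      by simp
    then have "bitsize (IntV (g j u)) \<le> M" using row0(3)[OF j u] unfolding M by linarith
    then show "bitsize (IntV u) \<le> M \<and> bitsize (IntV (g j u)) \<le> M" using bp[OF u] by blast
  next
    fix e assume "e \<in> set l"
    then show "bitsize (enc_entry e) \<le> 3 * M + 1"
      using inv(4) nat[of "fst e"] bp[of "fst (snd e)"] bp[of "snd (snd e)"] unfolding enc_entry_def by fastforce
  next
    show "length l \<le> num_steps m I" using inv(3) i by simp
  qed
qed

end

lemma inst_computes_final_state:
  assumes m: "0 < m"
  shows "inst_computes (\<lambda>I. enc_state (num_jobs I) (job_time I) (breakpoints m I) (final_state Q m I))"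
proof -
  note bps = inst_computes_breakpoints[OF m]
  \<comment> \<open>A unary loop counter: only the length of this list matters, which is the number
    of steps.\<close>
  define L where "L I = concat (map (\<lambda>j. breakpoints m I) [0..<num_jobs I])" for I
  have len: "length (L I) = num_steps m I" for I
    by (simp add: L_def num_steps_def length_concat comp_def sum_list_triv)
  have "inst_computes (\<lambda>I. ListV (concat (map (\<lambda>j. map IntV (breakpoints m I)) [0..<num_jobs I])))"
    by (rule computes_concat_map[OF inst_computes_jobs]) (rule liftsD[OF _ bps])
  then have L: "inst_computes (\<lambda>I. ListV (map IntV (L I)))" by (simp add: L_def map_concat comp_def)
  have "inst_computes (\<lambda>I. (\<lambda>I i. enc_state_at Q m I i) I (length (L I)))"
  proof (rule computes_fold[OF L])
    show "inst_computes (\<lambda>I. enc_state_at Q m I 0)" by (rule inst_computes_initial_state[OF m])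
    let ?D = "SIGMA I:{I. valid_inst I}. {..length (L I)}" and ?sz = "\<lambda>y. bitsize (enc_inst (fst y))"
    let ?M = "\<lambda>I. bitsize (enc_state_at Q m I 0) + bitsize (ListV (map IntV (breakpoints m I))) +
      num_steps m I * bitsize (IntV (load (num_jobs I) (job_time I) + 1)) + 1"
    have "poly_bounded {I. valid_inst I} (\<lambda>I. bitsize (enc_inst I)) num_jobs"
      using poly_bounded_length[OF inst_computes_jobs] by simp
    then have "poly_bounded {I. valid_inst I} (\<lambda>I. bitsize (enc_inst I)) (\<lambda>I.
        num_jobs I * (3 * ?M I + (length (breakpoints m I) * (2 * ?M I + 1) + 1) + 1) + 1
        + (num_steps m I * (3 * ?M I + 1) + 1) + 1)"
      by (intro poly_bounded_add poly_bounded_mult poly_bounded_const poly_bounded_length[OF bps]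
        poly_bounded_num_steps[OF m] computes_imp_poly_bounded[OF inst_computes_initial_state[OF m]]
        computes_imp_poly_bounded[OF bps]
        computes_imp_poly_bounded[OF computes_add[OF inst_computes_load computes_Const[OF inst_env]]])
    then have "poly_bounded ?D ?sz (\<lambda>y. 
        num_jobs (fst y) * (3 * ?M (fst y) + (length (breakpoints m (fst y)) * (2 * ?M (fst y) + 1) + 1) + 1) + 1
        + (num_steps m (fst y) * (3 * ?M (fst y) + 1) + 1) + 1)"
      by (rule poly_bounded_fst)
    then show "poly_bounded ?D ?sz (\<lambda>y. bitsize (enc_state_at Q m (fst y) (snd y)))"
    proof (rule poly_bounded_mono)
      fix y assume "y \<in> ?D"
      then show "bitsize (enc_state_at Q m (fst y) (snd y)) \<le>
        num_jobs (fst y) * (3 * ?M (fst y) + (length (breakpoints m (fst y)) * (2 * ?M (fst y) + 1) + 1) + 1) + 1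
        + (num_steps m (fst y) * (3 * ?M (fst y) + 1) + 1) + 1"
        by (intro bitsize_state_at_le[OF m _ _ refl]) (auto simp: len)
    qed
  next
    fix env' let ?D = "SIGMA I:{I. valid_inst I}. {..<length (L I)}" and ?sz = "\<lambda>y. bitsize (enc_inst (fst y))"
    assume l: "inst_lifts ?D ?sz env' fst" and s: "computes ?D ?sz env' (\<lambda>y. enc_state_at Q m (fst y) (snd y))"
    have "computes ?D ?sz env' (\<lambda>y. enc_state (num_jobs (fst y)) (job_time (fst y)) (breakpoints m (fst y))
       (step (num_jobs (fst y)) (job_time (fst y)) (breakpoints m (fst y)) (state_at Q m (fst y) (snd y))))"
      by (rule computes_step[OF s liftsD[OF l inst_computes_load] liftsD[OF l bps]])
        (auto intro: cover_instance)
    then show "computes ?D ?sz env' (\<lambda>y. enc_state_at Q m (fst y) (Suc (snd y)))" by (simp add: state_at_def)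
  qed
  then show ?thesis by (simp add: len state_at_num_steps)
qed

lemma inst_computes_deadlines:
  assumes m: "0 < m"
  shows "inst_computes (\<lambda>I. enc_levels (num_jobs I) (job_time I) (deadlines Q m I))"
proof -
  note bps = inst_computes_breakpoints[OF m]
  note state = inst_computes_final_state[OF m, of Q, unfolded enc_state_def]
  define r where "r I = fst (final_state Q m I)" for I
  define l where "l I = snd (snd (final_state Q m I))" for I
  \<comment> \<open>The log has the latest move in front, so these are the deadlines after treating
    the \<open>i\<close> latest moves.\<close>
  define \<sigma> where "\<sigma> I i = fold (undo (num_jobs I) (job_time I) (breakpoints m I)) (take i (l I)) (r I)" for I i
  have final: "state_at Q m I (num_steps m I) = (r I, fst (snd (final_state Q m I)), l I)" for I
    unfolding state_at_num_steps by (simp add: r_def l_def)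
  have log: "inst_computes (\<lambda>I. ListV (map enc_entry (l I)))"
    unfolding l_def by (rule computes_snd[OF state])
  have "inst_computes (\<lambda>I. ListV (map (\<lambda>j. ListV [enc_nat j, IntV (job_time I j), IntV (r I j)]) [0..<num_jobs I]))"
  proof (rule computes_map[OF computes_head[OF state]])
    fix env' let ?D = "SIGMA I:{I. valid_inst I}. set [0..<num_jobs I]" and ?sz = "\<lambda>y. bitsize (enc_inst (fst y))"
    assume l: "inst_lifts ?D ?sz env' fst" and "computes ?D ?sz env' (\<lambda>y. enc_row (job_time (fst y))
      (breakpoints m (fst y)) (fst (final_state Q m (fst y))) (fst (snd (final_state Q m (fst y)))) (snd y))"
    note v = this(2)[unfolded enc_row_def, folded r_def]
    show "computes ?D ?sz env' (\<lambda>y. ListV [enc_nat (snd y), IntV (job_time (fst y) (snd y)), IntV (r (fst y) (snd y))])"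
      by (intro computes_Cons computes_Nil computes_head[OF v] computes_snd[OF v] computes_thd[OF v] lifts_bounded_env[OF l])
  qed
  then have init: "inst_computes (\<lambda>I. enc_levels (num_jobs I) (job_time I) (\<sigma> I 0))"
    by (simp add: enc_levels_def \<sigma>_def)
  have "inst_computes (\<lambda>I. (\<lambda>I i. enc_levels (num_jobs I) (job_time I) (\<sigma> I i)) I (length (l I)))"
  proof (rule computes_fold[OF log])
    show "inst_computes (\<lambda>I. enc_levels (num_jobs I) (job_time I) (\<sigma> I 0))" by (rule init)
    let ?D = "SIGMA I:{I. valid_inst I}. {..length (l I)}" and ?sz = "\<lambda>y. bitsize (enc_inst (fst y))"
    \<comment> \<open>Undoing assigns old deadlines from the log, so all deadlines stay breakpoints;
      job numbers and sizes already occur in the initial state.\<close>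
    let ?M = "\<lambda>I. bitsize (enc_state_at Q m I 0) + bitsize (ListV (map IntV (breakpoints m I)))"
    have "poly_bounded {I. valid_inst I} (\<lambda>I. bitsize (enc_inst I)) num_jobs"
      using poly_bounded_length[OF inst_computes_jobs] by simp
    then have "poly_bounded {I. valid_inst I} (\<lambda>I. bitsize (enc_inst I)) (\<lambda>I. num_jobs I * (3 * ?M I + 1) + 1)"
      by (intro poly_bounded_add poly_bounded_mult poly_bounded_const
        computes_imp_poly_bounded[OF inst_computes_initial_state[OF m]] computes_imp_poly_bounded[OF bps])
    then have "poly_bounded ?D ?sz (\<lambda>y. num_jobs (fst y) * (3 * ?M (fst y) + 1) + 1)"
      by (rule poly_bounded_fst)
    then show "poly_bounded ?D ?sz (\<lambda>y. bitsize (enc_levels (num_jobs (fst y)) (job_time (fst y)) (\<sigma> (fst y) (snd y))))"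
    proof (rule poly_bounded_mono)
      fix y assume y: "y \<in> ?D"
      define I where "I = fst y"
      have I: "valid_inst I" using y by (auto simp: I_def)
      note inv = state_at_invariant[OF m I final]
      have \<sigma>: "\<forall>j<num_jobs I. \<sigma> I (snd y) j \<in> set (breakpoints m I)"
        unfolding \<sigma>_def by (rule fold_undo_mem[OF m I]) (use inv in \<open>auto dest: in_set_takeD\<close>)
      have s0: "state_at Q m I 0 = (\<lambda>_. 0, job_cost Q I, [])" by (simp add: state_at_def)
      note row0 = bitsize_row_le[where n = "num_jobs I" and p = "job_time I" and B = "breakpoints m I" and
      r = "\<lambda>_. 0" and g = "job_cost Q I" and l = "[]", folded s0]
      show "bitsize (enc_levels (num_jobs (fst y)) (job_time (fst y)) (\<sigma> (fst y) (snd y))) \<le>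
          num_jobs (fst y) * (3 * ?M (fst y) + 1) + 1"
        unfolding I_def[symmetric] enc_levels_def
      proof (rule bitsize_ListV_le)
        fix v assume "v \<in> set (map (\<lambda>j. ListV [enc_nat j, IntV (job_time I j), IntV (\<sigma> I (snd y) j)]) [0..<num_jobs I])"
        then obtain j where j: "j < num_jobs I" "v = ListV [enc_nat j, IntV (job_time I j), IntV (\<sigma> I (snd y) j)]"
          by auto
        have "bitsize (enc_nat j) \<le> ?M I" "bitsize (IntV (job_time I j)) \<le> ?M I"
          using row0(1,2)[OF j(1)] by linarith+
        moreover have "bitsize (IntV (\<sigma> I (snd y) j)) \<le> ?M I"
          using bitsize_breakpoint[OF m I] \<sigma> j(1) trans_le_add2 by blast
        ultimately show "bitsize v \<le> 3 * ?M I + 1" unfolding j(2) by simp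
      qed simp
    qed
  next
    fix env' let ?D = "SIGMA I:{I. valid_inst I}. {..<length (l I)}" and ?sz = "\<lambda>y. bitsize (enc_inst (fst y))"
    assume lift: "inst_lifts ?D ?sz env' fst" and e: "computes ?D ?sz env' (\<lambda>y. enc_entry (l (fst y) ! snd y))"
      and levels: "computes ?D ?sz env' (\<lambda>y. enc_levels (num_jobs (fst y)) (job_time (fst y)) (\<sigma> (fst y) (snd y)))"
    have "computes ?D ?sz env' (\<lambda>y. enc_levels (num_jobs (fst y)) (job_time (fst y))
       (undo (num_jobs (fst y)) (job_time (fst y)) (breakpoints m (fst y)) (l (fst y) ! snd y) (\<sigma> (fst y) (snd y))))"
    proof (rule computes_undo[OF levels liftsD[OF lift inst_computes_load] liftsD[OF lift bps] _ e])
      fix y assume "y \<in> ?D"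
      then have y: "valid_inst (fst y)" "l (fst y) ! snd y \<in> set (l (fst y))" by auto
      show "fst (l (fst y) ! snd y) < num_jobs (fst y)"
        using state_at_invariant(4)[OF m y(1) final] y(2) by blast
      show "breakpoints m (fst y) \<noteq> []" by (simp add: breakpoints_def)
    qed
    then show "computes ?D ?sz env' (\<lambda>y. enc_levels (num_jobs (fst y)) (job_time (fst y)) (\<sigma> (fst y) (Suc (snd y))))"
      by (rule computes_cong) (auto simp: \<sigma>_def take_Suc_conv_app_nth)
  qed
  then show ?thesis by (simp add: \<sigma>_def deadlines_def r_def l_def case_prod_beta)
qed

lemma polynomial_time_schedule:
  assumes "0 < m"
  shows "polynomial_time_on {I. valid_inst I} enc_inst enc_schedule (schedule Q m)"
  unfolding schedule_def[abs_def]
  by (rule computes_imp_polynomial_time, rule computes_edd, rule inst_computes_deadlines[OF assms])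

theorem theorem11:
  fixes Q :: problem and \<epsilon> \<alpha> :: real
  assumes "\<epsilon> > 0" and "0 \<le> \<alpha>" and "\<alpha> < 1"
  shows "approximable_within (min_exp_objective Q) (\<lambda>I. 4 + \<epsilon>) \<and>
    approximable_within (min_cvar_objective \<alpha> Q)
      (\<lambda>I. min ((4 + \<epsilon>) / prob_min I) ((4 + \<epsilon>) / (1 - \<alpha>)))"
  by (rule approximable_if_polynomial_time[OF assms polynomial_time_schedule])

end
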